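(* Let $n\ge 2$, and let $K,T\subseteq \mathbb{R}^n$ be compact sets with connected boundary. For any $\lambda \in(0,1)$, $$\mathrm{vol}(\lambda\,\partial K+(1-\lambda)\,\partial T)\;\mathrm{vol}(\lambda\,\partial T+(1-\lambda)\,\partial K)\ge \mathrm{vol}(K)\,\mathrm{vol}(T)\cdot \left(1-|1-2\lambda|^n\right)^2.$$ Moreover, when $K$ and $T$ are convex bodies and $\lambda\neq 1/2$, equality holds if and only if either $K$ and $T$ are both translations of some (common) centrally-symmetric body, or $n=2$ and $K,T\subseteq\mathbb{R}^2$ are translations of homothets of some (common) centrally-symmetric body.
   Context: $\mathrm{vol}$ denotes Lebesgue measure on $\mathbb{R}^n$; $\partial A$ is the topological boundary of $A$; $A+B=\{a+b: a\in A, b\in B\}$ and $\lambda A=\{\lambda a: a\in A\}$. A convex body is a compact convex set with non-empty interior; a convex body $M$ is centrally-symmetric if $M=-M$; a homothet of $M$ is a set $aM$ with $a>0$. Each of $K$ and $T$ separately is assumed to have connected boundary. *)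

theory Defs
  imports "HOL-Analysis.Analysis" "HOL-Library.Set_Algebras"
begin

definition convex_body :: "(real ^ 'n) set \<Rightarrow> bool" where
  "convex_body M \<longleftrightarrow> compact M \<and> convex M \<and> interior M \<noteq> {}"

text \<open>The unary minus on sets is complementation, so the reflection of \<open>M\<close> is written as an image.\<close>

definition centrally_symmetric_body :: "(real ^ 'n) set \<Rightarrow> bool" where
  "centrally_symmetric_body M \<longleftrightarrow> convex_body M \<and> M = uminus ` M"

definition is_homothet_of :: "(real ^ 'n) set \<Rightarrow> (real ^ 'n) set \<Rightarrow> bool" where
  "is_homothet_of H M \<longleftrightarrow> (\<exists>a>0. H = (*\<^sub>R) a ` M)"

definition is_translation_of :: "(real ^ 'n) set \<Rightarrow> (real ^ 'n) set \<Rightarrow> bool" where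
  "is_translation_of A M \<longleftrightarrow> (\<exists>v. A = (+) v ` M)"

text \<open>The sum of sets below is the Minkowski sum of \<open>HOL-Library.Set_Algebras\<close>.\<close>

definition mink_comb :: "real \<Rightarrow> (real ^ 'n) set \<Rightarrow> (real ^ 'n) set \<Rightarrow> (real ^ 'n) set" where
  "mink_comb l A B = (*\<^sub>R) l ` A + (*\<^sub>R) (1 - l) ` B"

end

theory Submission
  imports Defs
begin

text \<open>
  Put \<open>X = \<lambda>K\<close> and \<open>Y = (1 - \<lambda>)T\<close>, of volumes \<open>a\<^sup>n\<close> and \<open>b\<^sup>n\<close>. A point \<open>z\<close> of \<open>X + Y\<close> outside
  \<open>\<partial>X + \<partial>Y\<close> is one for which \<open>X\<close> and \<open>z - Y\<close> meet but their boundaries do not; as the boundaries are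
  connected, one of the two sets contains the other. By Brunn-Minkowski such \<open>z\<close> fill at most the
  volume \<open>\<bar>a - b\<bar>\<^sup>n\<close>, while \<open>X + Y\<close> has volume at least \<open>(a + b)\<^sup>n\<close>. It remains to bound the product of
  two expressions \<open>(a + b)\<^sup>n - \<bar>a - b\<bar>\<^sup>n\<close>, which is a log-convexity statement proved by applying
  Cauchy-Schwarz to the odd part of the binomial expansion.

  Equality forces equality in Brunn-Minkowski for \<open>X, Y\<close> and for \<open>{z. z - Y \<subseteq> X}, -Y\<close>, so that
  \<open>X\<close> is homothetic to \<open>Y\<close> and to \<open>-Y\<close>. The equality case of Brunn-Minkowski
  is obtained from Bonnesen's refinement: if \<open>\<alpha>, \<beta>\<close> denote the \<open>(n-1)\<close>-st roots of the largest sections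
  of \<open>A, B\<close> by parallel hyperplanes, then
  \<open>vol (A + B) \<ge> (\<alpha> + \<beta>)\<^sup>n\<^sup>-\<^sup>1 (vol A / \<alpha>\<^sup>n\<^sup>-\<^sup>1 + vol B / \<beta>\<^sup>n\<^sup>-\<^sup>1)\<close>.
  Equality is inherited by the halves that a hyperplane cuts off in the same proportion from \<open>A\<close> and \<open>B\<close>;
  comparing the largest sections of these halves shows that all sections at matching quantiles have
  the same ratio, whence the marginals of \<open>A\<close> and \<open>B\<close> in every direction agree up to an affine map,
  and comparing centroids makes the translations coherent.
\<close>

section \<open>One-dimensional inequalities\<close>

text \<open>Each factor of the product is bounded below by a gap (a + b)^n - |a - b|^n, so equality
  in the product forces equality in both factors and, separately, in the numerical inequality for
  the roots \<open>k\<close>, \<open>t\<close> of the two volumes. In the plane the numerical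
  inequality is an identity, which leaves the ratio of \<open>k\<close> and \<open>t\<close> free;
  from dimension three on the odd terms of degree 1 and 3 both occur, and their proportionality
  forces \<open>k = t\<close>. Central symmetry can be read off only where one scaled body is
  strictly larger than the other, since only then the missed points have positive volume;
  \<open>\<lambda> \<noteq> 1/2\<close> ensures this for at least one of the two factors. Bonnesen's
  form is chosen because its equality case yields one relation between two suprema, with no
  regularity of the sets assumed; cutting both sets turns this into a relation for every section of
  convex bodies. All sum inequalities are stated for a set \<open>C\<close> containing the sums,
  which spares measurability of sums and applies directly to halves of sets and to one body
  containing the sum of two others.\<close>

lemma power_above_tangent:
  fixes x s :: real
  assumes "0 \<le> x" "0 < s"
  shows "s ^ Suc m + real (Suc m) * s ^ m * (x - s) \<le> x ^ Suc m"
    and "m \<ge> 1 \<Longrightarrow> x \<noteq> s \<Longrightarrow> s ^ Suc m + real (Suc m) * s ^ m * (x - s) < x ^ Suc m"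
proof -
  \<comment> \<open>The gap between the power and its tangent at \<open>s\<close>. It obeys a
    recursion whose increment is a nonnegative multiple of a square, so the bound follows by
    induction and is strict from exponent 2 on.\<close>
  define D where "D k = x ^ Suc k - s ^ Suc k - real (Suc k) * s ^ k * (x - s)" for k
  have rec: "D (Suc k) = x * D k + real (Suc k) * s ^ k * (x - s)\<^sup>2" for k
    by (simp add: D_def algebra_simps power2_eq_square)
  have nonneg: "D k \<ge> 0" for k
  proof (induction k)
    case 0 show ?case by (simp add: D_def)
  next
    case (Suc k) show ?case unfolding rec using Suc assms by simp
  qed
  show "s ^ Suc m + real (Suc m) * s ^ m * (x - s) \<le> x ^ Suc m"
    using nonneg[of m] by (simp add: D_def)
  assume "m \<ge> 1" "x \<noteq> s"
  then obtain k where k: "m = Suc k" by (cases m) auto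
  have "D m > 0" unfolding k rec using nonneg[of k] assms \<open>x \<noteq> s\<close>
    by (intro add_nonneg_pos mult_nonneg_nonneg mult_pos_pos) auto
  then show "s ^ Suc m + real (Suc m) * s ^ m * (x - s) < x ^ Suc m" by (simp add: D_def)
qed

text \<open>Jensen for the power m + 1 with weights a/(a+b) and b/(a+b) at the points p(a+b)/a and
  q(a+b)/b, whose mean is \<open>p + q\<close>. It compares Bonnesen's bound with the
  Brunn-Minkowski bound; for \<open>m \<ge> 1\<close> equality makes the points coincide, that is p
  : q = a : b.\<close>

lemma power_Suc_sum_le_weighted:
  fixes a b p q :: real
  assumes a: "0 < a" and b: "0 < b" and p: "0 < p" and q: "0 < q"
  shows "(p + q) ^ Suc m \<le> (a + b) ^ m * (p ^ Suc m / a ^ m + q ^ Suc m / b ^ m)"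
    and "m \<ge> 1 \<Longrightarrow> (a + b) ^ m * (p ^ Suc m / a ^ m + q ^ Suc m / b ^ m) \<le> (p + q) ^ Suc m
          \<Longrightarrow> p * b = q * a"
proof -
  define u v where "u = a / (a + b)" and "v = b / (a + b)"
  have u: "u > 0" and v: "v > 0" and uv: "u + v = 1"
    using a b by (auto simp: u_def v_def add_divide_distrib[symmetric])
  define s where "s = p + q"
  have s: "s > 0" using p q by (simp add: s_def)
  have eq: "(a + b) ^ m * (p ^ Suc m / a ^ m + q ^ Suc m / b ^ m)
      = u * (p / u) ^ Suc m + v * (q / v) ^ Suc m"
    using a b by (simp add: u_def v_def power_divide power_mult_distrib divide_simps)
      (simp add: algebra_simps)
  have lin: "u * (s ^ Suc m + real (Suc m) * s ^ m * (p / u - s))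
       + v * (s ^ Suc m + real (Suc m) * s ^ m * (q / v - s)) = s ^ Suc m"
  proof -
    have "u * (s ^ Suc m + real (Suc m) * s ^ m * (p / u - s))
       + v * (s ^ Suc m + real (Suc m) * s ^ m * (q / v - s))
      = (u + v) * s ^ Suc m + real (Suc m) * s ^ m * (u * (p / u) + v * (q / v) - (u + v) * s)"
      by (simp add: algebra_simps)
    also have "u * (p / u) + v * (q / v) = s" using u v by (simp add: s_def)
    finally show ?thesis using uv by simp
  qed
  have 1: "s ^ Suc m + real (Suc m) * s ^ m * (p / u - s) \<le> (p / u) ^ Suc m"
    by (rule power_above_tangent) (use p u s in auto)
  have 2: "s ^ Suc m + real (Suc m) * s ^ m * (q / v - s) \<le> (q / v) ^ Suc m"
    by (rule power_above_tangent) (use q v s in auto)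
  show "(p + q) ^ Suc m \<le> (a + b) ^ m * (p ^ Suc m / a ^ m + q ^ Suc m / b ^ m)"
    unfolding eq s_def[symmetric]
    using lin mult_left_mono[OF 1 less_imp_le[OF u]] mult_left_mono[OF 2 less_imp_le[OF v]]
    by linarith
  assume m: "m \<ge> 1"
    and le: "(a + b) ^ m * (p ^ Suc m / a ^ m + q ^ Suc m / b ^ m) \<le> (p + q) ^ Suc m"
  have "p / u = s"
  proof (rule ccontr)
    assume "p / u \<noteq> s"
    then have "s ^ Suc m + real (Suc m) * s ^ m * (p / u - s) < (p / u) ^ Suc m"
      by (intro power_above_tangent(2)) (use p u s m in auto)
    from mult_strict_left_mono[OF this u] mult_left_mono[OF 2 less_imp_le[OF v]] lin le
    show False unfolding eq s_def[symmetric] by linarith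
  qed
  then show "p * b = q * a" using a b by (simp add: u_def s_def field_simps)
qed

text \<open>\<open>A\<close> is translated by a point of \<open>B\<close> near its infimum and
  \<open>B\<close> by a point of \<open>A\<close> near its supremum; both translates lie in
  \<open>C\<close> and overlap only in an interval of length at most \<open>e\<close>.\<close>

lemma emeasure_lborel_1d_sum:
  fixes A B C :: "real set"
  assumes [measurable]: "A \<in> sets borel" "B \<in> sets borel" "C \<in> sets borel"
    and A: "A \<noteq> {}" "bounded A" and B: "B \<noteq> {}" "bounded B"
    and sum: "\<And>x y. x \<in> A \<Longrightarrow> y \<in> B \<Longrightarrow> x + y \<in> C"
  shows "emeasure lborel A + emeasure lborel B \<le> emeasure lborel C"
proof (rule ennreal_le_epsilon)
  fix e :: real assume e: "e > 0"
  have bA: "bdd_above A" and bB: "bdd_below B"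
    using A B bounded_imp_bdd_above bounded_imp_bdd_below by auto
  obtain a where a: "a \<in> A" "a > Sup A - e / 2"
    using less_cSupD[of A "Sup A - e/2"] A(1) e by auto
  obtain b where b: "b \<in> B" "b < Inf B + e / 2"
    using cInf_lessD[of B "Inf B + e/2"] B(1) e by auto
  define A' where "A' = (+) (- b) -` A"
  define B' where "B' = (+) (- a) -` B"
  have [measurable]: "A' \<in> sets borel" "B' \<in> sets borel"
    using measurable_sets[of "(+) (- b)" borel borel A] measurable_sets[of "(+) (- a)" borel borel B]
    by (auto simp: A'_def B'_def)
  have mA: "emeasure lborel A' = emeasure lborel A"
    using emeasure_distr[of "(+) (-b)" lborel borel A] lborel_distr_plus[of "-b"]
    by (simp add: A'_def)
  have mB: "emeasure lborel B' = emeasure lborel B"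
    using emeasure_distr[of "(+) (-a)" lborel borel B] lborel_distr_plus[of "-a"]
    by (simp add: B'_def)
  have sub: "A' \<union> B' \<subseteq> C"
  proof
    fix x assume "x \<in> A' \<union> B'"
    then show "x \<in> C"
      using sum[of "x - b" b] sum[of a "x - a"] a b by (auto simp: A'_def B'_def)
  qed
  have int: "A' \<inter> B' \<subseteq> {a + Inf B .. Sup A + b}"
  proof
    fix x assume "x \<in> A' \<inter> B'"
    then have "- b + x \<in> A" "- a + x \<in> B" by (auto simp: A'_def B'_def)
    then have "- b + x \<le> Sup A" "Inf B \<le> - a + x"
      using bA bB cSup_upper cInf_lower by auto
    then show "x \<in> {a + Inf B .. Sup A + b}" by auto
  qed
  have "emeasure lborel A + emeasure lborel B = emeasure lborel (A' \<union> B') + emeasure lborel (A' \<inter> B')"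
    unfolding mA[symmetric] mB[symmetric] by (rule emeasure_Un_Int) auto
  also have "\<dots> \<le> emeasure lborel C + emeasure lborel {a + Inf B .. Sup A + b}"
    by (intro add_mono emeasure_mono sub int) auto
  also have "emeasure lborel {a + Inf B .. Sup A + b} \<le> ennreal e"
    using a b by (subst emeasure_lborel_Icc_eq) (auto intro!: ennreal_leI)
  finally show "emeasure lborel A + emeasure lborel B \<le> emeasure lborel C + ennreal e"
    by (simp add: add_left_mono)
qed

text \<open>Layer-cake formula cut off at height 1: by Fubini the left side is the integral of
  \<open>min 1 (F x)\<close>.\<close>

lemma nn_integral_levels:
  fixes F :: "real \<Rightarrow> real"
  assumes [measurable]: "F \<in> borel_measurable borel" and nn: "\<And>x. 0 \<le> F x"
  shows "(\<integral>\<^sup>+s. emeasure lborel {x. F x > s} * indicator {0..<1} s \<partial>lborel) \<le> (\<integral>\<^sup>+x. F x \<partial>lborel)"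
    and "(\<And>x. F x \<le> 1) \<Longrightarrow>
      (\<integral>\<^sup>+s. emeasure lborel {x. F x > s} * indicator {0..<1} s \<partial>lborel) = (\<integral>\<^sup>+x. F x \<partial>lborel)"
proof -
  have "(\<integral>\<^sup>+s. emeasure lborel {x. F x > s} * indicator {0..<1} s \<partial>lborel)
      = (\<integral>\<^sup>+s. (\<integral>\<^sup>+x. indicator {x. F x > s} x * indicator {0..<1} s \<partial>lborel) \<partial>lborel)"
    by (simp add: nn_integral_multc)
  also have "\<dots> = (\<integral>\<^sup>+s. (\<integral>\<^sup>+x. indicator {(s,x). F x > s} (s,x) * indicator {0..<1} s \<partial>lborel) \<partial>lborel)"
    by (intro nn_integral_cong) (auto split: split_indicator)
  also have "\<dots> = (\<integral>\<^sup>+x. (\<integral>\<^sup>+s. indicator {(s,x). F x > s} (s,x) * indicator {0..<1} s \<partial>lborel) \<partial>lborel)"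
    by (rule lborel_pair.Fubini') measurable
  also have "\<dots> = (\<integral>\<^sup>+x. (\<integral>\<^sup>+s. indicator {0..<min 1 (F x)} s \<partial>lborel) \<partial>lborel)"
    by (intro nn_integral_cong) (auto split: split_indicator)
  also have "\<dots> = (\<integral>\<^sup>+x. min 1 (F x) \<partial>lborel)"
    by (intro nn_integral_cong) (use nn in \<open>auto simp: min_def\<close>)
  finally have eq: "(\<integral>\<^sup>+s. emeasure lborel {x. F x > s} * indicator {0..<1} s \<partial>lborel)
     = (\<integral>\<^sup>+x. ennreal (min 1 (F x)) \<partial>lborel)" .
  show "(\<integral>\<^sup>+s. emeasure lborel {x. F x > s} * indicator {0..<1} s \<partial>lborel) \<le> (\<integral>\<^sup>+x. F x \<partial>lborel)"
    unfolding eq by (intro nn_integral_mono) (auto intro: ennreal_leI)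
  assume "\<And>x. F x \<le> 1"
  then show "(\<integral>\<^sup>+s. emeasure lborel {x. F x > s} * indicator {0..<1} s \<partial>lborel) = (\<integral>\<^sup>+x. F x \<partial>lborel)"
    unfolding eq by (simp add: min_absorb2)
qed

text \<open>An additive relative of the Prekopa-Leindler inequality, integrated over levels from 0
  to 1. \<open>F\<close> and \<open>G\<close> both have supremum 1; \<open>H\<close> may exceed 1,
  so for it only the inequality part of the layer-cake formula is used.\<close>

lemma nn_integral_sup_convolution:
  fixes F G H :: "real \<Rightarrow> real"
  assumes [measurable]: "F \<in> borel_measurable borel" "G \<in> borel_measurable borel"
      "H \<in> borel_measurable borel"
    and nn: "\<And>x. 0 \<le> F x" "\<And>x. 0 \<le> G x" "\<And>x. 0 \<le> H x"
    and F1: "\<And>x. F x \<le> 1" "\<And>s. s < 1 \<Longrightarrow> \<exists>x. F x > s" "bounded {x. F x > 0}"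
    and G1: "\<And>x. G x \<le> 1" "\<And>s. s < 1 \<Longrightarrow> \<exists>x. G x > s" "bounded {x. G x > 0}"
    and H: "\<And>x y s. 0 \<le> s \<Longrightarrow> F x > s \<Longrightarrow> G y > s \<Longrightarrow> H (x + y) > s"
  shows "(\<integral>\<^sup>+x. F x \<partial>lborel) + (\<integral>\<^sup>+x. G x \<partial>lborel) \<le> (\<integral>\<^sup>+x. H x \<partial>lborel)"
proof -
  have "(\<integral>\<^sup>+x. F x \<partial>lborel) + (\<integral>\<^sup>+x. G x \<partial>lborel)
    = (\<integral>\<^sup>+s. emeasure lborel {x. F x > s} * indicator {0..<1} s \<partial>lborel)
      + (\<integral>\<^sup>+s. emeasure lborel {x. G x > s} * indicator {0..<1} s \<partial>lborel)"
    using nn_integral_levels(2)[of F] nn_integral_levels(2)[of G] nn F1 G1 by simp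
  also have "\<dots> = (\<integral>\<^sup>+s. emeasure lborel {x. F x > s} * indicator {0..<1} s
       + emeasure lborel {x. G x > s} * indicator {0..<1} s \<partial>lborel)"
    by (rule nn_integral_add[symmetric]) measurable
  also have "\<dots> \<le> (\<integral>\<^sup>+s. emeasure lborel {x. H x > s} * indicator {0..<1} s \<partial>lborel)"
  proof (rule nn_integral_mono)
    fix s :: real
    show "emeasure lborel {x. F x > s} * indicator {0..<1} s
       + emeasure lborel {x. G x > s} * indicator {0..<1} s
       \<le> emeasure lborel {x. H x > s} * indicator {0..<1} s"
    proof (cases "s \<in> {0..<1}")
      case True
      have "emeasure lborel {x. F x > s} + emeasure lborel {x. G x > s} \<le> emeasure lborel {x. H x > s}"
      proof (rule emeasure_lborel_1d_sum)
        show "bounded {x. s < F x}" by (rule bounded_subset[OF F1(3)]) (use True in auto)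
        show "bounded {x. s < G x}" by (rule bounded_subset[OF G1(3)]) (use True in auto)
        show "{x. s < F x} \<noteq> {}" "{x. s < G x} \<noteq> {}" using F1(2) G1(2) True by auto
      qed (use H True in auto)
      then show ?thesis using True by simp
    qed simp
  qed
  also have "\<dots> \<le> (\<integral>\<^sup>+x. H x \<partial>lborel)" by (rule nn_integral_levels(1)) (use nn in auto)
  finally show ?thesis .
qed

section \<open>The Brunn-Minkowski inequality in coordinates\<close>

text \<open>Coordinates indexed by a finite set, unlike a Euclidean type, allow induction on the dimension
  and provide the measure on hyperplane sections.\<close>

abbreviation lebesgue_PiM :: "'i set \<Rightarrow> ('i \<Rightarrow> real) measure" where
  "lebesgue_PiM I \<equiv> Pi\<^sub>M I (\<lambda>_. lborel)"

interpretation lborel_prod: product_sigma_finite "\<lambda>_ :: 'i. lborel :: real measure"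
  by standard

definition slice_set :: "'i set \<Rightarrow> 'i \<Rightarrow> ('i \<Rightarrow> real) set \<Rightarrow> real \<Rightarrow> ('i \<Rightarrow> real) set" where
  "slice_set I i A t = {y \<in> space (lebesgue_PiM I). y(i := t) \<in> A}"

definition slice_vol :: "'i set \<Rightarrow> 'i \<Rightarrow> ('i \<Rightarrow> real) set \<Rightarrow> real \<Rightarrow> real" where
  "slice_vol I i A t = measure (lebesgue_PiM I) (slice_set I i A t)"

text \<open>The restriction makes the sum undefined off \<open>I\<close>, as membership in the space
  of the product measure demands.\<close>

definition padd :: "'i set \<Rightarrow> ('i \<Rightarrow> real) \<Rightarrow> ('i \<Rightarrow> real) \<Rightarrow> 'i \<Rightarrow> real" where
  "padd I x y = (\<lambda>j\<in>I. x j + y j)"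

text \<open>Measurability and inclusion in a cube: enough for finite volumes and boundedly supported
  section functions, and both properties pass to sections.\<close>

definition boxed :: "'i set \<Rightarrow> real \<Rightarrow> ('i \<Rightarrow> real) set \<Rightarrow> bool" where
  "boxed I R A \<longleftrightarrow> A \<in> sets (lebesgue_PiM I) \<and> A \<subseteq> Pi\<^sub>E I (\<lambda>_. {-R..R})"

lemma boxed_finite_measure:
  assumes "finite I" "boxed I R A"
  shows "emeasure (lebesgue_PiM I) A < \<infinity>"
    "emeasure (lebesgue_PiM I) A = ennreal (measure (lebesgue_PiM I) A)"
proof -
  have "emeasure (lebesgue_PiM I) A \<le> emeasure (lebesgue_PiM I) (Pi\<^sub>E I (\<lambda>_. {-R..R}))"
    using assms by (intro emeasure_mono) (auto simp: boxed_def intro!: sets_PiM_I_finite)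
  also have "\<dots> = (\<Prod>i\<in>I. emeasure lborel {-R..R})"
    using assms by (intro lborel_prod.emeasure_PiM) auto
  also have "\<dots> < \<infinity>" by (auto simp: emeasure_lborel_Icc_eq ennreal_power power_0_left)
  finally show "emeasure (lebesgue_PiM I) A < \<infinity>" .
  then show "emeasure (lebesgue_PiM I) A = ennreal (measure (lebesgue_PiM I) A)"
    by (simp add: emeasure_eq_ennreal_measure less_top)
qed

lemma slice_set_boxed:
  assumes "finite I" "i \<notin> I" "boxed (insert i I) R A"
  shows "boxed I R (slice_set I i A t)"
proof -
  have "(\<lambda>y. y(i := t)) \<in> measurable (lebesgue_PiM I) (lebesgue_PiM (insert i I))"
    by (rule measurable_fun_upd[where J = I]) auto
  from measurable_sets[OF this, of A]
  have 1: "slice_set I i A t \<in> sets (lebesgue_PiM I)"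
    using assms by (simp add: boxed_def slice_set_def vimage_def Int_def conj_commute)
  have "slice_set I i A t \<subseteq> Pi\<^sub>E I (\<lambda>_. {-R..R})"
  proof
    fix y assume "y \<in> slice_set I i A t"
    then have y: "y \<in> space (lebesgue_PiM I)" "y(i := t) \<in> Pi\<^sub>E (insert i I) (\<lambda>_. {-R..R})"
      using assms by (auto simp: slice_set_def boxed_def)
    have "y j \<in> {-R..R}" if "j \<in> I" for j
      using PiE_mem[OF y(2), of j] that assms(2) by (cases "j = i") auto
    then show "y \<in> Pi\<^sub>E I (\<lambda>_. {-R..R})" using y(1)
      by (auto simp: space_PiM PiE_def)
  qed
  then show ?thesis using 1 by (simp add: boxed_def)
qed

lemma slice_set_outside:
  assumes "boxed (insert i I) R A" "t \<notin> {-R..R}"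
  shows "slice_set I i A t = {}"
  using assms PiE_mem[of "_(i := t)" "insert i I" "\<lambda>_. {-R..R}" i]
  by (fastforce simp: slice_set_def boxed_def)

lemma slice_vol_nonneg [simp]: "0 \<le> slice_vol I i A t"
  by (simp add: slice_vol_def)

lemma slice_vol_bounded_support:
  assumes "boxed (insert i I) R A"
  shows "bounded {t. 0 < slice_vol I i A t}"
  by (rule bounded_subset[of "{-R..R}"])
     (use slice_set_outside[OF assms] in \<open>force simp: slice_vol_def\<close>)+

lemma ennreal_slice_vol:
  assumes "finite I" "i \<notin> I" "boxed (insert i I) R A"
  shows "ennreal (slice_vol I i A t) = (\<integral>\<^sup>+y. indicator A (y(i := t)) \<partial>lebesgue_PiM I)"
proof -
  note b = slice_set_boxed[OF assms, of t]
  have "ennreal (slice_vol I i A t) = emeasure (lebesgue_PiM I) (slice_set I i A t)"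
    unfolding slice_vol_def using boxed_finite_measure[OF assms(1) b] by simp
  also have "\<dots> = (\<integral>\<^sup>+y. indicator (slice_set I i A t) y \<partial>lebesgue_PiM I)"
    using b by (simp add: boxed_def)
  also have "\<dots> = (\<integral>\<^sup>+y. indicator A (y(i := t)) \<partial>lebesgue_PiM I)"
    by (intro nn_integral_cong) (auto simp: slice_set_def split: split_indicator)
  finally show ?thesis .
qed

lemma slice_vol_measurable:
  assumes "finite I" "i \<notin> I" "boxed (insert i I) R A"
  shows "slice_vol I i A \<in> borel_measurable borel"
proof -
  have [measurable]: "A \<in> sets (lebesgue_PiM (insert i I))" using assms by (simp add: boxed_def)
  interpret finite_product_sigma_finite "\<lambda>_. lborel :: real measure" I
    by standard (use assms in auto)
  have "(\<lambda>(t, y). y(i := t)) \<in> measurable (lborel \<Otimes>\<^sub>M lebesgue_PiM I) (lebesgue_PiM (insert i I))"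
    unfolding split_def by (rule measurable_fun_upd[where J = I]) auto
  then have "(\<lambda>t. \<integral>\<^sup>+y. indicator A (y(i := t)) \<partial>lebesgue_PiM I) \<in> borel_measurable lborel"
    by (intro borel_measurable_nn_integral) (simp add: split_def)
  then have "(\<lambda>t. ennreal (slice_vol I i A t)) \<in> borel_measurable borel"
    by (simp add: ennreal_slice_vol[OF assms])
  then have "(\<lambda>t. enn2real (ennreal (slice_vol I i A t))) \<in> borel_measurable borel"
    by measurable
  then show ?thesis by simp
qed

lemma measure_eq_nn_integral_slice_vol:
  assumes "finite I" "i \<notin> I" "boxed (insert i I) R A"
  shows "ennreal (measure (lebesgue_PiM (insert i I)) A) = (\<integral>\<^sup>+t. slice_vol I i A t \<partial>lborel)"
proof -
  have [measurable]: "A \<in> sets (lebesgue_PiM (insert i I))" using assms by (simp add: boxed_def)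
  have "ennreal (measure (lebesgue_PiM (insert i I)) A) = emeasure (lebesgue_PiM (insert i I)) A"
    using boxed_finite_measure[OF _ assms(3)] assms by simp
  also have "\<dots> = (\<integral>\<^sup>+x. indicator A x \<partial>lebesgue_PiM (insert i I))" by simp
  also have "\<dots> = (\<integral>\<^sup>+t. (\<integral>\<^sup>+y. indicator A (y(i := t)) \<partial>lebesgue_PiM I) \<partial>lborel)"
    using assms by (intro lborel_prod.product_nn_integral_insert_rev) auto
  finally show ?thesis using ennreal_slice_vol[OF assms] by simp
qed

lemma slice_vol_le:
  assumes "finite I" "i \<notin> I" "boxed (insert i I) R A" "0 \<le> R"
  shows "slice_vol I i A t \<le> (2 * R) ^ card I"
proof -
  note b = slice_set_boxed[OF assms(1-3), of t]
  have "ennreal (slice_vol I i A t) = emeasure (lebesgue_PiM I) (slice_set I i A t)"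
    unfolding slice_vol_def using boxed_finite_measure[OF assms(1) b] by simp
  also have "\<dots> \<le> emeasure (lebesgue_PiM I) (Pi\<^sub>E I (\<lambda>_. {-R..R}))"
    using b assms by (intro emeasure_mono) (auto simp: boxed_def intro!: sets_PiM_I_finite)
  also have "\<dots> = (\<Prod>i\<in>I. emeasure lborel {-R..R})"
    using assms by (intro lborel_prod.emeasure_PiM) auto
  also have "\<dots> = ennreal ((2 * R) ^ card I)"
    using assms by (simp add: ennreal_power)
  finally show ?thesis using assms by (simp add: ennreal_le_iff)
qed

lemma padd_fun_upd:
  assumes "i \<notin> I" 
  shows "padd (insert i I) (x(i := t)) (y(i := u)) = (padd I x y)(i := t + u)"
  using assms by (auto simp: padd_def fun_eq_iff restrict_def)

text \<open>A predicate on \<open>I\<close>, since the lemmas on sections take it as the induction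
  hypothesis one dimension lower. Volumes enter as powers, which avoids roots and reads 1 for the
  empty index set.\<close>

definition brunn_minkowski_PiM :: "'i set \<Rightarrow> bool" where
  "brunn_minkowski_PiM I \<longleftrightarrow> (\<forall>A B C p q R. boxed I R A \<longrightarrow> boxed I R B \<longrightarrow> boxed I R C \<longrightarrow>
     (\<forall>x\<in>A. \<forall>y\<in>B. padd I x y \<in> C) \<longrightarrow> p > 0 \<longrightarrow> q > 0 \<longrightarrow>
     measure (lebesgue_PiM I) A = p ^ card I \<longrightarrow> measure (lebesgue_PiM I) B = q ^ card I \<longrightarrow>
     (p + q) ^ card I \<le> measure (lebesgue_PiM I) C)"

lemma brunn_minkowski_PiMD:
  assumes "brunn_minkowski_PiM I" "boxed I R A" "boxed I R B" "boxed I R C"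
     "\<And>x y. x \<in> A \<Longrightarrow> y \<in> B \<Longrightarrow> padd I x y \<in> C" "p > 0" "q > 0"
     "measure (lebesgue_PiM I) A = p ^ card I" "measure (lebesgue_PiM I) B = q ^ card I"
  shows "(p + q) ^ card I \<le> measure (lebesgue_PiM I) C"
  using assms unfolding brunn_minkowski_PiM_def by blast

lemma scaled_power_add_less:
  fixes s p q a b :: real
  assumes "0 \<le> s" "0 < p" "0 < q" "0 < a" "0 < b" "s * p ^ m < a ^ m" "s * q ^ m < b ^ m"
  shows "s * (p + q) ^ m < (a + b) ^ m"
proof (cases "m = 0")
  case False
  define c where "c = root m s"
  have c: "s = c ^ m" "c \<ge> 0" using assms False by (auto simp: c_def)
  have "c * p < a" "c * q < b"
    using assms c by (auto simp: power_mult_distrib[symmetric] intro: power_less_imp_less_base)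
  then have "(c * (p + q)) ^ m < (a + b) ^ m"
    using c assms False by (intro power_strict_mono) (auto simp: algebra_simps)
  then show ?thesis by (simp add: c power_mult_distrib)
qed (use assms in auto)

text \<open>Over no coordinates the product measure is a point mass, so a positive volume agrees
  with \<open>p ^ 0\<close>. This lets dimension one be an ordinary induction step.\<close>

lemma measure_PiM_empty_index:
  assumes "0 < measure (lebesgue_PiM {}) X"
  shows "measure (lebesgue_PiM {}) X = 1"
proof -
  have "X \<in> sets (lebesgue_PiM {})" using assms measure_notin_sets by force
  then have "X = {} \<or> X = {\<lambda>_. undefined}" by (auto simp: PiM_empty)
  then show ?thesis using assms by (auto simp: PiM_empty measure_count_space)
qed

lemma measure_PiM_power:
  assumes "finite I" "0 < measure (lebesgue_PiM I) X"
  obtains p where "p > 0" "measure (lebesgue_PiM I) X = p ^ card I"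
proof (cases "I = {}")
  case True
  then show ?thesis using that[of 1] measure_PiM_empty_index assms by auto
next
  case False
  then show ?thesis using that[of "root (card I) (measure (lebesgue_PiM I) X)"] assms
    by (simp add: card_gt_0_iff)
qed

lemma slice_vol_superadditive:
  assumes I: "finite I" "i \<notin> I" and BM: "brunn_minkowski_PiM I"
    and A: "boxed (insert i I) R A" and B: "boxed (insert i I) R B" and C: "boxed (insert i I) R C"
    and sum: "\<And>x y. x \<in> A \<Longrightarrow> y \<in> B \<Longrightarrow> padd (insert i I) x y \<in> C"
    and p: "p > 0" "slice_vol I i A t = p ^ card I" and q: "q > 0" "slice_vol I i B u = q ^ card I"
  shows "(p + q) ^ card I \<le> slice_vol I i C (t + u)"
  unfolding slice_vol_def
proof (rule brunn_minkowski_PiMD[OF BM])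
  show "padd I x y \<in> slice_set I i C (t + u)" if "x \<in> slice_set I i A t" "y \<in> slice_set I i B u" for x y
    using sum[of "x(i := t)" "y(i := u)"] that padd_fun_upd[OF I(2)]
    by (auto simp: slice_set_def space_PiM padd_def)
qed (use p q slice_set_boxed[OF I] A B C in \<open>auto simp: slice_vol_def\<close>)

text \<open>After division by their suprema, the section functions of \<open>A\<close> and \<open>B\<close> have superlevel sets that are
  nonempty at the same levels, so the one-dimensional inequality applies level by level.\<close>

lemma bonnesen_PiM:
  assumes I: "finite I" "i \<notin> I" and BM: "brunn_minkowski_PiM I"
    and A: "boxed (insert i I) R A" and B: "boxed (insert i I) R B" and C: "boxed (insert i I) R C"
    and sum: "\<And>x y. x \<in> A \<Longrightarrow> y \<in> B \<Longrightarrow> padd (insert i I) x y \<in> C"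
    and p: "p > 0" "\<And>t. slice_vol I i A t \<le> p ^ card I"
      "\<And>s. s < 1 \<Longrightarrow> \<exists>t. slice_vol I i A t > s * p ^ card I"
    and q: "q > 0" "\<And>t. slice_vol I i B t \<le> q ^ card I"
      "\<And>s. s < 1 \<Longrightarrow> \<exists>t. slice_vol I i B t > s * q ^ card I"
  shows "(p + q) ^ card I * (measure (lebesgue_PiM (insert i I)) A / p ^ card I
       + measure (lebesgue_PiM (insert i I)) B / q ^ card I) \<le> measure (lebesgue_PiM (insert i I)) C"
proof -
  let ?m = "card I" and ?M = "lebesgue_PiM (insert i I)"
  note [measurable] = slice_vol_measurable[OF I A] slice_vol_measurable[OF I B] slice_vol_measurable[OF I C]
  have int: "(\<integral>\<^sup>+t. ennreal (slice_vol I i X t / k) \<partial>lborel) = ennreal (measure ?M X / k)"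
    if X: "boxed (insert i I) R X" and k: "k > 0" for X k
  proof -
    note [measurable] = slice_vol_measurable[OF I X]
    have "(\<integral>\<^sup>+t. ennreal (slice_vol I i X t / k) \<partial>lborel)
        = (\<integral>\<^sup>+t. ennreal (1 / k) * ennreal (slice_vol I i X t) \<partial>lborel)"
      using k by (simp add: ennreal_mult[symmetric])
    also have "\<dots> = ennreal (1 / k) * ennreal (measure ?M X)"
      by (simp add: nn_integral_cmult measure_eq_nn_integral_slice_vol[OF I X])
    finally show ?thesis using k by (simp add: ennreal_mult[symmetric])
  qed
  have pos: "p ^ ?m > 0" "q ^ ?m > 0" "(p + q) ^ ?m > 0" using p q by simp_all
  have "(\<integral>\<^sup>+t. ennreal (slice_vol I i A t / p ^ ?m) \<partial>lborel) + (\<integral>\<^sup>+t. ennreal (slice_vol I i B t / q ^ ?m) \<partial>lborel)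
     \<le> (\<integral>\<^sup>+t. ennreal (slice_vol I i C t / (p + q) ^ ?m) \<partial>lborel)"
  proof (rule nn_integral_sup_convolution)
    show "slice_vol I i A t / p ^ ?m \<le> 1" "slice_vol I i B t / q ^ ?m \<le> 1" for t
      using p(2)[of t] q(2)[of t] pos by auto
    show "\<exists>t. slice_vol I i A t / p ^ ?m > s" "\<exists>t. slice_vol I i B t / q ^ ?m > s" if "s < 1" for s
      using p(3)[OF that] q(3)[OF that] pos by (auto simp: pos_less_divide_eq)
    show "bounded {t. 0 < slice_vol I i A t / p ^ ?m}" "bounded {t. 0 < slice_vol I i B t / q ^ ?m}"
      using slice_vol_bounded_support[OF A] slice_vol_bounded_support[OF B] pos p(1) q(1)
      by (simp_all add: zero_less_divide_iff order.asym)
    fix t u s :: real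
    assume s: "0 \<le> s" and "s < slice_vol I i A t / p ^ ?m" "s < slice_vol I i B u / q ^ ?m"
    then have gt: "s * p ^ ?m < slice_vol I i A t" "s * q ^ ?m < slice_vol I i B u"
      using pos by (auto simp: pos_less_divide_eq)
    have g0: "0 < slice_vol I i A t" "0 < slice_vol I i B u"
      using gt s pos by (auto intro: le_less_trans[rotated])
    obtain p' where p': "p' > 0" "slice_vol I i A t = p' ^ ?m"
      using measure_PiM_power[OF I(1)] g0 unfolding slice_vol_def by metis
    obtain q' where q': "q' > 0" "slice_vol I i B u = q' ^ ?m"
      using measure_PiM_power[OF I(1)] g0 unfolding slice_vol_def by metis
    \<comment> \<open>For \<open>?m > 0\<close>, \<open>p'\<close> and \<open>q'\<close> exceed the
      fraction s^(1/m) of \<open>p\<close> and \<open>q\<close>, hence so does their sum relative to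
      \<open>p + q\<close>: the same level \<open>s\<close> serves all three section
      functions.\<close>
    have "s * (p + q) ^ ?m < (p' + q') ^ ?m"
      by (rule scaled_power_add_less) (use s p q p' q' gt in auto)
    also have "\<dots> \<le> slice_vol I i C (t + u)"
      by (rule slice_vol_superadditive[OF I BM A B C sum p' q']) 
    finally show "s < slice_vol I i C (t + u) / (p + q) ^ ?m"
      using pos by (simp add: pos_less_divide_eq)
  qed (use p q in auto)
  then have "ennreal (measure ?M A / p ^ ?m + measure ?M B / q ^ ?m) \<le> ennreal (measure ?M C / (p + q) ^ ?m)"
    using int[OF A pos(1)] int[OF B pos(2)] int[OF C pos(3)] pos by (simp add: ennreal_plus[symmetric] del: ennreal_plus)
  then have "measure ?M A / p ^ ?m + measure ?M B / q ^ ?m \<le> measure ?M C / (p + q) ^ ?m"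
    using pos by (subst (asm) ennreal_le_iff) auto
  then show ?thesis using pos by (simp add: pos_le_divide_eq mult.commute)
qed

definition max_slice :: "'i set \<Rightarrow> 'i \<Rightarrow> ('i \<Rightarrow> real) set \<Rightarrow> real" where
  "max_slice I i A = (SUP t. slice_vol I i A t)"

lemma max_slice:
  assumes I: "finite I" "i \<notin> I" and A: "boxed (insert i I) R A"
    and pos: "0 < measure (lebesgue_PiM (insert i I)) A"
  shows "slice_vol I i A t \<le> max_slice I i A" "max_slice I i A > 0"
    "s < max_slice I i A \<Longrightarrow> \<exists>t. slice_vol I i A t > s"
    "\<exists>p>0. max_slice I i A = p ^ card I"
proof -
  have "0 \<le> R"
  proof (rule ccontr)
    assume "\<not> 0 \<le> R"
    then have "A = {}" using A PiE_mem[of _ "insert i I" "\<lambda>_. {-R..R}" i] by (force simp: boxed_def)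
    then show False using pos by simp
  qed
  then have bdd: "bdd_above (range (slice_vol I i A))"
    using slice_vol_le[OF I A] by (intro bdd_aboveI2)
  show le: "slice_vol I i A t \<le> max_slice I i A" for t
    unfolding max_slice_def by (rule cSUP_upper[OF _ bdd]) simp
  show gt: "\<exists>t. slice_vol I i A t > s" if "s < max_slice I i A" for s
    using less_cSUP_iff[OF _ bdd] that unfolding max_slice_def by auto
  have "\<exists>t. slice_vol I i A t > 0"
  proof (rule ccontr)
    assume "\<not> ?thesis"
    then have "slice_vol I i A t = 0" for t
      using slice_vol_nonneg[of I i A t] by (metis order_less_le)
    then have "ennreal (measure (lebesgue_PiM (insert i I)) A) = 0"
      using measure_eq_nn_integral_slice_vol[OF I A] by simp
    then show False using pos by simp
  qed
  then show mpos: "max_slice I i A > 0" using le by (meson less_le_trans)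
  show "\<exists>p>0. max_slice I i A = p ^ card I"
  \<comment> \<open>\<open>p ^ 0\<close> is 1 for every \<open>p\<close>, so with no remaining
    coordinates the supremum itself must be 1; it is, because sections then have measure 0 or
    1.\<close>
  proof (cases "I = {}")
    case True
    from gt[OF mpos] obtain t where "slice_vol I i A t > 0" by auto
    then have "max_slice I i A \<ge> 1"
      using measure_PiM_empty_index[of "slice_set {} i A t"] le[of t] unfolding True slice_vol_def by simp
    moreover have "\<not> max_slice I i A > 1"
    proof
      assume "max_slice I i A > 1"
      from gt[OF this] obtain t where "slice_vol I i A t > 1" by auto
      then show False
        using measure_PiM_empty_index[of "slice_set {} i A t"] unfolding True slice_vol_def by simp
    qed
    ultimately show ?thesis by (intro exI[of _ 1]) (auto simp: True)
  next
    case False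
    then show ?thesis using mpos I by (intro exI[of _ "root (card I) (max_slice I i A)"]) (simp add: card_gt_0_iff)
  qed
qed

lemma bonnesen_max_slice:
  assumes I: "finite I" "i \<notin> I" and BM: "brunn_minkowski_PiM I"
    and A: "boxed (insert i I) R A" and B: "boxed (insert i I) R B" and C: "boxed (insert i I) R C"
    and sum: "\<And>x y. x \<in> A \<Longrightarrow> y \<in> B \<Longrightarrow> padd (insert i I) x y \<in> C"
    and p: "p > 0" "max_slice I i A = p ^ card I" and q: "q > 0" "max_slice I i B = q ^ card I"
    and pos: "0 < measure (lebesgue_PiM (insert i I)) A" "0 < measure (lebesgue_PiM (insert i I)) B"
  shows "(p + q) ^ card I * (measure (lebesgue_PiM (insert i I)) A / p ^ card I
       + measure (lebesgue_PiM (insert i I)) B / q ^ card I) \<le> measure (lebesgue_PiM (insert i I)) C"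
proof (rule bonnesen_PiM[OF I BM A B C sum])
  show "\<exists>t. s * p ^ card I < slice_vol I i A t" if "s < 1" for s
    by (rule max_slice(3)[OF I A pos(1)]) (use p that in simp)
  show "\<exists>t. s * q ^ card I < slice_vol I i B t" if "s < 1" for s
    by (rule max_slice(3)[OF I B pos(2)]) (use q that in simp)
qed (use p q max_slice(1)[OF I A pos(1)] max_slice(1)[OF I B pos(2)] in auto)

theorem brunn_minkowski_PiM:
  assumes "finite I"
  shows "brunn_minkowski_PiM I"
  using assms
proof (induction I)
  case empty
  show ?case unfolding brunn_minkowski_PiM_def
  proof safe
    fix A B C :: "('a \<Rightarrow> real) set" and p q R :: real
    assume sum: "\<forall>x\<in>A. \<forall>y\<in>B. padd {} x y \<in> C" and C: "boxed {} R C"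
      and A: "measure (lebesgue_PiM {}) A = p ^ card {}" and B: "measure (lebesgue_PiM {}) B = q ^ card {}"
    have "A \<noteq> {}" "B \<noteq> {}" using A B by auto
    then have "C \<noteq> {}" using sum by auto
    moreover have "C \<subseteq> {\<lambda>_. undefined}" using C by (auto simp: boxed_def)
    ultimately have "C = {\<lambda>_. undefined}" by blast
    then show "(p + q) ^ card {} \<le> measure (lebesgue_PiM {}) C"
      by (simp add: PiM_empty measure_count_space)
  qed
next
  case (insert i I)
  note I = insert.hyps(1,2) and BM = insert.IH
  show ?case unfolding brunn_minkowski_PiM_def
  proof safe
    fix A B C :: "('a \<Rightarrow> real) set" and p q R :: real
    assume A: "boxed (insert i I) R A" and B: "boxed (insert i I) R B" and C: "boxed (insert i I) R C"
      and sum: "\<forall>x\<in>A. \<forall>y\<in>B. padd (insert i I) x y \<in> C" and p: "0 < p" and q: "0 < q"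
      and mA: "measure (lebesgue_PiM (insert i I)) A = p ^ card (insert i I)"
      and mB: "measure (lebesgue_PiM (insert i I)) B = q ^ card (insert i I)"
    have pos: "0 < measure (lebesgue_PiM (insert i I)) A" "0 < measure (lebesgue_PiM (insert i I)) B"
      using mA mB p q by simp_all
    obtain a where a: "a > 0" "max_slice I i A = a ^ card I" using max_slice(4)[OF I A pos(1)] by auto
    obtain b where b: "b > 0" "max_slice I i B = b ^ card I" using max_slice(4)[OF I B pos(2)] by auto
    \<comment> \<open>Whatever the roots \<open>a\<close> and \<open>b\<close> of the largest
      sections are, Bonnesen's bound dominates the Brunn-Minkowski one; this closes the
      induction.\<close>
    have "(p + q) ^ Suc (card I) \<le> (a + b) ^ card I * (p ^ Suc (card I) / a ^ card I + q ^ Suc (card I) / b ^ card I)"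
      by (rule power_Suc_sum_le_weighted) (use a b p q in auto)
    also have "\<dots> \<le> measure (lebesgue_PiM (insert i I)) C"
      using bonnesen_max_slice[OF I BM A B C _ a b pos] sum mA mB I by simp
    finally show "(p + q) ^ card (insert i I) \<le> measure (lebesgue_PiM (insert i I)) C"
      using I by simp
  qed
qed

text \<open>The only information drawn from equality: the strict part of the weighted inequality
  forces the roots of the largest sections into the ratio p : q. \<open>I \<noteq> {}\<close>
  supplies the exponent at least 1 that strictness requires.\<close>

lemma bonnesen_equality_PiM:
  assumes I: "finite I" "i \<notin> I" "I \<noteq> {}"
    and A: "boxed (insert i I) R A" and B: "boxed (insert i I) R B" and C: "boxed (insert i I) R C"
    and sum: "\<And>x y. x \<in> A \<Longrightarrow> y \<in> B \<Longrightarrow> padd (insert i I) x y \<in> C" 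
    and p: "0 < p" "measure (lebesgue_PiM (insert i I)) A = p ^ card (insert i I)"
    and q: "0 < q" "measure (lebesgue_PiM (insert i I)) B = q ^ card (insert i I)"
    and eq: "measure (lebesgue_PiM (insert i I)) C \<le> (p + q) ^ card (insert i I)"
  shows "max_slice I i A * q ^ card I = max_slice I i B * p ^ card I"
proof -
  have pos: "0 < measure (lebesgue_PiM (insert i I)) A" "0 < measure (lebesgue_PiM (insert i I)) B"
    using p q by simp_all
  obtain a where a: "a > 0" "max_slice I i A = a ^ card I" using max_slice(4)[OF I(1,2) A pos(1)] by auto
  obtain b where b: "b > 0" "max_slice I i B = b ^ card I" using max_slice(4)[OF I(1,2) B pos(2)] by auto
  have "(a + b) ^ card I * (p ^ Suc (card I) / a ^ card I + q ^ Suc (card I) / b ^ card I)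
     \<le> measure (lebesgue_PiM (insert i I)) C"
    using bonnesen_max_slice[OF I(1,2) brunn_minkowski_PiM[OF I(1)] A B C _ a b pos] sum p q I by simp
  also have "\<dots> \<le> (p + q) ^ Suc (card I)" using eq I by simp
  finally have "p * b = q * a"
    by (intro power_Suc_sum_le_weighted(2)) (use a b p q I in \<open>auto simp: Suc_le_eq card_gt_0_iff\<close>)
  then have "(p * b) ^ card I = (q * a) ^ card I" by simp
  then show ?thesis using a b by (simp add: power_mult_distrib mult.commute)
qed

section \<open>Hyperplane sections of sets in Euclidean space\<close>

definition coord_set :: "'a::euclidean_space set \<Rightarrow> ('a \<Rightarrow> real) set" where
  "coord_set A = {f \<in> space (lebesgue_PiM Basis). (\<Sum>b\<in>Basis. f b *\<^sub>R b) \<in> A}"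

lemma measure_coord_set:
  fixes A :: "'a::euclidean_space set"
  assumes "A \<in> sets borel"
  shows "measure (lebesgue_PiM Basis) (coord_set A) = measure lebesgue A"
    "coord_set A \<in> sets (lebesgue_PiM Basis)"
proof -
  have m: "(\<lambda>f. \<Sum>b\<in>Basis. f b *\<^sub>R b) \<in> measurable (lebesgue_PiM (Basis :: 'a set)) borel"
    by measurable
  show "coord_set A \<in> sets (lebesgue_PiM Basis)"
    using measurable_sets[OF m assms] by (simp add: coord_set_def vimage_def Int_def conj_commute)
  have "measure lebesgue A = measure lborel A" using assms by simp
  also have "\<dots> = measure (lebesgue_PiM Basis) (coord_set A)"
    by (subst lborel_eq, subst measure_distr[OF m assms])
      (simp add: coord_set_def vimage_def Int_def conj_commute)
  finally show "measure (lebesgue_PiM Basis) (coord_set A) = measure lebesgue A" ..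
qed

lemma compact_boxed:
  fixes A :: "'a::euclidean_space set"
  assumes "compact A"
  obtains R0 where "\<And>R. R \<ge> R0 \<Longrightarrow> boxed Basis R (coord_set A)"
proof -
  obtain R0 where R0: "\<And>x. x \<in> A \<Longrightarrow> norm x \<le> R0"
    using compact_imp_bounded[OF assms] by (auto simp: bounded_iff)
  have "boxed Basis R (coord_set A)" if "R \<ge> R0" for R
  proof -
    have "f b \<in> {-R..R}" if "f \<in> coord_set A" "b \<in> Basis" for f b
    proof -
      let ?x = "\<Sum>b\<in>Basis. f b *\<^sub>R b"
      have "f b = ?x \<bullet> b" using that(2) by simp
      moreover have "\<bar>?x \<bullet> b\<bar> \<le> norm ?x" using that(2) by (rule Basis_le_norm)
      moreover have "norm ?x \<le> R" using R0[of ?x] that \<open>R \<ge> R0\<close> by (auto simp: coord_set_def)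
      ultimately show ?thesis by auto
    qed
    then show ?thesis
      using measure_coord_set(2)[of A] assms
      by (auto simp: boxed_def borel_compact coord_set_def space_PiM PiE_def Pi_def)
  qed
  then show ?thesis using that by blast
qed

lemma compact_boxed3:
  fixes A B C :: "'a::euclidean_space set"
  assumes "compact A" "compact B" "compact C"
  obtains R where "boxed Basis R (coord_set A)" "boxed Basis R (coord_set B)" "boxed Basis R (coord_set C)"
proof -
  obtain Ra where "\<And>R. R \<ge> Ra \<Longrightarrow> boxed Basis R (coord_set A)" using compact_boxed assms by blast
  moreover obtain Rb where "\<And>R. R \<ge> Rb \<Longrightarrow> boxed Basis R (coord_set B)" using compact_boxed assms by blast
  moreover obtain Rc where "\<And>R. R \<ge> Rc \<Longrightarrow> boxed Basis R (coord_set C)" using compact_boxed assms by blast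
  ultimately show ?thesis using that[of "max Ra (max Rb Rc)"] by simp
qed

lemma padd_coord_set:
  fixes A B C :: "'a::euclidean_space set"
  assumes "\<And>x y. x \<in> A \<Longrightarrow> y \<in> B \<Longrightarrow> x + y \<in> C" "f \<in> coord_set A" "g \<in> coord_set B"
  shows "padd Basis f g \<in> coord_set C"
proof -
  have "(\<Sum>b\<in>Basis. padd Basis f g b *\<^sub>R b) = (\<Sum>b\<in>Basis. f b *\<^sub>R b) + (\<Sum>b\<in>Basis. g b *\<^sub>R (b::'a))"
    by (simp add: padd_def scaleR_add_left sum.distrib)
  then show ?thesis using assms by (auto simp: coord_set_def space_PiM padd_def)
qed

text \<open>Any compact \<open>C\<close> containing the sums is allowed, because the applications
  take for \<open>C\<close> a part cut off by a hyperplane, or a body \<open>X\<close> that contains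
  \<open>mink_diff X Y\<close> plus the reflection of \<open>Y\<close>.\<close>

theorem brunn_minkowski:
  fixes A B C :: "'a::euclidean_space set"
  assumes "compact A" "compact B" "compact C"
    and sum: "\<And>x y. x \<in> A \<Longrightarrow> y \<in> B \<Longrightarrow> x + y \<in> C"
    and "p > 0" "q > 0" "measure lebesgue A = p ^ DIM('a)" "measure lebesgue B = q ^ DIM('a)"
  shows "(p + q) ^ DIM('a) \<le> measure lebesgue C"
proof -
  obtain R where R: "boxed Basis R (coord_set A)" "boxed Basis R (coord_set B)" "boxed Basis R (coord_set C)"
    using compact_boxed3 assms by blast
  from brunn_minkowski_PiMD[OF brunn_minkowski_PiM[OF finite_Basis] R padd_coord_set[OF sum], where p = p and q = q]
  show ?thesis using assms by (simp add: measure_coord_set borel_compact)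
qed

definition hslice :: "'a \<Rightarrow> 'a::euclidean_space set \<Rightarrow> real \<Rightarrow> real" where
  "hslice i A t = slice_vol (Basis - {i}) i (coord_set A) t"

lemma slice_set_coord_set:
  fixes A :: "'a::euclidean_space set"
  assumes "i \<in> Basis"
  shows "slice_set (Basis - {i}) i (coord_set A) t
    = {y \<in> space (lebesgue_PiM (Basis - {i})). t *\<^sub>R i + (\<Sum>b\<in>Basis - {i}. y b *\<^sub>R b) \<in> A}"
proof -
  have "(\<Sum>b\<in>Basis. (y(i := t)) b *\<^sub>R b) = t *\<^sub>R i + (\<Sum>b\<in>Basis - {i}. y b *\<^sub>R b)" for y :: "'a \<Rightarrow> real"
    using assms by (subst sum.remove[of _ i]) (auto intro!: sum.cong)
  moreover have "y(i := t) \<in> space (lebesgue_PiM Basis)" if "y \<in> space (lebesgue_PiM (Basis - {i}))" for y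
    using that assms by (auto simp: space_PiM PiE_def extensional_def)
  ultimately show ?thesis by (auto simp: slice_set_def coord_set_def)
qed

lemma hslice_restrict:
  fixes A :: "'a::euclidean_space set"
  assumes "i \<in> Basis"
  shows "hslice i (A \<inter> {x. x \<bullet> i \<in> X}) t = (if t \<in> X then hslice i A t else 0)"
proof -
  have *: "(t *\<^sub>R i + (\<Sum>b\<in>Basis - {i}. y b *\<^sub>R b)) \<bullet> i = t" for y :: "'a \<Rightarrow> real"
  proof -
    have "(\<Sum>b\<in>Basis - {i}. y b *\<^sub>R b) \<bullet> i = 0"
      using assms by (auto simp: inner_sum_left inner_not_same_Basis intro!: sum.neutral)
    then show ?thesis using assms by (simp add: inner_add_left)
  qed
  show ?thesis
    unfolding hslice_def slice_vol_def slice_set_coord_set[OF assms] by (simp add: *)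
qed

lemma hslice_nonneg [simp]: "0 \<le> hslice i A t" by (simp add: hslice_def)

lemma hslice_bounded:
  fixes A :: "'a::euclidean_space set"
  assumes "i \<in> Basis" "compact A"
  obtains M where "\<And>t. hslice i A t \<le> M"
proof -
  obtain R0 where R0: "\<And>R. R \<ge> R0 \<Longrightarrow> boxed Basis R (coord_set A)" using compact_boxed assms by blast
  have "boxed Basis (max 0 R0) (coord_set A)" by (rule R0) simp
  then have "hslice i A t \<le> (2 * max 0 R0) ^ card (Basis - {i})" for t
    unfolding hslice_def using slice_vol_le[of "Basis - {i}" i "max 0 R0" "coord_set A"] assms
    by (simp add: insert_absorb)
  then show ?thesis using that by blast
qed

lemma measure_eq_nn_integral_hslice:
  assumes "i \<in> Basis" "compact A"
  shows "ennreal (measure lebesgue A) = (\<integral>\<^sup>+t. hslice i A t \<partial>lborel)"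
proof -
  obtain R where "boxed Basis R (coord_set A)" using compact_boxed3 assms by blast
  then show ?thesis
    using measure_eq_nn_integral_slice_vol[of "Basis - {i}" i R "coord_set A"] assms
    by (simp add: hslice_def[abs_def] insert_absorb measure_coord_set borel_compact)
qed

definition sup_hslice :: "'a \<Rightarrow> 'a::euclidean_space set \<Rightarrow> real" where
  "sup_hslice i A = (SUP t. hslice i A t)"

lemma hslice_le_sup:
  assumes "i \<in> Basis" "compact A"
  shows "hslice i A t \<le> sup_hslice i A"
    "s < sup_hslice i A \<Longrightarrow> \<exists>t. hslice i A t > s"
proof -
  obtain M where "\<And>t. hslice i A t \<le> M" using hslice_bounded assms by blast
  then have b: "bdd_above (range (hslice i A))" by (rule bdd_aboveI2)
  show "hslice i A t \<le> sup_hslice i A"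
    unfolding sup_hslice_def by (rule cSUP_upper[OF _ b]) simp
  show "s < sup_hslice i A \<Longrightarrow> \<exists>t. hslice i A t > s"
    using less_cSUP_iff[OF _ b] unfolding sup_hslice_def by auto
qed

lemma brunn_minkowski_equality_sup_hslice:
  fixes A B C :: "'a::euclidean_space set"
  assumes i: "i \<in> Basis" and dim: "DIM('a) \<ge> 2"
    and "compact A" "compact B" "compact C"
    and sum: "\<And>x y. x \<in> A \<Longrightarrow> y \<in> B \<Longrightarrow> x + y \<in> C"
    and "p > 0" "q > 0" "measure lebesgue A = p ^ DIM('a)" "measure lebesgue B = q ^ DIM('a)"
    and "measure lebesgue C \<le> (p + q) ^ DIM('a)"
  shows "sup_hslice i A * q ^ (DIM('a) - 1) = sup_hslice i B * p ^ (DIM('a) - 1)"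
proof -
  obtain R where R: "boxed Basis R (coord_set A)" "boxed Basis R (coord_set B)" "boxed Basis R (coord_set C)"
    using compact_boxed3 assms by blast
  have "card (Basis - {i}) = DIM('a) - 1" using i by simp
  then have "Basis - {i} \<noteq> {}" using dim by (metis Suc_1 card.empty diff_is_0_eq not_less_eq_eq)
  then show ?thesis
    using bonnesen_equality_PiM[of "Basis - {i}" i R "coord_set A" "coord_set B" "coord_set C" p q] R
      padd_coord_set[OF sum] assms
    by (simp add: insert_absorb measure_coord_set borel_compact sup_hslice_def hslice_def[abs_def] max_slice_def)
qed

lemma measure_affine_hyperplane_cut:
  fixes A :: "'a::euclidean_space set"
  assumes "u \<noteq> 0" "compact A"
  shows "measure lebesgue A = measure lebesgue (A \<inter> {x. x \<bullet> u \<le> t}) + measure lebesgue (A \<inter> {x. x \<bullet> u \<ge> t})"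
    and "compact (A \<inter> {x. x \<bullet> u \<le> t})" "compact (A \<inter> {x. x \<bullet> u \<ge> t})"
proof -
  show c: "compact (A \<inter> {x. x \<bullet> u \<le> t})" "compact (A \<inter> {x. x \<bullet> u \<ge> t})"
    using assms by (auto intro!: compact_Int_closed closed_halfspace_component_le
        closed_Collect_le continuous_intros)
  have "negligible ((A \<inter> {x. x \<bullet> u \<le> t}) \<inter> (A \<inter> {x. x \<bullet> u \<ge> t}))"
    by (rule negligible_subset[OF negligible_hyperplane[of u t]]) (use assms in \<open>auto simp: inner_commute\<close>)
  moreover have "A = (A \<inter> {x. x \<bullet> u \<le> t}) \<union> (A \<inter> {x. x \<bullet> u \<ge> t})" by auto
  ultimately show "measure lebesgue A = measure lebesgue (A \<inter> {x. x \<bullet> u \<le> t}) + measure lebesgue (A \<inter> {x. x \<bullet> u \<ge> t})"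
    using measure_Un3[of "A \<inter> {x. x \<bullet> u \<le> t}" lebesgue "A \<inter> {x. x \<bullet> u \<ge> t}"] c
    by (simp add: lmeasurable_compact negligible_imp_measure0)
qed

text \<open>Brunn-Minkowski for the two halves adds up to Brunn-Minkowski for \<open>A\<close> and \<open>B\<close>, so both halves
  are again cases of equality.\<close>

lemma brunn_minkowski_equality_cut:
  fixes A B C :: "'a::euclidean_space set"
  assumes i: "i \<in> Basis" and dim: "DIM('a) \<ge> 2"
    and c: "compact A" "compact B" "compact C"
    and sum: "\<And>x y. x \<in> A \<Longrightarrow> y \<in> B \<Longrightarrow> x + y \<in> C"
    and p: "p > 0" and q: "q > 0" and mA: "measure lebesgue A = p ^ DIM('a)"
    and mB: "measure lebesgue B = q ^ DIM('a)"
    and mC: "measure lebesgue C \<le> (p + q) ^ DIM('a)"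
    and \<theta>: "0 < \<theta>" "\<theta> < 1"
    and t: "measure lebesgue (A \<inter> {x. x \<bullet> i \<le> t}) = \<theta> * p ^ DIM('a)"
    and u: "measure lebesgue (B \<inter> {x. x \<bullet> i \<le> u}) = \<theta> * q ^ DIM('a)"
  shows "sup_hslice i (A \<inter> {x. x \<bullet> i \<le> t}) * q ^ (DIM('a) - 1)
       = sup_hslice i (B \<inter> {x. x \<bullet> i \<le> u}) * p ^ (DIM('a) - 1)"
    and "sup_hslice i (A \<inter> {x. x \<bullet> i \<ge> t}) * q ^ (DIM('a) - 1)
       = sup_hslice i (B \<inter> {x. x \<bullet> i \<ge> u}) * p ^ (DIM('a) - 1)"
proof -
  let ?n = "DIM('a)"
  have i0: "i \<noteq> 0" using i by auto
  note cutA = measure_affine_hyperplane_cut[OF i0 c(1), of t]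
  note cutB = measure_affine_hyperplane_cut[OF i0 c(2), of u]
  note cutC = measure_affine_hyperplane_cut[OF i0 c(3), of "t + u"]
  have t': "measure lebesgue (A \<inter> {x. x \<bullet> i \<ge> t}) = (1 - \<theta>) * p ^ ?n"
    using cutA(1) t mA by (simp add: algebra_simps)
  have u': "measure lebesgue (B \<inter> {x. x \<bullet> i \<ge> u}) = (1 - \<theta>) * q ^ ?n"
    using cutB(1) u mB by (simp add: algebra_simps)
  \<comment> \<open>The share \<theta> of a volume is the n-th power of \<rho> times its root, so
    the lower halves have roots \<rho> p and \<rho> q, and their Brunn-Minkowski bound is the share
    \<theta> of the full bound; \<sigma> does the same for the upper halves.\<close>
  define \<rho> \<sigma> where "\<rho> = root ?n \<theta>" and "\<sigma> = root ?n (1 - \<theta>)"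
  have \<rho>: "\<rho> > 0" "\<rho> ^ ?n = \<theta>" and \<sigma>: "\<sigma> > 0" "\<sigma> ^ ?n = 1 - \<theta>"
    using \<theta> by (auto simp: \<rho>_def \<sigma>_def)
  have sum1: "x + y \<in> C \<inter> {x. x \<bullet> i \<le> t + u}"
    if "x \<in> A \<inter> {x. x \<bullet> i \<le> t}" "y \<in> B \<inter> {x. x \<bullet> i \<le> u}" for x y
    using that sum by (auto simp: inner_add_left)
  have sum2: "x + y \<in> C \<inter> {x. x \<bullet> i \<ge> t + u}"
    if "x \<in> A \<inter> {x. x \<bullet> i \<ge> t}" "y \<in> B \<inter> {x. x \<bullet> i \<ge> u}" for x y
    using that sum by (auto simp: inner_add_left)
  have m1: "measure lebesgue (A \<inter> {x. x \<bullet> i \<le> t}) = (\<rho> * p) ^ ?n"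
      "measure lebesgue (B \<inter> {x. x \<bullet> i \<le> u}) = (\<rho> * q) ^ ?n"
    using t u \<rho> by (simp_all add: power_mult_distrib)
  have m2: "measure lebesgue (A \<inter> {x. x \<bullet> i \<ge> t}) = (\<sigma> * p) ^ ?n"
      "measure lebesgue (B \<inter> {x. x \<bullet> i \<ge> u}) = (\<sigma> * q) ^ ?n"
    using t' u' \<sigma> by (simp_all add: power_mult_distrib)
  have pos: "\<rho> * p > 0" "\<rho> * q > 0" "\<sigma> * p > 0" "\<sigma> * q > 0" using \<rho> \<sigma> p q by simp_all
  have e1: "(\<rho> * p + \<rho> * q) ^ ?n = \<theta> * (p + q) ^ ?n"
    by (metis \<rho>(2) distrib_left power_mult_distrib)
  have e2: "(\<sigma> * p + \<sigma> * q) ^ ?n = (1 - \<theta>) * (p + q) ^ ?n"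
    by (metis \<sigma>(2) distrib_left power_mult_distrib)
  have b1: "\<theta> * (p + q) ^ ?n \<le> measure lebesgue (C \<inter> {x. x \<bullet> i \<le> t + u})"
    using brunn_minkowski[OF cutA(2) cutB(2) cutC(2) sum1 pos(1,2) m1] e1 by simp
  have b2: "(1 - \<theta>) * (p + q) ^ ?n \<le> measure lebesgue (C \<inter> {x. x \<bullet> i \<ge> t + u})"
    using brunn_minkowski[OF cutA(3) cutB(3) cutC(3) sum2 pos(3,4) m2] e2 by simp
  \<comment> \<open>The volume that the upper half of \<open>C\<close> must have leaves the lower
    half no room beyond its own bound, and conversely.\<close>
  have s1: "measure lebesgue (C \<inter> {x. x \<bullet> i \<le> t + u}) \<le> (\<rho> * p + \<rho> * q) ^ ?n"
    unfolding e1 using b2 cutC(1) mC by (simp add: algebra_simps)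
  have s2: "measure lebesgue (C \<inter> {x. x \<bullet> i \<ge> t + u}) \<le> (\<sigma> * p + \<sigma> * q) ^ ?n"
    unfolding e2 using b1 cutC(1) mC by (simp add: algebra_simps)
  from brunn_minkowski_equality_sup_hslice[OF i dim cutA(2) cutB(2) cutC(2) sum1 pos(1,2) m1 s1]
  show "sup_hslice i (A \<inter> {x. x \<bullet> i \<le> t}) * q ^ (?n - 1)
       = sup_hslice i (B \<inter> {x. x \<bullet> i \<le> u}) * p ^ (?n - 1)"
    using \<rho> by (simp add: power_mult_distrib algebra_simps)
  from brunn_minkowski_equality_sup_hslice[OF i dim cutA(3) cutB(3) cutC(3) sum2 pos(3,4) m2 s2]
  show "sup_hslice i (A \<inter> {x. x \<bullet> i \<ge> t}) * q ^ (?n - 1)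
       = sup_hslice i (B \<inter> {x. x \<bullet> i \<ge> u}) * p ^ (?n - 1)"
    using \<sigma> by (simp add: power_mult_distrib algebra_simps)
qed

section \<open>Brunn's concavity of sections and the regularity it gives\<close>

lemma measure_PiM_scale:
  fixes c :: real
  assumes I: "finite I" and c: "c > 0" and X: "X \<in> sets (lebesgue_PiM I)"
  shows "measure (lebesgue_PiM I) X
     = c ^ card I * measure (lebesgue_PiM I) {y \<in> space (lebesgue_PiM I). (\<lambda>j\<in>I. c * y j) \<in> X}"
    and "{y \<in> space (lebesgue_PiM I). (\<lambda>j\<in>I. c * y j) \<in> X} \<in> sets (lebesgue_PiM I)"
proof -
  let ?M = "lebesgue_PiM I"
  define f where "f = (\<lambda>y :: 'a \<Rightarrow> real. \<lambda>j\<in>I. c * y j)"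
  have f [measurable]: "f \<in> measurable ?M ?M"
    unfolding f_def by (intro measurable_restrict) simp
  have vim: "{y \<in> space ?M. f y \<in> X} = f -` X \<inter> space ?M" for X by auto
  show "{y \<in> space ?M. (\<lambda>j\<in>I. c * y j) \<in> X} \<in> sets ?M"
    using measurable_sets[OF f X] vim[of X] by (simp add: f_def)
  \<comment> \<open>Both measures agree on boxes, by a one-dimensional substitution in each
    coordinate, and this characterises the product measure.\<close>
  have "scale_measure (ennreal (c ^ card I)) (distr ?M ?M f) = ?M"
  proof (rule lborel_prod.PiM_eqI[OF I])
    fix A :: "'a \<Rightarrow> real set" assume A: "\<And>i. i \<in> I \<Longrightarrow> A i \<in> sets lborel"
    then have PA: "Pi\<^sub>E I A \<in> sets ?M" using I by (intro sets_PiM_I_finite) auto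
    have 1: "emeasure lborel (A j) = ennreal c * emeasure lborel ((*) c -` A j)" if "j \<in> I" for j
    proof -
      have [measurable]: "A j \<in> sets borel" using A that by simp
      have "emeasure lborel (A j) = (\<integral>\<^sup>+x. indicator (A j) x \<partial>lborel)" by simp
      also have "\<dots> = ennreal c * (\<integral>\<^sup>+x. indicator (A j) (0 + c * x) \<partial>lborel)"
        using c by (subst nn_integral_real_affine[where t = 0 and c = c]) auto
      also have "(\<integral>\<^sup>+x. indicator (A j) (0 + c * x) \<partial>lborel) = (\<integral>\<^sup>+x. indicator ((*) c -` A j) x \<partial>lborel)"
        by (intro nn_integral_cong) (auto split: split_indicator)
      also have "\<dots> = emeasure lborel ((*) c -` A j)"
      proof (rule nn_integral_indicator)
        have "(*) c -` A j \<inter> space borel \<in> sets borel" by (rule measurable_sets[of _ borel borel]) auto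
        then show "(*) c -` A j \<in> sets lborel" by simp
      qed
      finally show ?thesis .
    qed
    have "f -` Pi\<^sub>E I A \<inter> space ?M = Pi\<^sub>E I (\<lambda>j. (*) c -` A j)"
      by (auto simp: f_def space_PiM PiE_def Pi_def)
    moreover have "(*) c -` A j \<in> sets lborel" if "j \<in> I" for j
    proof -
      have "(*) c -` A j \<inter> space borel \<in> sets borel"
        using A[OF that] by (intro measurable_sets[of _ borel borel]) auto
      then show ?thesis by simp
    qed
    ultimately have "emeasure (distr ?M ?M f) (Pi\<^sub>E I A) = (\<Prod>j\<in>I. emeasure lborel ((*) c -` A j))"
      using PA I by (simp add: emeasure_distr lborel_prod.emeasure_PiM)
    then have "emeasure (scale_measure (ennreal (c ^ card I)) (distr ?M ?M f)) (Pi\<^sub>E I A)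
       = (\<Prod>j\<in>I. ennreal c) * (\<Prod>j\<in>I. emeasure lborel ((*) c -` A j))"
      using c by (simp add: ennreal_power)
    also have "\<dots> = (\<Prod>j\<in>I. emeasure lborel (A j))"
      by (subst prod.distrib[symmetric], rule prod.cong) (use 1 in auto)
    finally show "emeasure (scale_measure (ennreal (c ^ card I)) (distr ?M ?M f)) (Pi\<^sub>E I A)
      = (\<Prod>j\<in>I. emeasure lborel (A j))" .
  qed simp
  then have "measure ?M X = measure (scale_measure (ennreal (c ^ card I)) (distr ?M ?M f)) X" by simp
  also have "\<dots> = c ^ card I * measure (distr ?M ?M f) X" using c by (simp add: Sigma_Algebra.measure_def enn2real_mult)
  also have "measure (distr ?M ?M f) X = measure ?M (f -` X \<inter> space ?M)"
    by (rule measure_distr[OF f X])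
  finally show "measure ?M X = c ^ card I * measure ?M {y \<in> space ?M. (\<lambda>j\<in>I. c * y j) \<in> X}"
    using vim[of X] by (simp add: f_def)
qed

text \<open>Brunn's theorem: by convexity, (1 - \<theta>) times the section at \<open>s\<close> plus
  \<theta> times the section at \<open>t\<close> lies in the intermediate section, and
  Brunn-Minkowski applies one dimension lower.\<close>

lemma hslice_concave:
  fixes A :: "'a::euclidean_space set"
  assumes i: "i \<in> Basis" and A: "compact A" "convex A"
    and ab: "a > 0" "b > 0" and s: "hslice i A s = a ^ (DIM('a) - 1)" and t: "hslice i A t = b ^ (DIM('a) - 1)"
    and \<theta>: "0 < \<theta>" "\<theta> < 1"
  shows "((1 - \<theta>) * a + \<theta> * b) ^ (DIM('a) - 1) \<le> hslice i A ((1 - \<theta>) * s + \<theta> * t)"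
proof -
  define I where "I = Basis - {i}"
  define r where "r = (1 - \<theta>) * s + \<theta> * t"
  have I: "finite I" "i \<notin> I" "insert i I = Basis" and card: "card I = DIM('a) - 1"
    using i by (auto simp: I_def)
  let ?M = "lebesgue_PiM I"
  define sl where "sl = slice_set I i (coord_set A)"
  \<comment> \<open>\<open>X\<close> and \<open>Y\<close> are the sections scaled by 1 - \<theta>
    and \<theta>, written as preimages under the inverse scaling, which makes them
    measurable.\<close>
  define X where "X = {y \<in> space ?M. (\<lambda>j\<in>I. (1 / (1 - \<theta>)) * y j) \<in> sl s}"
  define Y where "Y = {y \<in> space ?M. (\<lambda>j\<in>I. (1 / \<theta>) * y j) \<in> sl t}"
  obtain R0 where R0: "\<And>R. R \<ge> R0 \<Longrightarrow> boxed Basis R (coord_set A)" using compact_boxed A(1) by blast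
  define R where "R = max 0 R0"
  have R: "boxed (insert i I) R (coord_set A)" "0 \<le> R" using R0[of R] I by (auto simp: R_def)
  have bs: "boxed I R (sl u)" for u unfolding sl_def by (rule slice_set_boxed[OF I(1,2) R(1)])
  have sl_sets: "sl u \<in> sets ?M" for u using bs by (simp add: boxed_def)
  have msl: "measure ?M (sl u) = hslice i A u" for u
    by (simp add: hslice_def slice_vol_def sl_def I_def)
  have scl: "measure ?M {y \<in> space ?M. (\<lambda>j\<in>I. (1 / c) * y j) \<in> sl u} = c ^ card I * hslice i A u"
      "{y \<in> space ?M. (\<lambda>j\<in>I. (1 / c) * y j) \<in> sl u} \<in> sets ?M" if "c > 0" for c u
    using measure_PiM_scale[OF I(1) _ sl_sets[of u], of "1 / c"] that
    by (simp_all add: msl power_divide)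
  have mX: "measure ?M X = ((1 - \<theta>) * a) ^ card I" and X: "X \<in> sets ?M"
    unfolding X_def power_mult_distrib using scl[of "1 - \<theta>" s] \<theta> s card by auto
  have mY: "measure ?M Y = (\<theta> * b) ^ card I" and Y: "Y \<in> sets ?M"
    unfolding Y_def power_mult_distrib using scl[of \<theta> t] \<theta> t card by auto
  have bound: "\<bar>y j\<bar> \<le> R" if "(\<lambda>j\<in>I. (1 / c) * y j) \<in> sl u" "j \<in> I" "0 < c" "c \<le> 1" for y c u j
  proof -
    have "(1 / c) * y j \<in> {-R..R}" using bs[of u] that PiE_mem[of "\<lambda>j\<in>I. (1 / c) * y j" I "\<lambda>_. {-R..R}" j]
      by (auto simp: boxed_def)
    then have "\<bar>y j\<bar> / c \<le> R" using that(3) by (auto simp: abs_le_iff field_simps)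
    then have "\<bar>y j\<bar> \<le> c * R" using that(3) by (simp add: field_simps)
    also have "\<dots> \<le> 1 * R" using that R(2) by (intro mult_right_mono) auto
    finally show ?thesis by simp
  qed
  have bX: "boxed I R X" unfolding boxed_def using X \<theta> bound[of "1 - \<theta>" _ s]
    by (auto simp: X_def space_PiM PiE_def Pi_def abs_le_iff) (use minus_le_iff in blast)
  have bY: "boxed I R Y" unfolding boxed_def using Y \<theta> bound[of "\<theta>" _ t]
    by (auto simp: Y_def space_PiM PiE_def Pi_def abs_le_iff) (use minus_le_iff in blast)
  have "((1 - \<theta>) * a + \<theta> * b) ^ card I \<le> measure ?M (sl r)"
  proof (rule brunn_minkowski_PiMD[OF brunn_minkowski_PiM[OF I(1)] bX bY bs])
    fix x y assume x: "x \<in> X" and y: "y \<in> Y"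
    let ?e = "\<lambda>u z. u *\<^sub>R i + (\<Sum>b\<in>I. z b *\<^sub>R b)"
    have e: "sl u = {z \<in> space ?M. ?e u z \<in> A}" for u
      unfolding sl_def I_def by (rule slice_set_coord_set[OF i])
    have inA: "?e s (\<lambda>j\<in>I. (1 / (1 - \<theta>)) * x j) \<in> A" "?e t (\<lambda>j\<in>I. (1 / \<theta>) * y j) \<in> A"
      using x y by (auto simp: X_def Y_def e)
    have sc: "c *\<^sub>R ?e u (\<lambda>j\<in>I. (1 / c) * z j) = (c * u) *\<^sub>R i + (\<Sum>b\<in>I. z b *\<^sub>R b)" if "c \<noteq> 0" for c u z
      using that by (simp add: scaleR_add_right scaleR_sum_right)
    have "?e r (padd I x y) = (1 - \<theta>) *\<^sub>R ?e s (\<lambda>j\<in>I. (1 / (1 - \<theta>)) * x j) + \<theta> *\<^sub>R ?e t (\<lambda>j\<in>I. (1 / \<theta>) * y j)"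
      using \<theta> sc[of "1 - \<theta>" s x] sc[of \<theta> t y]
      by (simp add: padd_def r_def scaleR_add_left sum.distrib)
    also have "\<dots> \<in> A" using A(2) inA \<theta> by (intro convexD) auto
    finally show "padd I x y \<in> sl r" by (simp add: e space_PiM padd_def)
  qed (use mX mY ab \<theta> in auto)
  then show ?thesis by (simp add: msl card r_def)
qed

lemma hslice_pos:
  fixes A :: "'a::euclidean_space set"
  assumes i: "i \<in> Basis" and A: "compact A" and w: "w \<in> interior A"
  shows "hslice i A (w \<bullet> i) > 0"
proof -
  define I where "I = Basis - {i}"
  have I: "finite I" "i \<notin> I" "insert i I = Basis" using i by (auto simp: I_def)
  let ?M = "lebesgue_PiM I"
  obtain e where e: "e > 0" "ball w e \<subseteq> A" using w by (auto simp: mem_interior)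
  \<comment> \<open>All points of a box with half-sides \<open>d\<close> are within
    \<open>DIM('a) * d = e / 2\<close> of its centre, hence in the ball.\<close>
  define d where "d = e / (2 * DIM('a))"
  have d: "d > 0" using e by (simp add: d_def)
  define Q where "Q = Pi\<^sub>E I (\<lambda>j. {w \<bullet> j - d .. w \<bullet> j + d})"
  obtain R where "boxed Basis R (coord_set A)" using compact_boxed3 A by blast
  then have b: "boxed I R (slice_set I i (coord_set A) (w \<bullet> i))"
    using slice_set_boxed[OF I(1,2), of R "coord_set A"] I(3) by simp
  have "Q \<subseteq> slice_set I i (coord_set A) (w \<bullet> i)"
  proof
    fix y assume y: "y \<in> Q"
    let ?x = "(w \<bullet> i) *\<^sub>R i + (\<Sum>b\<in>I. y b *\<^sub>R b)"
    have "w = (\<Sum>b\<in>Basis. (w \<bullet> b) *\<^sub>R b)" by (simp add: euclidean_representation)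
    also have "\<dots> = (w \<bullet> i) *\<^sub>R i + (\<Sum>b\<in>I. (w \<bullet> b) *\<^sub>R b)"
      using i unfolding I_def by (rule sum.remove[OF finite_Basis])
    finally have "w - ?x = (\<Sum>b\<in>I. (w \<bullet> b - y b) *\<^sub>R b)"
      by (simp add: scaleR_diff_left sum_subtractf algebra_simps)
    also have "norm \<dots> \<le> (\<Sum>b\<in>I. d)"
    proof (rule sum_norm_le)
      fix b assume b: "b \<in> I"
      then have "y b \<in> {w \<bullet> b - d .. w \<bullet> b + d}" using y unfolding Q_def by (rule PiE_mem[rotated])
      then have "\<bar>w \<bullet> b - y b\<bar> \<le> d" by (auto simp: abs_le_iff)
      then show "norm ((w \<bullet> b - y b) *\<^sub>R b) \<le> d" using b by (simp add: I_def)
    qed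
    also have "\<dots> \<le> DIM('a) * d"
      using d card_mono[of Basis I] by (auto simp: I_def intro!: mult_right_mono)
    also have "\<dots> < e" using e by (simp add: d_def)
    finally have "?x \<in> A" using e by (auto simp: dist_norm)
    moreover have "y \<in> space ?M" using y by (auto simp: Q_def space_PiM PiE_def)
    ultimately show "y \<in> slice_set I i (coord_set A) (w \<bullet> i)"
      unfolding I_def slice_set_coord_set[OF i] by simp
  qed
  then have "emeasure ?M Q \<le> emeasure ?M (slice_set I i (coord_set A) (w \<bullet> i))"
    using b by (intro emeasure_mono) (auto simp: boxed_def)
  also have "\<dots> = ennreal (hslice i A (w \<bullet> i))"
    using boxed_finite_measure[OF I(1) b] by (simp add: hslice_def slice_vol_def I_def)
  also have "emeasure ?M Q = (\<Prod>j\<in>I. emeasure lborel {w \<bullet> j - d .. w \<bullet> j + d})"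
    unfolding Q_def by (intro lborel_prod.emeasure_PiM I) auto
  also have "\<dots> = ennreal ((2 * d) ^ card I)" using d by (simp add: ennreal_power)
  finally have "(2 * d) ^ card I \<le> hslice i A (w \<bullet> i)" by (simp add: ennreal_le_iff)
  moreover have "(2 * d) ^ card I > 0" using d by simp
  ultimately show ?thesis by linarith
qed

text \<open>The distribution function, not normalised, of the marginal of \<open>A\<close> in
  direction \<open>u\<close>. The vector \<open>u\<close> is arbitrary, although derivatives are
  taken only along basis vectors.\<close>

definition halfspace_vol :: "'a \<Rightarrow> 'a::euclidean_space set \<Rightarrow> real \<Rightarrow> real" where
  "halfspace_vol u A t = measure lebesgue (A \<inter> {x. x \<bullet> u \<le> t})"

lemma halfspace_vol_diff_bounds:
  fixes A :: "'a::euclidean_space set"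
  assumes i: "i \<in> Basis" and A: "compact A" and st: "s \<le> t"
  shows "(\<And>r. s \<le> r \<Longrightarrow> r \<le> t \<Longrightarrow> lo \<le> hslice i A r) \<Longrightarrow> lo * (t - s) \<le> halfspace_vol i A t - halfspace_vol i A s"
    and "(\<And>r. s \<le> r \<Longrightarrow> r \<le> t \<Longrightarrow> hslice i A r \<le> hi) \<Longrightarrow> halfspace_vol i A t - halfspace_vol i A s \<le> hi * (t - s)"
proof -
  have i0: "i \<noteq> 0" using i by auto
  let ?S = "A \<inter> {x. x \<bullet> i \<in> {s..t}}"
  have c: "compact (A \<inter> {x. x \<bullet> i \<le> t})" by (rule measure_affine_hyperplane_cut[OF i0 A])
  have eq: "(A \<inter> {x. x \<bullet> i \<le> t}) \<inter> {x. x \<bullet> i \<le> s} = A \<inter> {x. x \<bullet> i \<le> s}"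
     "(A \<inter> {x. x \<bullet> i \<le> t}) \<inter> {x. x \<bullet> i \<ge> s} = ?S" using st by auto
  have d: "halfspace_vol i A t - halfspace_vol i A s = measure lebesgue ?S"
    using measure_affine_hyperplane_cut(1)[OF i0 c, of s] unfolding eq halfspace_vol_def by simp
  have cS: "compact ?S" using measure_affine_hyperplane_cut(3)[OF i0 c, of s] unfolding eq .
  have m: "ennreal (measure lebesgue ?S) = (\<integral>\<^sup>+r. hslice i A r * indicator {s..t} r \<partial>lborel)"
    unfolding measure_eq_nn_integral_hslice[OF i cS] hslice_restrict[OF i]
    by (intro nn_integral_cong) (auto split: split_indicator)
  show "lo * (t - s) \<le> halfspace_vol i A t - halfspace_vol i A s"
    if "\<And>r. s \<le> r \<Longrightarrow> r \<le> t \<Longrightarrow> lo \<le> hslice i A r"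
  proof -
    have "ennreal (lo * (t - s)) \<le> ennreal (max lo 0) * ennreal (t - s)"
      using st by (subst ennreal_mult[symmetric]) (auto intro!: ennreal_leI mult_right_mono)
    also have "\<dots> = (\<integral>\<^sup>+r. ennreal (max lo 0) * indicator {s..t} r \<partial>lborel)"
      using st by (simp add: nn_integral_cmult)
    also have "\<dots> \<le> ennreal (measure lebesgue ?S)" unfolding m
      using that by (intro nn_integral_mono) (auto split: split_indicator intro: ennreal_leI)
    finally show ?thesis unfolding d by simp
  qed
  show "halfspace_vol i A t - halfspace_vol i A s \<le> hi * (t - s)"
    if hi: "\<And>r. s \<le> r \<Longrightarrow> r \<le> t \<Longrightarrow> hslice i A r \<le> hi"
  proof -
    have hi0: "hi \<ge> 0" using hi[of s] st hslice_nonneg[of i A s] by linarith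
    have "ennreal (measure lebesgue ?S) \<le> (\<integral>\<^sup>+r. ennreal hi * indicator {s..t} r \<partial>lborel)" unfolding m
      using hi by (intro nn_integral_mono) (auto split: split_indicator intro: ennreal_leI)
    also have "\<dots> = ennreal (hi * (t - s))"
      using st hi0 by (simp add: nn_integral_cmult ennreal_mult)
    finally show ?thesis unfolding d using hi0 st by (simp add: ennreal_le_iff)
  qed
qed

text \<open>The fundamental theorem of calculus at a continuity point, the integral entering only
  through upper and lower bounds for the increments of \<open>V\<close>.\<close>

lemma DERIV_from_increment_bounds:
  fixes V S :: "real \<Rightarrow> real"
  assumes lo: "\<And>s t lo. s \<le> t \<Longrightarrow> (\<And>r. s \<le> r \<Longrightarrow> r \<le> t \<Longrightarrow> lo \<le> S r) \<Longrightarrow> lo * (t - s) \<le> V t - V s"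
    and hi: "\<And>s t hi. s \<le> t \<Longrightarrow> (\<And>r. s \<le> r \<Longrightarrow> r \<le> t \<Longrightarrow> S r \<le> hi) \<Longrightarrow> V t - V s \<le> hi * (t - s)"
    and cont: "isCont S x"
  shows "DERIV V x :> S x"
  unfolding has_field_derivative_iff
proof (rule LIM_I)
  fix e :: real assume e: "e > 0"
  obtain d where d: "d > 0" "\<And>r. \<bar>r - x\<bar> < d \<Longrightarrow> \<bar>S r - S x\<bar> < e / 2"
    using cont e unfolding continuous_at_eps_delta dist_real_def by (metis half_gt_zero)
  have "norm ((V y - V x) / (y - x) - S x) < e" if y: "y \<noteq> x" "norm (y - x) < d" for y
  proof -
    define s t where "s = min x y" and "t = max x y"
    have st: "s < t" using y by (auto simp: s_def t_def)
    have q: "(V y - V x) / (y - x) = (V t - V s) / (t - s)"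
      unfolding s_def t_def min_def max_def by (auto simp: divide_simps) (simp add: algebra_simps)?
    have near: "\<bar>S r - S x\<bar> < e / 2" if "s \<le> r" "r \<le> t" for r
      using that y by (intro d(2)) (auto simp: s_def t_def)
    have "(S x - e / 2) * (t - s) \<le> V t - V s"
    proof (rule lo)
      fix r assume "s \<le> r" "r \<le> t"
      from near[OF this] show "S x - e / 2 \<le> S r" by linarith
    qed (use st in simp)
    then have 1: "S x - e / 2 \<le> (V t - V s) / (t - s)" using st by (simp add: pos_le_divide_eq)
    have "V t - V s \<le> (S x + e / 2) * (t - s)"
    proof (rule hi)
      fix r assume "s \<le> r" "r \<le> t"
      from near[OF this] show "S r \<le> S x + e / 2" by linarith
    qed (use st in simp)
    then have 2: "(V t - V s) / (t - s) \<le> S x + e / 2" using st by (simp add: pos_divide_le_eq)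
    show ?thesis unfolding q real_norm_def using 1 2 e by linarith
  qed
  then show "\<exists>d>0. \<forall>y. y \<noteq> x \<and> norm (y - x) < d \<longrightarrow> norm ((V y - V x) / (y - x) - S x) < e"
    using d(1) by blast
qed

lemma halfspace_vol_mono:
  fixes A :: "'a::euclidean_space set"
  assumes "i \<in> Basis" "compact A" "s \<le> t"
  shows "halfspace_vol i A s \<le> halfspace_vol i A t"
  using halfspace_vol_diff_bounds(1)[OF assms, of 0] by simp

lemma isCont_halfspace_vol:
  fixes A :: "'a::euclidean_space set"
  assumes i: "i \<in> Basis" and A: "compact A"
  shows "isCont (halfspace_vol i A) t"
proof -
  obtain M where M: "\<And>t. hslice i A t \<le> M" using hslice_bounded[OF i A] by blast
  have M0: "M \<ge> 0" using M[of 0] hslice_nonneg[of i A 0] by linarith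
  have *: "\<bar>halfspace_vol i A x - halfspace_vol i A y\<bar> \<le> M * \<bar>x - y\<bar>" if "x \<le> y" for x y
    using halfspace_vol_diff_bounds(2)[OF i A that, of M] halfspace_vol_mono[OF i A that] M that by auto
  have L: "\<bar>halfspace_vol i A x - halfspace_vol i A y\<bar> \<le> M * \<bar>x - y\<bar>" for x y
    using *[of x y] *[of y x] by (cases "x \<le> y") (auto simp: abs_minus_commute)
  have "((\<lambda>x. halfspace_vol i A x - halfspace_vol i A t) \<longlongrightarrow> 0) (at t)"
  proof (rule Lim_null_comparison[of _ "\<lambda>x. M * \<bar>x - t\<bar>"])
    show "\<forall>\<^sub>F x in at t. norm (halfspace_vol i A x - halfspace_vol i A t) \<le> M * \<bar>x - t\<bar>"
      using L by (intro always_eventually) auto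
    have "((\<lambda>x. M * \<bar>x - t\<bar>) \<longlongrightarrow> M * \<bar>t - t\<bar>) (at t)" by (intro tendsto_intros)
    then show "((\<lambda>x. M * \<bar>x - t\<bar>) \<longlongrightarrow> 0) (at t)" by simp
  qed
  then show ?thesis by (simp add: isCont_def LIM_zero_iff)
qed

text \<open>A segment from an interior point to a lowest or highest point of \<open>A\<close> stays
  in the interior before its end, so every strictly intermediate height is attained in the
  interior.\<close>

lemma convex_body_extent:
  fixes A :: "'a::euclidean_space set"
  assumes i: "i \<in> Basis" and A: "compact A" "convex A" "interior A \<noteq> {}"
  obtains a0 a1 where "a0 < a1" "\<And>x. x \<in> A \<Longrightarrow> a0 \<le> x \<bullet> i \<and> x \<bullet> i \<le> a1"
    "\<And>t. a0 < t \<Longrightarrow> t < a1 \<Longrightarrow> \<exists>w\<in>interior A. w \<bullet> i = t"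
proof -
  obtain w where w: "w \<in> interior A" using A by auto
  have ne: "A \<noteq> {}" using A by auto
  have cont: "continuous_on A (\<lambda>x. x \<bullet> i)" by (intro continuous_intros)
  obtain x0 where x0: "x0 \<in> A" "\<And>x. x \<in> A \<Longrightarrow> x0 \<bullet> i \<le> x \<bullet> i"
    using continuous_attains_inf[OF A(1) ne cont] by auto
  obtain x1 where x1: "x1 \<in> A" "\<And>x. x \<in> A \<Longrightarrow> x \<bullet> i \<le> x1 \<bullet> i"
    using continuous_attains_sup[OF A(1) ne cont] by auto
  obtain e where e: "e > 0" "cball w e \<subseteq> A" using w by (auto simp: mem_interior_cball)
  have "w + e *\<^sub>R i \<in> A" "w - e *\<^sub>R i \<in> A" using e i by (auto simp: dist_norm intro!: subsetD[OF e(2)])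
  from x1(2)[OF this(1)] x0(2)[OF this(2)] have lt: "x0 \<bullet> i < w \<bullet> i" "w \<bullet> i < x1 \<bullet> i"
    using e i by (auto simp: inner_add_left inner_diff_left)
  have seg: "\<exists>v\<in>interior A. v \<bullet> i = t" if z: "z \<in> A" and \<theta>: "0 < \<theta>" "\<theta> < 1" "t = w \<bullet> i + \<theta> * (z \<bullet> i - w \<bullet> i)"
      and ne: "w \<bullet> i \<noteq> z \<bullet> i" for t \<theta> z
  proof -
    have "(1 - \<theta>) *\<^sub>R w + \<theta> *\<^sub>R z \<in> open_segment w z"
      using \<theta> ne by (auto simp: in_segment)
    then have "(1 - \<theta>) *\<^sub>R w + \<theta> *\<^sub>R z \<in> interior A"
      using in_interior_closure_convex_segment[OF A(2) w, of z] z closure_subset by blast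
    then show ?thesis by (intro bexI[of _ "(1 - \<theta>) *\<^sub>R w + \<theta> *\<^sub>R z"]) (auto simp: \<theta>(3) inner_add_left algebra_simps)
  qed
  show ?thesis
  proof (rule that[of "x0 \<bullet> i" "x1 \<bullet> i"])
    fix t assume t: "x0 \<bullet> i < t" "t < x1 \<bullet> i"
    consider "t = w \<bullet> i" | "t < w \<bullet> i" | "t > w \<bullet> i" by linarith
    then show "\<exists>w\<in>interior A. w \<bullet> i = t"
    proof cases
      case 2
      show ?thesis
        by (rule seg[OF x0(1), of "(t - w \<bullet> i) / (x0 \<bullet> i - w \<bullet> i)"])
           (use 2 t lt in \<open>auto simp: divide_neg_neg neg_divide_less_eq\<close>)
    next
      case 3
      show ?thesis
        by (rule seg[OF x1(1), of "(t - w \<bullet> i) / (x1 \<bullet> i - w \<bullet> i)"])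
           (use 3 t lt in \<open>auto simp: pos_divide_less_eq\<close>)
    qed (use w in auto)
  qed (use x0 x1 lt in auto)
qed

lemma hslice_quasi_concave:
  fixes A :: "'a::euclidean_space set"
  assumes i: "i \<in> Basis" and dim: "DIM('a) \<ge> 2" and A: "compact A" "convex A"
    and st: "s < r" "r < t" and c: "c < hslice i A s" "c < hslice i A t" "0 \<le> c"
  shows "c < hslice i A r"
proof -
  let ?m = "DIM('a) - 1"
  have m: "?m > 0" using dim by simp
  define a b where "a = root ?m (hslice i A s)" and "b = root ?m (hslice i A t)"
  have pos: "hslice i A s > 0" "hslice i A t > 0" using c by linarith+
  have ab: "a > 0" "b > 0" "hslice i A s = a ^ ?m" "hslice i A t = b ^ ?m"
    using pos m by (auto simp: a_def b_def)
  define \<theta> where "\<theta> = (r - s) / (t - s)"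
  have \<theta>: "0 < \<theta>" "\<theta> < 1" using st by (auto simp: \<theta>_def)
  have "(1 - \<theta>) * s + \<theta> * t = s + \<theta> * (t - s)" by (simp add: algebra_simps)
  also have "\<dots> = r" using st by (simp add: \<theta>_def)
  finally have r: "(1 - \<theta>) * s + \<theta> * t = r" .
  have "(1 - \<theta>) * min a b + \<theta> * min a b \<le> (1 - \<theta>) * a + \<theta> * b"
    using \<theta> by (intro add_mono mult_left_mono) auto
  then have "min a b \<le> (1 - \<theta>) * a + \<theta> * b" by (simp add: algebra_simps)
  then have "min a b ^ ?m \<le> ((1 - \<theta>) * a + \<theta> * b) ^ ?m" using ab by (intro power_mono) auto
  also have "\<dots> \<le> hslice i A r"
    using hslice_concave[OF i A ab(1,2,3,4) \<theta>] unfolding r .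
  finally show ?thesis using c ab by (auto simp: min_def split: if_splits)
qed

text \<open>The negated (n-1)-st root of the section function is convex by Brunn's theorem, hence
  continuous on an open interval. At the extreme heights the section function may jump, as for a
  cube.\<close>

lemma isCont_hslice:
  fixes A :: "'a::euclidean_space set"
  assumes i: "i \<in> Basis" and dim: "DIM('a) \<ge> 2" and A: "compact A" "convex A"
    and w: "\<And>t. a0 < t \<Longrightarrow> t < a1 \<Longrightarrow> \<exists>w\<in>interior A. w \<bullet> i = t" and t: "a0 < t" "t < a1"
  shows "isCont (hslice i A) t"
proof -
  let ?m = "DIM('a) - 1" and ?f = "\<lambda>t. - root (DIM('a) - 1) (hslice i A t)"
  have m: "?m > 0" using dim by simp
  have pos: "hslice i A t > 0" if "a0 < t" "t < a1" for t
    using w[OF that] hslice_pos[OF i A(1)] by blast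
  have "convex_on {a0<..<a1} ?f"
  proof (rule convex_onI)
    fix \<theta> x y :: real assume \<theta>: "0 < \<theta>" "\<theta> < 1" and xy: "x \<in> {a0<..<a1}" "y \<in> {a0<..<a1}"
    define a b where "a = root ?m (hslice i A x)" and "b = root ?m (hslice i A y)"
    have ab: "a > 0" "b > 0" "hslice i A x = a ^ ?m" "hslice i A y = b ^ ?m"
      using pos xy m by (auto simp: a_def b_def)
    have "((1 - \<theta>) * a + \<theta> * b) ^ ?m \<le> hslice i A ((1 - \<theta>) * x + \<theta> * y)"
      by (rule hslice_concave[OF i A ab \<theta>])
    then have "root ?m (((1 - \<theta>) * a + \<theta> * b) ^ ?m) \<le> root ?m (hslice i A ((1 - \<theta>) * x + \<theta> * y))"
      using m by (simp only: real_root_le_iff)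
    also have "root ?m (((1 - \<theta>) * a + \<theta> * b) ^ ?m) = (1 - \<theta>) * a + \<theta> * b"
      using m ab \<theta> by (intro real_root_power_cancel) auto
    finally show "?f ((1 - \<theta>) *\<^sub>R x + \<theta> *\<^sub>R y) \<le> (1 - \<theta>) * ?f x + \<theta> * ?f y"
      by (simp add: a_def b_def)
  qed simp
  then have "continuous_on {a0<..<a1} ?f" by (intro convex_on_continuous) auto
  then have "isCont ?f t" using t by (simp add: continuous_on_eq_continuous_at)
  then have "isCont (\<lambda>t. (- ?f t) ^ ?m) t" by (rule continuous_power[OF continuous_minus])
  moreover have "(\<lambda>t. (- ?f t) ^ ?m) = hslice i A" using m by (intro ext) simp
  ultimately show ?thesis by (simp only:)
qed

text \<open>A consequence of quasi-concavity. It recovers single sections from the maxima over two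
  halves, the only quantities that equality controls.\<close>

lemma hslice_eq_min_sup:
  fixes A :: "'a::euclidean_space set"
  assumes i: "i \<in> Basis" and dim: "DIM('a) \<ge> 2" and A: "compact A" "convex A"
  shows "hslice i A t = min (sup_hslice i (A \<inter> {x. x \<bullet> i \<le> t})) (sup_hslice i (A \<inter> {x. x \<bullet> i \<ge> t}))"
proof (rule antisym)
  have i0: "i \<noteq> 0" using i by auto
  note c = measure_affine_hyperplane_cut(2,3)[OF i0 A(1), of t]
  have res: "hslice i (A \<inter> {x. x \<bullet> i \<le> t}) s = (if s \<le> t then hslice i A s else 0)"
    "hslice i (A \<inter> {x. x \<bullet> i \<ge> t}) s = (if s \<ge> t then hslice i A s else 0)" for s
    using hslice_restrict[OF i, of A "{..t}" s] hslice_restrict[OF i, of A "{t..}" s] by auto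
  show "hslice i A t \<le> min (sup_hslice i (A \<inter> {x. x \<bullet> i \<le> t})) (sup_hslice i (A \<inter> {x. x \<bullet> i \<ge> t}))"
    using hslice_le_sup(1)[OF i c(1), of t] hslice_le_sup(1)[OF i c(2), of t] by (simp add: res)
  show "min (sup_hslice i (A \<inter> {x. x \<bullet> i \<le> t})) (sup_hslice i (A \<inter> {x. x \<bullet> i \<ge> t})) \<le> hslice i A t"
  proof (rule ccontr)
    assume "\<not> ?thesis"
    then have "hslice i A t < sup_hslice i (A \<inter> {x. x \<bullet> i \<le> t})" "hslice i A t < sup_hslice i (A \<inter> {x. x \<bullet> i \<ge> t})"
      by auto
    then obtain s r where "hslice i (A \<inter> {x. x \<bullet> i \<le> t}) s > hslice i A t"
      "hslice i (A \<inter> {x. x \<bullet> i \<ge> t}) r > hslice i A t"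
      using hslice_le_sup(2)[OF i c(1)] hslice_le_sup(2)[OF i c(2)] by metis
    then have "s \<le> t" "hslice i A s > hslice i A t" "r \<ge> t" "hslice i A r > hslice i A t"
      unfolding res using not_less[THEN iffD2, OF hslice_nonneg[of i A t]] by (simp_all split: if_splits)
    then show False using hslice_quasi_concave[OF i dim A, of s t r "hslice i A t"]
      by (cases "s = t"; cases "r = t") auto
  qed
qed

section \<open>The equality case of the Brunn-Minkowski inequality\<close>

text \<open>The model is the section function \<open>S\<close> of a convex body in one direction,
  with cumulative volume \<open>V\<close>, extent from \<open>a0\<close> to \<open>a1\<close> and
  total volume \<open>v\<close>. The derivative is demanded only strictly inside because
  \<open>S\<close> may jump at the ends, while \<open>V\<close> is continuous everywhere.\<close>

locale slab_profile =
  fixes S V :: "real \<Rightarrow> real" and a0 a1 v :: real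
  assumes less: "a0 < a1"
    and deriv: "\<And>t. a0 < t \<Longrightarrow> t < a1 \<Longrightarrow> DERIV V t :> S t"
    and pos: "\<And>t. a0 < t \<Longrightarrow> t < a1 \<Longrightarrow> S t > 0"
    and cont: "\<And>t. isCont V t"
    and V0: "\<And>t. t \<le> a0 \<Longrightarrow> V t = 0" and V1: "\<And>t. a1 \<le> t \<Longrightarrow> V t = v"
begin

lemma strict: "a0 \<le> s \<Longrightarrow> s < t \<Longrightarrow> t \<le> a1 \<Longrightarrow> V s < V t"
proof (rule DERIV_pos_imp_increasing_open[of s t])
  fix x assume "a0 \<le> s" "t \<le> a1" "s < x" "x < t"
  then show "\<exists>y. DERIV V x :> y \<and> 0 < y" using deriv[of x] pos[of x] by auto
qed (simp_all add: continuous_at_imp_continuous_on cont)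

lemma v_pos: "0 < v"
  using strict[of a0 a1] V0[of a0] V1[of a1] less by simp

lemma range: "a0 < t \<Longrightarrow> t < a1 \<Longrightarrow> 0 < V t \<and> V t < v"
  using strict[of a0 t] strict[of t a1] V0[of a0] V1[of a1] by simp

lemma bounds: "0 \<le> V t" "V t \<le> v"
  using range[of t] V0[of t] V1[of t] v_pos by (cases "a0 < t"; cases "t < a1"; auto)+

lemma mono: "s \<le> t \<Longrightarrow> V s \<le> V t"
proof -
  assume st: "s \<le> t"
  consider "s \<le> a0" | "a1 \<le> t" | "a0 < s" "t < a1" by linarith
  then show "V s \<le> V t"
  proof cases
    case 3
    then show ?thesis using strict[of s t] st by (cases "s = t") auto
  qed (use bounds V0 V1 in auto)
qed

lemma ex_inverse: "0 < y \<Longrightarrow> y < v \<Longrightarrow> \<exists>t. a0 < t \<and> t < a1 \<and> V t = y"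
proof -
  assume y: "0 < y" "y < v"
  obtain t where t: "a0 \<le> t" "t \<le> a1" "V t = y"
    using IVT[of V a0 y a1] y V0[of a0] V1[of a1] cont less by (auto simp: less_imp_le)
  moreover have "t \<noteq> a0" "t \<noteq> a1" using t y V0[of a0] V1[of a1] by auto
  ultimately show ?thesis by (metis order_le_less)
qed

text \<open>The quantile function of \<open>V\<close>, meaningful for \<open>y\<close> strictly
  between 0 and \<open>v\<close>.\<close>

definition inverse_profile :: "real \<Rightarrow> real" where
  "inverse_profile y = (SOME t. a0 < t \<and> t < a1 \<and> V t = y)"

lemma inverse_profile:
  assumes "0 < y" "y < v"
  shows "a0 < inverse_profile y" "inverse_profile y < a1" "V (inverse_profile y) = y"
  using someI_ex[OF ex_inverse[OF assms]] by (auto simp: inverse_profile_def)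

lemma inverse_profile_V:
  assumes t: "a0 < t" "t < a1"
  shows "inverse_profile (V t) = t"
proof (rule ccontr)
  note i = inverse_profile[OF conjunct1[OF range[OF t]] conjunct2[OF range[OF t]]]
  assume "inverse_profile (V t) \<noteq> t"
  then consider "inverse_profile (V t) < t" | "t < inverse_profile (V t)" by linarith
  then show False
    using strict[of "inverse_profile (V t)" t] strict[of t "inverse_profile (V t)"] i t
    by cases simp_all
qed

lemma DERIV_inverse_profile:
  assumes y: "0 < y" "y < v"
  shows "DERIV inverse_profile y :> inverse (S (inverse_profile y))"
proof (rule DERIV_inverse_function[where f = V and a = 0 and b = v])
  let ?t = "inverse_profile y"
  note t = inverse_profile[OF y]
  show "DERIV V ?t :> S ?t" using deriv t by simp
  show "S ?t \<noteq> 0" using pos[of ?t] t by simp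
  obtain c where c: "a0 < c" "c < ?t" using dense[OF t(1)] by auto
  obtain d where d: "?t < d" "d < a1" using dense[OF t(2)] by auto
  note cd = c d
  have "isCont inverse_profile (V ?t)"
    by (rule isCont_inverse_function2[of c _ d]) (use cd inverse_profile_V cont in auto)
  then show "isCont inverse_profile y" unfolding t(3) .
qed (rule y inverse_profile(3); assumption)+

end

text \<open>The map matching equal proportions \<open>VA / p\<^sup>n\<close> and \<open>VB / q\<^sup>n\<close> has constant derivative \<open>q / p\<close>.\<close>

lemma slab_profile_affine:
  assumes A: "slab_profile SA VA a0 a1 (p ^ Suc m)" and B: "slab_profile SB VB b0 b1 (q ^ Suc m)"
    and p: "p > 0" and q: "q > 0"
    and match: "\<And>t u. a0 < t \<Longrightarrow> t < a1 \<Longrightarrow> b0 < u \<Longrightarrow> u < b1 \<Longrightarrow>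
        VA t * q ^ Suc m = VB u * p ^ Suc m \<Longrightarrow> SA t * q ^ m = SB u * p ^ m"
  shows "\<exists>c. \<forall>t. VB (t * (q / p) + c) = (q / p) ^ Suc m * VA t"
proof -
  interpret A: slab_profile SA VA a0 a1 "p ^ Suc m" by (rule A)
  interpret B: slab_profile SB VB b0 b1 "q ^ Suc m" by (rule B)
  define k where "k = (q / p) ^ Suc m"
  have k: "k > 0" "k * p ^ Suc m = q ^ Suc m" using p q by (auto simp: k_def power_divide)
  \<comment> \<open>\<tau> sends a height in \<open>A\<close> to the height in \<open>B\<close>
    below which the same proportion of volume lies.\<close>
  define \<tau> where "\<tau> t = B.inverse_profile (k * VA t)" for t
  have rng: "0 < k * VA t" "k * VA t < q ^ Suc m" if "a0 < t" "t < a1" for t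
    using A.range[OF that] k mult_strict_left_mono[of "VA t" "p ^ Suc m" k] by auto
  have D: "DERIV \<tau> t :> q / p" if t: "a0 < t" "t < a1" for t
  proof -
    note r = rng[OF t]
    have "DERIV (\<lambda>t. k * VA t) t :> k * SA t" by (rule DERIV_cmult[OF A.deriv[OF t]])
    from DERIV_chain2[OF B.DERIV_inverse_profile[OF r] this]
    have "DERIV \<tau> t :> inverse (SB (\<tau> t)) * (k * SA t)" by (simp add: \<tau>_def[abs_def])
    \<comment> \<open>\<open>match\<close> makes SB equal to SA times (q/p)^m, while k is
      (q/p)^(m+1): one factor q/p remains.\<close>
    moreover have "inverse (SB (\<tau> t)) * (k * SA t) = q / p"
    proof -
      note i = B.inverse_profile[OF r, folded \<tau>_def]
      have "VA t * q ^ Suc m = VB (\<tau> t) * p ^ Suc m"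
        unfolding i(3) k(2)[symmetric] by (simp add: ac_simps)
      from match[OF t i(1,2) this] have eq: "SB (\<tau> t) = SA t * q ^ m / p ^ m"
        using p by (simp add: field_simps)
      show ?thesis using A.pos[OF t] p q unfolding eq k_def by (simp add: power_divide field_simps)
    qed
    ultimately show ?thesis by simp
  qed
  have "\<exists>c. \<forall>t\<in>{a0<..<a1}. \<tau> t - t * (q / p) = c"
  proof (rule has_field_derivative_zero_constant)
    fix t assume "t \<in> {a0<..<a1}"
    then have "DERIV (\<lambda>t. \<tau> t - t * (q / p)) t :> q / p - q / p"
      by (intro DERIV_diff D DERIV_cmult_right[of "\<lambda>t. t" 1, simplified]) auto
    then show "((\<lambda>t. \<tau> t - t * (q / p)) has_field_derivative 0) (at t within {a0<..<a1})"
      by (simp add: has_field_derivative_at_within)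
  qed simp
  then obtain c where c: "\<And>t. a0 < t \<Longrightarrow> t < a1 \<Longrightarrow> \<tau> t = t * (q / p) + c" by (force simp: algebra_simps)
  \<comment> \<open>The identity \<open>F t = 0\<close> holds strictly inside. Continuity carries it
    to the end heights; beyond them \<open>VA\<close> is constant, and \<open>VB\<close> is squeezed
    between its value there and its extreme value 0 or \<open>q ^ Suc m\<close>.\<close>
  define F where "F t = VB (t * (q / p) + c) - k * VA t" for t
  have F0: "F t = 0" if t: "a0 < t" "t < a1" for t
    using B.inverse_profile(3)[OF rng[OF t]] c[OF t] by (simp add: F_def \<tau>_def)
  have "isCont F t" for t
  proof -
    have "isCont (\<lambda>t. VB (t * (q / p) + c)) t"
      by (rule isCont_o2[where g = VB]) (rule isCont_add isCont_mult continuous_ident continuous_const B.cont)+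
    then show ?thesis unfolding F_def by (intro isCont_diff isCont_mult continuous_const A.cont)
  qed
  then have contF: "continuous_on UNIV F" by (simp add: continuous_at_imp_continuous_on)
  have Fc: "F t = 0" if "t \<in> closure {a0<..<a1}" for t
    using continuous_constant_on_closure[of "{a0<..<a1}" F 0 t] contF F0 that
    by (auto intro: continuous_on_subset)
  have F01: "F a0 = 0" "F a1 = 0" using Fc[of a0] Fc[of a1] A.less by auto
  have "F t = 0" for t
  proof -
    consider "t \<le> a0" | "a0 < t" "t < a1" | "a1 \<le> t" by linarith
    then show ?thesis
    proof cases
      case 1
      have "VB (t * (q / p) + c) \<le> VB (a0 * (q / p) + c)"
        using 1 p q by (intro B.mono add_right_mono mult_right_mono) auto
      then show ?thesis using F01(1) A.V0[of a0] A.V0[OF 1] B.bounds(1)[of "t * (q / p) + c"] by (simp add: F_def)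
    next
      case 3
      have "VB (a1 * (q / p) + c) \<le> VB (t * (q / p) + c)"
        using 3 p q by (intro B.mono add_right_mono mult_right_mono) auto
      then show ?thesis using F01(2) A.V1[of a1] A.V1[OF 3] k(2) B.bounds(2)[of "t * (q / p) + c"] by (simp add: F_def)
    qed (use F0 in auto)
  qed
  then show ?thesis by (auto simp: F_def k_def)
qed

lemma slab_profile_convex_body:
  fixes A :: "'a::euclidean_space set"
  assumes i: "i \<in> Basis" and dim: "DIM('a) \<ge> 2" and A: "compact A" "convex A" "interior A \<noteq> {}"
  shows "\<exists>a0 a1. slab_profile (hslice i A) (halfspace_vol i A) a0 a1 (measure lebesgue A)"
proof -
  obtain a0 a1 where a: "a0 < a1" "\<And>x. x \<in> A \<Longrightarrow> a0 \<le> x \<bullet> i \<and> x \<bullet> i \<le> a1"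
    "\<And>t. a0 < t \<Longrightarrow> t < a1 \<Longrightarrow> \<exists>w\<in>interior A. w \<bullet> i = t"
    using convex_body_extent[OF i A] by blast
  have "slab_profile (hslice i A) (halfspace_vol i A) a0 a1 (measure lebesgue A)"
  proof
    fix t assume t: "a0 < t" "t < a1"
    show "DERIV (halfspace_vol i A) t :> hslice i A t"
      by (rule DERIV_from_increment_bounds[OF halfspace_vol_diff_bounds[OF i A(1)]
            isCont_hslice[OF i dim A(1,2) a(3) t]]) auto
    show "0 < hslice i A t" using a(3)[OF t] hslice_pos[OF i A(1)] by blast
  next
    fix t assume t: "t \<le> a0"
    have "A \<inter> {x. x \<bullet> i \<le> t} \<subseteq> {x. i \<bullet> x = a0}"
      using a(2) t by (force simp: inner_commute)
    then have "negligible (A \<inter> {x. x \<bullet> i \<le> t})"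
      using negligible_hyperplane[of i a0] i negligible_subset by (metis nonzero_Basis)
    then show "halfspace_vol i A t = 0" by (simp add: halfspace_vol_def negligible_imp_measure0)
  next
    fix t assume t: "a1 \<le> t"
    have "A \<inter> {x. x \<bullet> i \<le> t} = A" using a(2) t by force
    then show "halfspace_vol i A t = measure lebesgue A" by (simp add: halfspace_vol_def)
  qed (use a isCont_halfspace_vol[OF i A(1)] in auto)
  then show ?thesis by blast
qed

lemma brunn_minkowski_equality_axis:
  fixes A B C :: "'a::euclidean_space set"
  assumes i: "i \<in> Basis" and dim: "DIM('a) \<ge> 2"
    and A: "compact A" "convex A" "interior A \<noteq> {}" and B: "compact B" "convex B" "interior B \<noteq> {}"
    and C: "compact C"
    and sum: "\<And>x y. x \<in> A \<Longrightarrow> y \<in> B \<Longrightarrow> x + y \<in> C"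
    and p: "p > 0" and q: "q > 0" and mA: "measure lebesgue A = p ^ DIM('a)"
    and mB: "measure lebesgue B = q ^ DIM('a)"
    and mC: "measure lebesgue C \<le> (p + q) ^ DIM('a)"
  shows "\<exists>c. \<forall>t. halfspace_vol i B (t * (q / p) + c) = (q / p) ^ DIM('a) * halfspace_vol i A t"
proof -
  define m where "m = DIM('a) - 1"
  have n: "DIM('a) = Suc m" using dim by (simp add: m_def)
  obtain a0 a1 where a: "slab_profile (hslice i A) (halfspace_vol i A) a0 a1 (p ^ DIM('a))"
    using slab_profile_convex_body[OF i dim A] mA by auto
  obtain b0 b1 where b: "slab_profile (hslice i B) (halfspace_vol i B) b0 b1 (q ^ DIM('a))"
    using slab_profile_convex_body[OF i dim B] mB by auto
  have "\<exists>c. \<forall>t. halfspace_vol i B (t * (q / p) + c) = (q / p) ^ Suc m * halfspace_vol i A t"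
  proof (rule slab_profile_affine[OF a[unfolded n] b[unfolded n] p q])
    fix t u assume t: "a0 < t" "t < a1" and u: "b0 < u" "u < b1"
      and "halfspace_vol i A t * q ^ Suc m = halfspace_vol i B u * p ^ Suc m"
    then have eq: "halfspace_vol i A t * q ^ DIM('a) = halfspace_vol i B u * p ^ DIM('a)" unfolding n by blast
    \<comment> \<open>The common proportion of volume below the heights \<open>t\<close> and
      \<open>u\<close>.\<close>
    define \<theta> where "\<theta> = halfspace_vol i A t / p ^ DIM('a)"
    have \<theta>: "0 < \<theta>" "\<theta> < 1" using slab_profile.range[OF a t] p by (auto simp: \<theta>_def)
    have t': "measure lebesgue (A \<inter> {x. x \<bullet> i \<le> t}) = \<theta> * p ^ DIM('a)"
      using p by (simp add: \<theta>_def halfspace_vol_def)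
    have u': "measure lebesgue (B \<inter> {x. x \<bullet> i \<le> u}) = \<theta> * q ^ DIM('a)"
      using p eq by (simp add: \<theta>_def halfspace_vol_def field_simps)
    note cut = brunn_minkowski_equality_cut[OF i dim A(1) B(1) C sum p q mA mB mC \<theta> t' u']
    have P: "p ^ (DIM('a) - 1) \<ge> 0" "q ^ (DIM('a) - 1) \<ge> 0" using p q by simp_all
    \<comment> \<open>Each section is the minimum of the maxima over two halves, and for both halves
      these maxima are in the ratio \<open>p ^ m\<close> to \<open>q ^ m\<close>.\<close>
    show "hslice i A t * q ^ m = hslice i B u * p ^ m"
      unfolding hslice_eq_min_sup[OF i dim A(1,2), of t] hslice_eq_min_sup[OF i dim B(1,2), of u]
      using cut P unfolding m_def by (simp add: min_mult_distrib_right)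
  qed
  then show ?thesis by (simp only: n)
qed

text \<open>A shear carries the functional \<open>x \<bullet> u\<close> to a coordinate; rotation invariance of the Lebesgue
  measure is available in the library only for well-ordered index types.\<close>

lemma nn_integral_lborel_shear:
  fixes f :: "'a::euclidean_space \<Rightarrow> ennreal"
  assumes i: "i \<in> Basis" and u: "u \<bullet> i \<noteq> 0" and [measurable]: "f \<in> borel_measurable borel"
  shows "(\<integral>\<^sup>+x. f x \<partial>lborel) = ennreal \<bar>u \<bullet> i\<bar> * (\<integral>\<^sup>+x. f (x + (x \<bullet> u - x \<bullet> i) *\<^sub>R i) \<partial>lborel)"
proof -
  define I where "I = Basis - {i}"
  have I: "finite I" "i \<notin> I" and BI: "Basis = insert i I" using i by (auto simp: I_def)
  define e where "e t y = t *\<^sub>R i + (\<Sum>b\<in>I. y b *\<^sub>R b)" for t and y :: "'a \<Rightarrow> real"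
  have esum: "(\<Sum>b\<in>Basis. (y(i := t)) b *\<^sub>R b) = e t y" for y t
    unfolding BI e_def using I by (auto intro!: sum.cong)
  have fub: "(\<integral>\<^sup>+x. g x \<partial>lborel) = (\<integral>\<^sup>+y. (\<integral>\<^sup>+t. g (e t y) \<partial>lborel) \<partial>lebesgue_PiM I)"
    if [measurable]: "g \<in> borel_measurable borel" for g :: "'a \<Rightarrow> ennreal"
  proof -
    have m [measurable]: "(\<lambda>f. \<Sum>b\<in>Basis. f b *\<^sub>R b) \<in> measurable (lebesgue_PiM (Basis :: 'a set)) borel"
      by measurable
    have "(\<integral>\<^sup>+x. g x \<partial>lborel) = (\<integral>\<^sup>+y. g (\<Sum>b\<in>Basis. y b *\<^sub>R b) \<partial>lebesgue_PiM Basis)"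
      by (subst lborel_eq, subst nn_integral_distr) auto
    also have "\<dots> = (\<integral>\<^sup>+y. (\<integral>\<^sup>+t. g (\<Sum>b\<in>Basis. (y(i := t)) b *\<^sub>R b) \<partial>lborel) \<partial>lebesgue_PiM I)"
      unfolding BI by (rule lborel_prod.product_nn_integral_insert[OF I]) (use m in \<open>simp add: BI\<close>)
    finally show ?thesis unfolding esum .
  qed
  have inner: "e t y \<bullet> i = t" "e t y \<bullet> u = (u \<bullet> i) * t + (\<Sum>b\<in>I. y b *\<^sub>R b) \<bullet> u" for t y
  proof -
    have "(\<Sum>b\<in>I. y b *\<^sub>R b) \<bullet> i = 0"
      using i by (auto simp: I_def inner_sum_left inner_not_same_Basis intro!: sum.neutral)
    then show "e t y \<bullet> i = t" "e t y \<bullet> u = (u \<bullet> i) * t + (\<Sum>b\<in>I. y b *\<^sub>R b) \<bullet> u"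
      using i by (simp_all add: e_def inner_add_left inner_commute[of i u])
  qed
  \<comment> \<open>On a line parallel to \<open>i\<close> the shear changes only the coordinate
    \<open>t\<close>, into an affine function of \<open>t\<close> with slope
    \<open>u \<bullet> i\<close>; Fubini thus leaves a one-dimensional substitution.\<close>
  have sh: "e t y + (e t y \<bullet> u - e t y \<bullet> i) *\<^sub>R i = e ((\<Sum>b\<in>I. y b *\<^sub>R b) \<bullet> u + (u \<bullet> i) * t) y" for t y
    unfolding inner by (simp add: e_def algebra_simps)
  have me [measurable]: "(\<lambda>t. e t y) \<in> borel_measurable borel" for y
    unfolding e_def by measurable
  have "(\<integral>\<^sup>+x. f x \<partial>lborel) = (\<integral>\<^sup>+y. (\<integral>\<^sup>+t. f (e t y) \<partial>lborel) \<partial>lebesgue_PiM I)"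
    by (rule fub) measurable
  also have "\<dots> = (\<integral>\<^sup>+y. ennreal \<bar>u \<bullet> i\<bar> * (\<integral>\<^sup>+t. f (e ((\<Sum>b\<in>I. y b *\<^sub>R b) \<bullet> u + (u \<bullet> i) * t) y) \<partial>lborel) \<partial>lebesgue_PiM I)"
    by (intro nn_integral_cong nn_integral_real_affine u) measurable
  also have "\<dots> = (\<integral>\<^sup>+y. ennreal \<bar>u \<bullet> i\<bar> * (\<integral>\<^sup>+t. f (e t y + (e t y \<bullet> u - e t y \<bullet> i) *\<^sub>R i) \<partial>lborel) \<partial>lebesgue_PiM I)"
    unfolding sh ..
  also have "\<dots> = (\<integral>\<^sup>+x. ennreal \<bar>u \<bullet> i\<bar> * f (x + (x \<bullet> u - x \<bullet> i) *\<^sub>R i) \<partial>lborel)"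
    by (subst fub) (auto intro!: nn_integral_cong nn_integral_cmult[symmetric])
  also have "\<dots> = ennreal \<bar>u \<bullet> i\<bar> * (\<integral>\<^sup>+x. f (x + (x \<bullet> u - x \<bullet> i) *\<^sub>R i) \<partial>lborel)"
    by (rule nn_integral_cmult) measurable
  finally show ?thesis .
qed

lemma linear_shear: "linear (\<lambda>x::'a::euclidean_space. x + (x \<bullet> u - x \<bullet> i) *\<^sub>R i)"
  by (rule linearI) (simp_all add: inner_add_left algebra_simps)

lemma inj_shear:
  fixes u i :: "'a::euclidean_space"
  assumes i: "i \<in> Basis" and u: "u \<bullet> i \<noteq> 0"
  shows "inj (\<lambda>x. x + (x \<bullet> u - x \<bullet> i) *\<^sub>R i)"
proof (rule linear_injective_0[OF linear_shear, THEN iffD2], safe)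
  fix x assume x: "x + (x \<bullet> u - x \<bullet> i) *\<^sub>R i = 0"
  have "(x + (x \<bullet> u - x \<bullet> i) *\<^sub>R i) \<bullet> i = x \<bullet> u" using i by (simp add: inner_add_left)
  then have "x \<bullet> u = 0" unfolding x by simp
  then have "x = (x \<bullet> i) *\<^sub>R i" using x by simp
  then have "x \<bullet> u = (x \<bullet> i) * (i \<bullet> u)" by (metis inner_scaleR_left)
  then have "x \<bullet> i = 0" using \<open>x \<bullet> u = 0\<close> u by (simp add: inner_commute)
  then show "x = 0" using \<open>x = (x \<bullet> i) *\<^sub>R i\<close> by simp
qed

lemma measure_shear_image:
  fixes u i :: "'a::euclidean_space"
  assumes i: "i \<in> Basis" and u: "u \<bullet> i \<noteq> 0" and A: "compact A"
  shows "measure lebesgue ((\<lambda>x. x + (x \<bullet> u - x \<bullet> i) *\<^sub>R i) ` A) = \<bar>u \<bullet> i\<bar> * measure lebesgue A"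
proof -
  let ?L = "\<lambda>x::'a. x + (x \<bullet> u - x \<bullet> i) *\<^sub>R i"
  have c: "compact (?L ` A)" using A by (intro compact_continuous_image continuous_intros)
  then have [measurable]: "?L ` A \<in> sets borel" "A \<in> sets borel" using A by (auto simp: borel_compact)
  have "emeasure lborel (?L ` A) = (\<integral>\<^sup>+x. indicator (?L ` A) x \<partial>lborel)" by simp
  also have "\<dots> = ennreal \<bar>u \<bullet> i\<bar> * (\<integral>\<^sup>+x. indicator (?L ` A) (?L x) \<partial>lborel)"
    by (rule nn_integral_lborel_shear[OF i u]) measurable
  also have "(\<integral>\<^sup>+x. indicator (?L ` A) (?L x) \<partial>lborel) = (\<integral>\<^sup>+x. indicator A x \<partial>lborel)"
    using inj_image_mem_iff[OF inj_shear[OF i u]]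
    by (intro nn_integral_cong) (auto split: split_indicator)
  finally have "emeasure lborel (?L ` A) = ennreal \<bar>u \<bullet> i\<bar> * emeasure lborel A" by simp
  then show ?thesis by (simp add: Sigma_Algebra.measure_def enn2real_mult)
qed

lemma brunn_minkowski_equality_halfspace:
  fixes A B C :: "'a::euclidean_space set"
  assumes u: "u \<noteq> 0" and dim: "DIM('a) \<ge> 2"
    and A: "compact A" "convex A" "interior A \<noteq> {}" and B: "compact B" "convex B" "interior B \<noteq> {}"
    and C: "compact C"
    and sum: "\<And>x y. x \<in> A \<Longrightarrow> y \<in> B \<Longrightarrow> x + y \<in> C"
    and p: "p > 0" and q: "q > 0" and mA: "measure lebesgue A = p ^ DIM('a)"
    and mB: "measure lebesgue B = q ^ DIM('a)"
    and mC: "measure lebesgue C \<le> (p + q) ^ DIM('a)"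
  shows "\<exists>c. \<forall>t. halfspace_vol u B (t * (q / p) + c) = (q / p) ^ DIM('a) * halfspace_vol u A t"
proof -
  obtain i where i: "i \<in> Basis" "u \<bullet> i \<noteq> 0"
    using u euclidean_all_zero_iff by blast
  let ?n = "DIM('a)"
  define L where "L = (\<lambda>x::'a. x + (x \<bullet> u - x \<bullet> i) *\<^sub>R i)"
  have lin: "linear L" unfolding L_def by (rule linear_shear)
  have inj: "inj L" unfolding L_def by (rule inj_shear[OF i])
  have cL: "compact (L ` X)" if "compact X" for X
    using that lin by (intro compact_continuous_image linear_continuous_on) (simp_all add: linear_conv_bounded_linear)
  have mL: "measure lebesgue (L ` X) = \<bar>u \<bullet> i\<bar> * measure lebesgue X" if "compact X" for X
    using measure_shear_image[OF i that] by (simp add: L_def)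
  have hL: "halfspace_vol i (L ` X) t = \<bar>u \<bullet> i\<bar> * halfspace_vol u X t" if "compact X" for X t
  proof -
    have "L ` X \<inter> {x. x \<bullet> i \<le> t} = L ` (X \<inter> {x. x \<bullet> u \<le> t})"
      using i by (auto simp: L_def inner_add_left)
    then show ?thesis
      using mL[OF measure_affine_hyperplane_cut(2)[OF u that, of t]] by (simp add: halfspace_vol_def)
  qed
  \<comment> \<open>The shear multiplies all volumes by the n-th power of \<kappa>, so the roots
    \<open>p\<close>, \<open>q\<close> become \<kappa> p, \<kappa> q and their ratio is
    unchanged.\<close>
  define \<kappa> where "\<kappa> = root ?n \<bar>u \<bullet> i\<bar>"
  have \<kappa>: "\<kappa> > 0" "\<kappa> ^ ?n = \<bar>u \<bullet> i\<bar>" using i by (simp_all add: \<kappa>_def)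
  have "\<exists>c. \<forall>t. halfspace_vol i (L ` B) (t * ((\<kappa> * q) / (\<kappa> * p)) + c)
      = ((\<kappa> * q) / (\<kappa> * p)) ^ ?n * halfspace_vol i (L ` A) t"
  proof (rule brunn_minkowski_equality_axis[OF i(1) dim, where C = "L ` C"])
    show "interior (L ` A) \<noteq> {}" "interior (L ` B) \<noteq> {}"
      using A B interior_injective_linear_image[OF lin inj] by auto
    show "x + y \<in> L ` C" if "x \<in> L ` A" "y \<in> L ` B" for x y
      using that sum linear_add[OF lin, symmetric] by auto
    have "(\<kappa> * p + \<kappa> * q) ^ ?n = \<bar>u \<bullet> i\<bar> * (p + q) ^ ?n"
      by (simp add: \<kappa>(2)[symmetric] power_mult_distrib[symmetric] algebra_simps)
    then show "measure lebesgue (L ` C) \<le> (\<kappa> * p + \<kappa> * q) ^ ?n"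
      using mC by (simp add: mL[OF C] mult_left_mono)
  qed (use A B C p q \<kappa> mA mB in \<open>auto intro!: cL convex_linear_image[OF lin] simp: mL power_mult_distrib\<close>)
  then show ?thesis using \<kappa> i by (simp add: hL[OF A(1)] hL[OF B(1)])
qed

section \<open>Recovering a convex body from its halfspace volumes\<close>

lemma measure_scaleR_image:
  fixes A :: "'a::euclidean_space set"
  assumes "compact A"
  shows "measure lebesgue ((\<lambda>x. r *\<^sub>R x + v) ` A) = \<bar>r\<bar> ^ DIM('a) * measure lebesgue A"
  using emeasure_lebesgue_affine[of r v A] assms
  by (simp add: Sigma_Algebra.measure_def enn2real_mult)

text \<open>A point of \<open>A\<close> outside \<open>B\<close> is separated from \<open>B\<close>
  by a hyperplane. The halfspace on the side of \<open>B\<close> holds the full volume of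
  \<open>B\<close>, hence that of \<open>A\<close>; but \<open>A\<close> has positive volume near
  each of its points, also beyond the hyperplane.\<close>

lemma convex_body_subset_of_halfspace_vol_eq:
  fixes A B :: "'a::euclidean_space set"
  assumes A: "compact A" "convex A" "interior A \<noteq> {}" and B: "compact B" "convex B"
    and m: "measure lebesgue A = measure lebesgue B"
    and h: "\<And>u t. u \<noteq> 0 \<Longrightarrow> halfspace_vol u A t = halfspace_vol u B t"
  shows "A \<subseteq> B"
proof (rule ccontr)
  assume "\<not> A \<subseteq> B"
  then obtain x where x: "x \<in> A" "x \<notin> B" by auto
  obtain a b where ab: "a \<bullet> x < b" "\<And>y. y \<in> B \<Longrightarrow> a \<bullet> y > b"
    using separating_hyperplane_closed_point[OF B(2) compact_imp_closed[OF B(1)] x(2)] by auto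
  have B0: "B \<noteq> {}"
  proof
    assume "B = {}"
    then have "negligible A" using m A by (simp add: negligible_iff_measure0 lmeasurable_compact)
    then show False using A(3) open_not_negligible[of "interior A"] interior_subset negligible_subset by blast
  qed
  then obtain y where "y \<in> B" by auto
  from ab(2)[OF this] ab(1) have a0: "a \<noteq> 0" by auto
  have "B \<inter> {x. x \<bullet> (-a) \<le> -b} = B" using ab(2) by (auto simp: inner_commute less_imp_le)
  then have "measure lebesgue (A \<inter> {x. x \<bullet> (-a) \<le> -b}) = measure lebesgue A"
    using h[of "-a" "-b"] a0 m by (simp add: halfspace_vol_def)
  then have "measure lebesgue (A \<inter> {x. x \<bullet> (-a) \<ge> -b}) = 0"
    using measure_affine_hyperplane_cut(1)[of "-a" A "-b"] a0 A by simp
  then have "negligible (A \<inter> {x. x \<bullet> (-a) \<ge> -b})"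
    using measure_affine_hyperplane_cut(3)[of "-a" A "-b"] a0 A
    by (simp add: negligible_iff_measure0 lmeasurable_compact)
  moreover have "interior A \<inter> {x. x \<bullet> (-a) > -b} \<subseteq> A \<inter> {x. x \<bullet> (-a) \<ge> -b}"
    using interior_subset by auto
  ultimately have neg: "negligible (interior A \<inter> {x. x \<bullet> (-a) > -b})" by (rule negligible_subset)
  have op: "open {x. x \<bullet> (-a) > -b}" by (intro open_Collect_less continuous_intros)
  have "x \<in> closure (interior A)"
    using x convex_closure_interior[OF A(2,3)] closure_subset by auto
  moreover have "x \<in> {x. x \<bullet> (-a) > -b}" using ab by (simp add: inner_commute)
  ultimately have "interior A \<inter> {x. x \<bullet> (-a) > -b} \<noteq> {}"
    using op closure_iff_nhds_not_empty by (metis Int_commute open_Int_closure_eq_empty disjoint_iff)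
  then show False using neg open_not_negligible op open_Int open_interior by blast
qed

lemma halfspace_vol_affine_image:
  fixes B :: "'a::euclidean_space set"
  assumes "compact B" "u \<noteq> 0" "r > 0"
  shows "halfspace_vol u ((\<lambda>x. r *\<^sub>R x + v) ` B) t = r ^ DIM('a) * halfspace_vol u B ((t - v \<bullet> u) / r)"
proof -
  have "(\<lambda>x. r *\<^sub>R x + v) ` B \<inter> {x. x \<bullet> u \<le> t} = (\<lambda>x. r *\<^sub>R x + v) ` (B \<inter> {x. x \<bullet> u \<le> (t - v \<bullet> u) / r})"
    using assms(3) by (auto simp: inner_add_left field_simps)
  then show ?thesis
    using measure_scaleR_image[OF measure_affine_hyperplane_cut(2)[OF assms(2,1)], of r v] assms
    by (simp add: halfspace_vol_def)
qed

text \<open>The shift in direction \<open>u\<close> equals the difference of the first moments in that direction, hence is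
  linear in \<open>u\<close>.\<close>

lemma translates_of_halfspace_vol_shift:
  fixes A B :: "'a::euclidean_space set"
  assumes A: "compact A" "convex A" "interior A \<noteq> {}" and B: "compact B" "convex B" "interior B \<noteq> {}"
    and m: "measure lebesgue A = measure lebesgue B"
    and h: "\<And>u. u \<noteq> 0 \<Longrightarrow> \<exists>d. \<forall>t. halfspace_vol u A t = halfspace_vol u B (t + d)"
  shows "\<exists>w. A = (\<lambda>x. x + w) ` B"
proof -
  define v where "v = measure lebesgue A"
  have v: "v > 0"
  proof -
    have "\<not> negligible A"
      using A(3) open_not_negligible[of "interior A"] interior_subset negligible_subset by blast
    then show ?thesis using A by (simp add: v_def negligible_iff_measure0 lmeasurable_compact zero_less_measure_iff)
  qed
  \<comment> \<open>The first moment; divided by the volume \<open>v\<close> it is the centroid, so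
    \<open>w\<close> below is the difference of the centroids.\<close>
  define g where "g X = (\<integral>x. indicator X x *\<^sub>R x \<partial>lborel)" for X :: "'a set"
  define w where "w = (1 / v) *\<^sub>R (g A - g B)"
  have int: "integrable lborel (\<lambda>x. indicator X x *\<^sub>R x)" if "compact X" for X :: "'a set"
    using that by (intro borel_integrable_compact continuous_intros)
  have gu: "(\<integral>x. indicator X x *\<^sub>R (x \<bullet> u + d) \<partial>lborel) = g X \<bullet> u + d * measure lebesgue X" if "compact X" for X u d
  proof -
    have [measurable]: "X \<in> sets borel" using that by (simp add: borel_compact)
    have i1: "integrable lborel (\<lambda>x. (indicator X x *\<^sub>R x) \<bullet> u)"
      using int[OF that] by (rule integrable_inner_left)
    have i2: "integrable lborel (\<lambda>x. indicator X x *\<^sub>R d)"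
      using that by (intro borel_integrable_compact continuous_intros)
    have "(\<integral>x. indicator X x *\<^sub>R (x \<bullet> u + d) \<partial>lborel) = (\<integral>x. (indicator X x *\<^sub>R x) \<bullet> u + indicator X x *\<^sub>R d \<partial>lborel)"
      by (intro Bochner_Integration.integral_cong) (auto simp: algebra_simps)
    also have "\<dots> = (\<integral>x. (indicator X x *\<^sub>R x) \<bullet> u \<partial>lborel) + (\<integral>x. indicator X x *\<^sub>R d \<partial>lborel)"
      by (rule Bochner_Integration.integral_add[OF i1 i2])
    also have "(\<integral>x. (indicator X x *\<^sub>R x) \<bullet> u \<partial>lborel) = g X \<bullet> u"
      unfolding g_def by (rule integral_inner_left) (rule int[OF that])
    also have "(\<integral>x. indicator X x *\<^sub>R d \<partial>lborel) = d * measure lebesgue X"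
      using that by simp
    finally show ?thesis .
  qed
  have shift: "halfspace_vol u A t = halfspace_vol u B (t - w \<bullet> u)" if u: "u \<noteq> 0" for u t
  proof -
    obtain d where d: "\<And>t. halfspace_vol u A t = halfspace_vol u B (t + d)" using h[OF u] by auto
    \<comment> \<open>The marginal of \<open>X\<close> in direction \<open>u\<close>, shifted by
      \<open>d\<close>. Its tails are expressed by \<open>halfspace_vol\<close>, so cumulative
      volumes that agree up to a shift give equal measures, whose means can be compared.\<close>
    define M where "M X d = distr (density lborel (indicator X :: 'a \<Rightarrow> ennreal)) borel (\<lambda>x. x \<bullet> u + d)" for X d
    have tail: "emeasure (M X c) {s<..} = ennreal (measure lebesgue X - halfspace_vol u X (s - c))"
      if X: "compact X" for X s c
    proof -
      have [measurable]: "X \<in> sets borel" using X by (simp add: borel_compact)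
      note cut = measure_affine_hyperplane_cut[OF u X, of "s - c"]
      have pre: "(\<lambda>x::'a. x \<bullet> u + c) -` {s<..} = {x. x \<bullet> u > s - c}" by auto
      have [measurable]: "{x. x \<bullet> u > s - c} \<in> sets borel" by measurable
      have "emeasure (M X c) {s<..} = emeasure (density lborel (indicator X)) {x. x \<bullet> u > s - c}"
        unfolding M_def by (subst emeasure_distr) (auto simp: pre)
      also have "\<dots> = emeasure lborel (X \<inter> {x. x \<bullet> u > s - c})"
        by (subst emeasure_density) (auto simp: indicator_inter_arith[symmetric])
      also have "X \<inter> {x. x \<bullet> u > s - c} = X - X \<inter> {x. x \<bullet> u \<le> s - c}" by auto
      also have "emeasure lborel (X - X \<inter> {x. x \<bullet> u \<le> s - c}) = ennreal (measure lborel (X - X \<inter> {x. x \<bullet> u \<le> s - c}))"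
        using X cut(2) emeasure_compact_finite[OF X]
        by (intro emeasure_eq_ennreal_measure) (metis Diff_subset \<open>X \<in> sets borel\<close> emeasure_mono less_top order.strict_trans1 sets_lborel top.extremum_strict)
      also have "measure lborel (X - X \<inter> {x. x \<bullet> u \<le> s - c}) = measure lborel X - measure lborel (X \<inter> {x. x \<bullet> u \<le> s - c})"
        using X cut(2) emeasure_compact_finite[OF X] by (intro measure_Diff) (auto simp: borel_compact less_top)
      also have "\<dots> = measure lebesgue X - halfspace_vol u X (s - c)"
        using X cut(2) by (simp add: halfspace_vol_def borel_compact)
      finally show ?thesis .
    qed
    have "M A 0 = M B (-d)"
    proof (rule measure_eqI_lessThan)
      show "emeasure (M A 0) {s<..} < \<infinity>" for s by (simp add: tail[OF A(1)])
      show "emeasure (M A 0) {s<..} = emeasure (M B (-d)) {s<..}" for s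
        by (simp add: tail[OF A(1)] tail[OF B(1)] m d)
    qed (auto simp: M_def)
    then have "(\<integral>s. s \<partial>M A 0) = (\<integral>s. s \<partial>M B (-d))" by simp
    moreover have "(\<integral>s. s \<partial>M X c) = g X \<bullet> u + c * measure lebesgue X" if X: "compact X" for X c
    proof -
      have [measurable]: "X \<in> sets borel" using X by (simp add: borel_compact)
      have "(\<integral>s. s \<partial>M X c) = (\<integral>x. x \<bullet> u + c \<partial>density lborel (indicator X))"
        unfolding M_def by (rule integral_distr) auto
      also have "density lborel (indicator X :: 'a \<Rightarrow> ennreal) = density lborel (\<lambda>x. ennreal (indicator X x))"
        by (simp add: ennreal_indicator)
      also have "(\<integral>x. x \<bullet> u + c \<partial>density lborel (\<lambda>x. ennreal (indicator X x)))
         = (\<integral>x. indicator X x *\<^sub>R (x \<bullet> u + c) \<partial>lborel)"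
        by (rule integral_density) auto
      finally show ?thesis using gu[OF X] by simp
    qed
    ultimately have "g A \<bullet> u = g B \<bullet> u - d * v" using A B m by (simp add: v_def)
    then have "d = - (w \<bullet> u)" using v by (simp add: w_def inner_diff_left field_simps)
    then show ?thesis using d by simp
  qed
  define B' where "B' = (\<lambda>x. 1 *\<^sub>R x + w) ` B"
  have B': "compact B'" "convex B'" "interior B' \<noteq> {}"
  proof -
    have eq: "B' = (+) w ` B" by (auto simp: B'_def add.commute)
    show "compact B'" "convex B'" "interior B' \<noteq> {}"
      using B by (auto simp: eq convex_translation_eq interior_translation intro!: compact_translation)
  qed
  have mB': "measure lebesgue B' = measure lebesgue B"
    unfolding B'_def by (subst measure_scaleR_image[OF B(1)]) simp
  have hh: "halfspace_vol u A t = halfspace_vol u B' t" if "u \<noteq> 0" for u t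
    using halfspace_vol_affine_image[OF B(1) that, of 1 w t] shift[OF that, of t] by (simp add: B'_def)
  have "A = B'"
    using convex_body_subset_of_halfspace_vol_eq[OF A B'(1,2)] convex_body_subset_of_halfspace_vol_eq[OF B' A(1,2)]
      m mB' hh by auto
  then show ?thesis by (auto simp: B'_def)
qed

theorem brunn_minkowski_equality:
  fixes A B C :: "'a::euclidean_space set"
  assumes dim: "DIM('a) \<ge> 2"
    and A: "compact A" "convex A" "interior A \<noteq> {}" and B: "compact B" "convex B" "interior B \<noteq> {}"
    and C: "compact C"
    and sum: "\<And>x y. x \<in> A \<Longrightarrow> y \<in> B \<Longrightarrow> x + y \<in> C"
    and p: "p > 0" and q: "q > 0" and mA: "measure lebesgue A = p ^ DIM('a)"
    and mB: "measure lebesgue B = q ^ DIM('a)"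
    and mC: "measure lebesgue C \<le> (p + q) ^ DIM('a)"
  shows "\<exists>w. A = (\<lambda>x. (p / q) *\<^sub>R x + w) ` B"
proof -
  \<comment> \<open>Rescaled to the volume of \<open>A\<close>, so that only a translation remains
    to be found.\<close>
  define B' where "B' = (\<lambda>x. (p / q) *\<^sub>R x + 0) ` B"
  have r: "p / q > 0" using p q by simp
  have eq: "B' = (*\<^sub>R) (p / q) ` B" by (simp add: B'_def)
  have B': "compact B'" "convex B'" "interior B' \<noteq> {}"
    using B p q interior_injective_linear_image[of "(*\<^sub>R) (p / q) :: 'a \<Rightarrow> 'a" B]
    by (auto simp: eq compact_scaling convex_scaling linear_scaleR injective_scaleR)
  have mB': "measure lebesgue A = measure lebesgue B'"
    unfolding B'_def measure_scaleR_image[OF B(1)] using p q mA mB by (simp add: power_divide)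
  have "\<exists>w. A = (\<lambda>x. x + w) ` B'"
  proof (rule translates_of_halfspace_vol_shift[OF A B' mB'])
    fix u :: 'a assume u: "u \<noteq> 0"
    obtain c where c: "\<And>t. halfspace_vol u B (t * (q / p) + c) = (q / p) ^ DIM('a) * halfspace_vol u A t"
      using brunn_minkowski_equality_halfspace[OF u dim A B C sum p q mA mB mC] by auto
    have "halfspace_vol u A t = halfspace_vol u B' (t + c * (p / q))" for t
    proof -
      have "halfspace_vol u B' (t + c * (p / q)) = (p / q) ^ DIM('a) * halfspace_vol u B (t * (q / p) + c)"
      proof -
        have "(t + c * (p / q) - 0 \<bullet> u) / (p / q) = t * (q / p) + c" using p q by (simp add: field_simps)
        then show ?thesis unfolding B'_def halfspace_vol_affine_image[OF B(1) u r] by simp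
      qed
      also have "\<dots> = halfspace_vol u A t" unfolding c using p q by (simp add: power_divide)
      finally show ?thesis by simp
    qed
    then show "\<exists>d. \<forall>t. halfspace_vol u A t = halfspace_vol u B' (t + d)" by blast
  qed
  then show ?thesis by (auto simp: eq image_image)
qed

section \<open>The numerical inequality\<close>

text \<open>The lower bound for the volume of a sum of boundaries when the bodies have volumes
  \<open>x ^ n\<close> and \<open>y ^ n\<close>: the Brunn-Minkowski bound for the whole sum, less
  the bound for the points missed.\<close>

definition power_gap :: "nat \<Rightarrow> real \<Rightarrow> real \<Rightarrow> real" where
  "power_gap n x y = (x + y) ^ n - \<bar>x - y\<bar> ^ n"

lemma power_gap_commute: "power_gap n x y = power_gap n y x"
  by (simp add: power_gap_def add.commute abs_minus_commute)

lemma power_gap_pos: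
  assumes "0 < x" "0 < y" "n > 0"
  shows "0 < power_gap n x y"
  using assms power_strict_mono[of "\<bar>x - y\<bar>" "x + y" n] by (simp add: power_gap_def abs_if)

lemma power_gap_scale: "0 \<le> c \<Longrightarrow> power_gap n (c * x) (c * y) = c ^ n * power_gap n x y"
proof -
  assume "0 \<le> c"
  then have "\<bar>c * x - c * y\<bar> = c * \<bar>x - y\<bar>" by (metis abs_mult abs_of_nonneg right_diff_distrib)
  then show ?thesis by (simp add: power_gap_def power_mult_distrib distrib_left[symmetric] right_diff_distrib del: distrib_left)
qed

lemma power_gap_odd_sum:
  assumes "y \<le> x"
  shows "power_gap n x y = (\<Sum>j | j \<le> n \<and> odd j. 2 * real (n choose j) * x ^ (n - j) * y ^ j)"
proof -
  have "power_gap n x y = (y + x) ^ n - (- y + x) ^ n"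
    using assms by (simp add: power_gap_def add.commute)
  also have "\<dots> = (\<Sum>j\<le>n. real (n choose j) * y ^ j * x ^ (n - j) - real (n choose j) * (- y) ^ j * x ^ (n - j))"
    unfolding binomial_ring sum_subtractf ..
  also have "\<dots> = (\<Sum>j | j \<le> n \<and> odd j. real (n choose j) * y ^ j * x ^ (n - j) - real (n choose j) * (- y) ^ j * x ^ (n - j))"
    by (rule sum.mono_neutral_right) auto
  also have "\<dots> = (\<Sum>j | j \<le> n \<and> odd j. 2 * real (n choose j) * x ^ (n - j) * y ^ j)"
    by (rule sum.cong) auto
  finally show ?thesis .
qed

lemma Cauchy_Schwarz_equality_sum:
  fixes a b :: "'i \<Rightarrow> real"
  assumes I: "finite I" and b: "0 < (\<Sum>i\<in>I. (b i)\<^sup>2)"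
    and le: "(\<Sum>i\<in>I. (a i)\<^sup>2) * (\<Sum>i\<in>I. (b i)\<^sup>2) \<le> (\<Sum>i\<in>I. a i * b i)\<^sup>2"
  obtains c where "\<And>i. i \<in> I \<Longrightarrow> a i = c * b i"
proof -
  let ?A = "\<Sum>i\<in>I. (a i)\<^sup>2" and ?B = "\<Sum>i\<in>I. (b i)\<^sup>2" and ?C = "\<Sum>i\<in>I. a i * b i"
  define c where "c = ?C / ?B"
  have "(\<Sum>i\<in>I. (a i - c * b i)\<^sup>2) = (\<Sum>i\<in>I. (a i)\<^sup>2 - 2 * c * (a i * b i) + c\<^sup>2 * (b i)\<^sup>2)"
    by (rule sum.cong) (auto simp: power2_eq_square algebra_simps)
  also have "\<dots> = ?A - 2 * c * ?C + c\<^sup>2 * ?B"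
    by (simp add: sum.distrib sum_subtractf sum_distrib_left)
  also have "\<dots> = (?A * ?B - ?C\<^sup>2) / ?B"
    using b by (simp add: c_def field_simps power2_eq_square)
  also have "\<dots> \<le> 0" using b le by (simp add: divide_le_0_iff)
  finally have "(\<Sum>i\<in>I. (a i - c * b i)\<^sup>2) = 0"
    by (intro antisym sum_nonneg) auto
  then have "\<forall>i\<in>I. (a i - c * b i)\<^sup>2 = 0"
    using I by (subst (asm) sum_nonneg_eq_0_iff) auto
  then show ?thesis using that[of c] by auto
qed

text \<open>Monomials at (u u', v v') are geometric means of those at the two pairs of squares,
  whence Cauchy-Schwarz with the binomial coefficients as weights. For \<open>n \<ge> 3\<close> the
  degrees 1 and 3 both occur, and proportionality in these two makes u : v equal to u' : v'.\<close>

lemma power_gap_log_convex: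
  fixes u v u' v' :: real
  assumes uv: "v \<le> u" "0 < v" and uv': "v' \<le> u'" "0 < v'"
  shows "(power_gap n (u * u') (v * v'))\<^sup>2 \<le> power_gap n (u\<^sup>2) (v\<^sup>2) * power_gap n (u'\<^sup>2) (v'\<^sup>2)"
    and "n \<ge> 3 \<Longrightarrow> power_gap n (u\<^sup>2) (v\<^sup>2) * power_gap n (u'\<^sup>2) (v'\<^sup>2) \<le> (power_gap n (u * u') (v * v'))\<^sup>2
       \<Longrightarrow> u * v' = v * u'"
proof -
  define I where "I = {j. j \<le> n \<and> odd j}"
  define w where "w j = sqrt (2 * real (n choose j))" for j
  define a where "a j = w j * u ^ (n - j) * v ^ j" for j
  define b where "b j = w j * u' ^ (n - j) * v' ^ j" for j
  have I: "finite I" by (simp add: I_def)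
  have w: "(w j)\<^sup>2 = 2 * real (n choose j)" for j by (simp add: w_def)
  have A: "power_gap n (u\<^sup>2) (v\<^sup>2) = (\<Sum>j\<in>I. (a j)\<^sup>2)"
    using uv by (subst power_gap_odd_sum)
      (auto simp: I_def a_def power_mult_distrib w power_mult[symmetric] mult.commute intro!: sum.cong power_mono)
  have B: "power_gap n (u'\<^sup>2) (v'\<^sup>2) = (\<Sum>j\<in>I. (b j)\<^sup>2)"
    using uv' by (subst power_gap_odd_sum)
      (auto simp: I_def b_def power_mult_distrib w power_mult[symmetric] mult.commute intro!: sum.cong power_mono)
  have C: "power_gap n (u * u') (v * v') = (\<Sum>j\<in>I. a j * b j)"
  proof -
    have "a j * b j = 2 * real (n choose j) * (u * u') ^ (n - j) * (v * v') ^ j" for j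
      unfolding a_def b_def w[symmetric] by (simp add: power_mult_distrib power2_eq_square ac_simps)
    then show ?thesis using uv uv' by (subst power_gap_odd_sum) (auto simp: I_def intro!: mult_mono)
  qed
  show "(power_gap n (u * u') (v * v'))\<^sup>2 \<le> power_gap n (u\<^sup>2) (v\<^sup>2) * power_gap n (u'\<^sup>2) (v'\<^sup>2)"
    unfolding A B C by (rule Cauchy_Schwarz_ineq_sum)
  assume n: "n \<ge> 3"
    and le: "power_gap n (u\<^sup>2) (v\<^sup>2) * power_gap n (u'\<^sup>2) (v'\<^sup>2) \<le> (power_gap n (u * u') (v * v'))\<^sup>2"
  have "0 < power_gap n (u'\<^sup>2) (v'\<^sup>2)" using uv' n by (intro power_gap_pos) auto
  then obtain c where c: "\<And>j. j \<in> I \<Longrightarrow> a j = c * b j"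
    using Cauchy_Schwarz_equality_sum[OF I, of b a] le unfolding A B C by blast
  obtain m where m: "n = m + 3" using n by (metis add.commute le_Suc_ex)
  have w0: "w 1 > 0" "w 3 > 0" using n by (auto simp: w_def zero_less_binomial_iff)
  have pos: "u > 0" "u' > 0" "v > 0" "v' > 0" using uv uv' by auto
  have "1 \<in> I" "3 \<in> I" using n by (auto simp: I_def)
  note c[OF this(1)] c[OF this(2)]
  then have "u ^ (m + 2) * v = c * (u' ^ (m + 2) * v')" "u ^ m * v ^ 3 = c * (u' ^ m * v' ^ 3)"
    using w0 by (auto simp: a_def b_def m)
  then have "(u ^ (m + 2) * v) * (c * (u' ^ m * v' ^ 3)) = (u ^ m * v ^ 3) * (c * (u' ^ (m + 2) * v'))"
    by simp
  moreover have "c \<noteq> 0" using \<open>u ^ m * v ^ 3 = c * (u' ^ m * v' ^ 3)\<close> pos by auto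
  ultimately have "(u * v')\<^sup>2 * (c * u ^ m * u' ^ m * v * v') = (v * u')\<^sup>2 * (c * u ^ m * u' ^ m * v * v')"
    by (simp add: power_add power2_eq_square power3_eq_cube ac_simps)
  then have "(u * v')\<^sup>2 = (v * u')\<^sup>2" using \<open>c \<noteq> 0\<close> pos by simp
  then show "u * v' = v * u'" using pos by (simp add: power2_eq_iff_nonneg)
qed

text \<open>For a fixed product the gap grows as the arguments move apart. In terms of sum and
  difference, p^2 - q^2 = 4 x y is the same for both pairs, and differences of powers obey a
  recursion of step 2 driven by this constant.\<close>

lemma power_gap_mono_spread:
  fixes x y X Y :: real
  assumes xy: "y \<le> x" "0 < y" and XY: "Y \<le> X" "0 < Y" and prod: "x * y = X * Y" and le: "x \<le> X"
    and n: "n \<ge> 2"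
  shows "power_gap n x y \<le> power_gap n X Y"
proof -
  have Yy: "Y \<le> y"
  proof (rule ccontr)
    assume "\<not> Y \<le> y"
    then have "x * y < X * Y" using le xy by (intro mult_le_less_imp_less) auto
    then show False using prod by simp
  qed
  have "Y * (X - x) = x * (y - Y)" using prod by (simp add: algebra_simps)
  moreover have "Y * (y - Y) \<le> x * (y - Y)" using Yy xy by (intro mult_right_mono) auto
  ultimately have "Y * (y - Y) \<le> Y * (X - x)" by simp
  then have d: "y - Y \<le> X - x" using XY by simp
  define p q P Q where "p = x + y" and "q = x - y" and "P = X + Y" and "Q = X - Y"
  have ord: "0 \<le> q" "q \<le> Q" "0 \<le> p" "p \<le> P" using d Yy xy le by (auto simp: p_def q_def P_def Q_def)
  define c where "c = 4 * (x * y)"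
  have c: "c = p\<^sup>2 - q\<^sup>2" "c = P\<^sup>2 - Q\<^sup>2" "c \<ge> 0"
  proof -
    show "c = p\<^sup>2 - q\<^sup>2" by (simp add: c_def p_def q_def power2_eq_square algebra_simps)
    show "c = P\<^sup>2 - Q\<^sup>2" by (simp add: c_def prod P_def Q_def power2_eq_square algebra_simps)
    show "c \<ge> 0" using xy by (simp add: c_def)
  qed
  have rec: "s ^ (k + 2) - r ^ (k + 2) = (s\<^sup>2 - r\<^sup>2) * s ^ k + r\<^sup>2 * (s ^ k - r ^ k)" for r s :: real and k
    by (simp add: power_add power2_eq_square algebra_simps)
  have qp: "q \<le> p" using xy by (simp add: p_def q_def)
  have step: "p ^ (k + 2) - q ^ (k + 2) \<le> P ^ (k + 2) - Q ^ (k + 2)"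
    if "p ^ k - q ^ k \<le> P ^ k - Q ^ k" for k
  proof -
    have "0 \<le> p ^ k - q ^ k" using qp ord by (simp add: power_mono)
    then have "q\<^sup>2 * (p ^ k - q ^ k) \<le> Q\<^sup>2 * (P ^ k - Q ^ k)"
      using that ord by (intro mult_mono power_mono) auto
    moreover have "c * p ^ k \<le> c * P ^ k" using c ord by (intro mult_left_mono power_mono) auto
    ultimately show ?thesis unfolding rec c(1,2)[symmetric] by linarith
  qed
  \<comment> \<open>The recursion of step 2 needs an odd start, and exponent 1 will not do: there
    the gap is \<open>2 * y\<close>, which decreases as the arguments move apart.\<close>
  have three: "p ^ 3 - q ^ 3 \<le> P ^ 3 - Q ^ 3"
  proof -
    have e: "(s + r) ^ 3 - (s - r) ^ 3 = 6 * (s * r) * s + 2 * r ^ 3" for s r :: real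
      by (simp add: power3_eq_cube algebra_simps)
    have "y ^ 3 - Y ^ 3 = (y - Y) * (y * y + y * Y + Y * Y)" by (simp add: power3_eq_cube algebra_simps)
    also have "\<dots> \<le> (y - Y) * (y * y + y * y + y * y)" using Yy XY xy
      by (intro mult_left_mono add_mono mult_mono) auto
    also have "\<dots> = (y - Y) * (3 * (y * y))" by simp
    also have "\<dots> \<le> (X - x) * (3 * (x * y))" using d Yy xy le
      by (intro mult_mono) auto
    finally have "2 * (y ^ 3 - Y ^ 3) \<le> 6 * (x * y) * (X - x)" by (simp add: algebra_simps)
    then have "6 * (x * y) * x + 2 * y ^ 3 \<le> 6 * (X * Y) * X + 2 * Y ^ 3"
      unfolding prod[symmetric] by (simp add: algebra_simps)
    then show ?thesis unfolding p_def q_def P_def Q_def e .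
  qed
  have "p ^ (k + 2) - q ^ (k + 2) \<le> P ^ (k + 2) - Q ^ (k + 2)
      \<and> p ^ (k + 3) - q ^ (k + 3) \<le> P ^ (k + 3) - Q ^ (k + 3)" for k
  proof (induction k)
    case 0 then show ?case using c three by (simp add: power2_eq_square)
  next
    case (Suc k)
    then show ?case using step[of "k + 2"] by (simp add: eval_nat_numeral)
  qed
  moreover have "n - 2 + 2 = n" using n by simp
  ultimately have "p ^ n - q ^ n \<le> P ^ n - Q ^ n" by metis
  then show ?thesis using xy XY by (simp add: power_gap_def p_def q_def P_def Q_def)
qed

text \<open>All four variables are square roots of the data, as log-convexity is phrased with
  squares. If q k \<le> p t, both factors have their larger argument in the same place and
  log-convexity gives the gap at (p^2 k t, q^2 k t). Otherwise the arguments of the second factor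
  are exchanged, the mean becomes (p q k^2, p q t^2), and this pair is more spread with the same
  product.\<close>

lemma power_gap_product_aux:
  fixes p q k t :: real
  assumes pq: "0 < q" "q \<le> p" and kt: "0 < t" "t \<le> k" and n: "n \<ge> 2"
  shows "(k * t) ^ (2 * n) * (power_gap n (p\<^sup>2) (q\<^sup>2))\<^sup>2
      \<le> power_gap n (p\<^sup>2 * k\<^sup>2) (q\<^sup>2 * t\<^sup>2) * power_gap n (p\<^sup>2 * t\<^sup>2) (q\<^sup>2 * k\<^sup>2)" (is "?L \<le> ?R")
    and "n \<ge> 3 \<Longrightarrow> q < p \<Longrightarrow>
      power_gap n (p\<^sup>2 * k\<^sup>2) (q\<^sup>2 * t\<^sup>2) * power_gap n (p\<^sup>2 * t\<^sup>2) (q\<^sup>2 * k\<^sup>2)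
      \<le> (k * t) ^ (2 * n) * (power_gap n (p\<^sup>2) (q\<^sup>2))\<^sup>2 \<Longrightarrow> k = t"
proof -
  have pos: "0 < p" "0 < k" "0 < k * t" using pq kt by auto
  have L: "?L = (power_gap n (p\<^sup>2 * (k * t)) (q\<^sup>2 * (k * t)))\<^sup>2"
    using power_gap_scale[of "k * t" n "p\<^sup>2" "q\<^sup>2"] pos
    by (simp add: mult.commute power_mult_distrib power_mult[symmetric])
  have qtpk: "q * t \<le> p * k" using pq kt by (intro mult_mono) auto
  have cmp: "q * t < p * k" if "q < p" using pq kt that by (intro mult_less_le_imp_less) auto
  consider (1) "q * k \<le> p * t" | (2) "p * t < q * k" by linarith
  then have "?L \<le> ?R \<and> (n \<ge> 3 \<longrightarrow> q < p \<longrightarrow> ?R \<le> ?L \<longrightarrow> k = t)"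
  proof cases
    case 1
    note cs = power_gap_log_convex[OF qtpk _ 1, of n]
    have eq: "p * k * (p * t) = p\<^sup>2 * (k * t)" "q * t * (q * k) = q\<^sup>2 * (k * t)"
      by (simp_all add: power2_eq_square ac_simps)
    have "k = t" if "p * k * (q * k) = q * t * (p * t)"
    proof -
      have "(p * q) * k\<^sup>2 = (p * q) * t\<^sup>2" using that by (simp add: power2_eq_square ac_simps)
      then have "k\<^sup>2 = t\<^sup>2" using pos pq by simp
      then show ?thesis using pos kt by (simp add: power2_eq_iff_nonneg)
    qed
    then show ?thesis unfolding L using cs pq kt pos by (auto simp: eq power_mult_distrib)
  next
    case 2
    have r: "power_gap n (p\<^sup>2 * t\<^sup>2) (q\<^sup>2 * k\<^sup>2) = power_gap n ((q * k)\<^sup>2) ((p * t)\<^sup>2)"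
      by (subst power_gap_commute) (simp add: power_mult_distrib)
    have eq: "p * k * (q * k) = p * q * k\<^sup>2" "q * t * (p * t) = p * q * t\<^sup>2"
      by (simp_all add: power2_eq_square ac_simps)
    note cs = power_gap_log_convex[OF qtpk _ less_imp_le[OF 2], of n, unfolded eq]
    have "power_gap n (p\<^sup>2 * (k * t)) (q\<^sup>2 * (k * t)) \<le> power_gap n (p * q * k\<^sup>2) (p * q * t\<^sup>2)"
    proof (rule power_gap_mono_spread)
      show "p\<^sup>2 * (k * t) * (q\<^sup>2 * (k * t)) = p * q * k\<^sup>2 * (p * q * t\<^sup>2)"
        by (simp add: power2_eq_square ac_simps)
      have "p * k * (p * t) \<le> p * k * (q * k)" using 2 pos by (intro mult_left_mono) auto
      then show "p\<^sup>2 * (k * t) \<le> p * q * k\<^sup>2" by (simp add: power2_eq_square ac_simps)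
    qed (use pq kt pos n in \<open>auto intro!: mult_mono power_mono\<close>)
    moreover have "0 \<le> power_gap n (p\<^sup>2 * (k * t)) (q\<^sup>2 * (k * t))"
      using pq pos n by (intro less_imp_le power_gap_pos) auto
    ultimately have le: "?L \<le> (power_gap n (p * q * k\<^sup>2) (p * q * t\<^sup>2))\<^sup>2"
      unfolding L by (intro power_mono)
    have lt: "(power_gap n (p * q * k\<^sup>2) (p * q * t\<^sup>2))\<^sup>2 \<le> ?R"
      using cs(1) pq kt pos by (simp add: r power_mult_distrib)
    \<comment> \<open>Equality in log-convexity would now give \<open>p * p = q * q\<close>, so for
      \<open>q < p\<close> this case never attains equality.\<close>
    have "False" if "n \<ge> 3" "q < p" "?R \<le> ?L"
    proof -
      have "p * k * (p * t) = q * t * (q * k)"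
        using cs(2) that le pq kt pos by (simp add: r power_mult_distrib)
      then have "p * p = q * q" using pos kt by (simp add: ac_simps)
      moreover have "q * q < p * p" using that pq by (intro mult_strict_mono) auto
      ultimately show False by simp
    qed
    then show ?thesis using le lt by auto
  qed
  then show "?L \<le> ?R" "n \<ge> 3 \<Longrightarrow> q < p \<Longrightarrow> ?R \<le> ?L \<Longrightarrow> k = t" by auto
qed

lemma power_gap_product:
  fixes l k t :: real
  assumes l: "0 < l" "l < 1" and kt: "0 < k" "0 < t" and n: "n \<ge> 2"
  shows "k ^ n * t ^ n * (1 - \<bar>1 - 2 * l\<bar> ^ n)\<^sup>2
      \<le> power_gap n (l * k) ((1 - l) * t) * power_gap n (l * t) ((1 - l) * k)" 
    and "n \<ge> 3 \<Longrightarrow> l \<noteq> 1 / 2 \<Longrightarrow>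
      power_gap n (l * k) ((1 - l) * t) * power_gap n (l * t) ((1 - l) * k)
      \<le> k ^ n * t ^ n * (1 - \<bar>1 - 2 * l\<bar> ^ n)\<^sup>2 \<Longrightarrow> k = t"
proof -
  let ?L = "\<lambda>l k t :: real. k ^ n * t ^ n * (1 - \<bar>1 - 2 * l\<bar> ^ n)\<^sup>2"
  let ?R = "\<lambda>l k t. power_gap n (l * k) ((1 - l) * t) * power_gap n (l * t) ((1 - l) * k)"
  have main: "?L l k t \<le> ?R l k t \<and> (n \<ge> 3 \<longrightarrow> l \<noteq> 1 / 2 \<longrightarrow> ?R l k t \<le> ?L l k t \<longrightarrow> k = t)"
    if l: "1 / 2 \<le> l" "l < 1" and kt: "0 < t" "t \<le> k" for l k t :: real
  proof -
    have s: "(sqrt l)\<^sup>2 = l" "(sqrt (1 - l))\<^sup>2 = 1 - l" "(sqrt k)\<^sup>2 = k" "(sqrt t)\<^sup>2 = t"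
      using l kt by auto
    have kt2: "(sqrt k * sqrt t) ^ (2 * n) = k ^ n * t ^ n"
      unfolding power_mult power_mult_distrib s ..
    \<comment> \<open>The origin of the constant in the theorem: the gap of \<open>l\<close> and
      \<open>1 - l\<close>, whose sum is 1.\<close>
    have g: "power_gap n l (1 - l) = 1 - \<bar>1 - 2 * l\<bar> ^ n"
      by (simp add: power_gap_def abs_minus_commute)
    note a = power_gap_product_aux[of "sqrt (1 - l)" "sqrt l" "sqrt t" "sqrt k" n, unfolded s kt2 g]
    show ?thesis using a l kt n by auto
  qed
  \<comment> \<open>Replacing \<open>l\<close> by \<open>1 - l\<close> or exchanging
    \<open>k\<close> and \<open>t\<close> only permutes factors and arguments, which reduces
    everything to \<open>1 / 2 \<le> l\<close> and \<open>t \<le> k\<close>.\<close>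
  have sym: "?L l k t = ?L (1 - l) k t" "?R l k t = ?R (1 - l) k t"
    "?L l k t = ?L l t k" "?R l k t = ?R l t k" for l k t :: real
    using power_gap_commute[of n "l * k"] power_gap_commute[of n "l * t"]
    by (simp_all add: mult.commute abs_minus_commute)
  have half: "?L l k t \<le> ?R l k t \<and> (n \<ge> 3 \<longrightarrow> l \<noteq> 1 / 2 \<longrightarrow> ?R l k t \<le> ?L l k t \<longrightarrow> k = t)"
    if l: "1 / 2 \<le> l" "l < 1" for l
  proof (cases "t \<le> k")
    case True then show ?thesis using main l kt by blast
  next
    case False
    then show ?thesis using main[OF l kt(1), of t] unfolding sym(3)[where l = l and k = k and t = t] sym(4)[where l = l and k = k and t = t] by auto
  qed
  have "?L l k t \<le> ?R l k t \<and> (n \<ge> 3 \<longrightarrow> l \<noteq> 1 / 2 \<longrightarrow> ?R l k t \<le> ?L l k t \<longrightarrow> k = t)"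
  proof (cases "1 / 2 \<le> l")
    case True then show ?thesis using half l by blast
  next
    case False
    then have "1 / 2 \<le> 1 - l" "1 - l < 1" using l by auto
    from half[OF this] show ?thesis unfolding sym(1,2)[where l = l and k = k and t = t] using False by auto
  qed
  then show "?L l k t \<le> ?R l k t" "n \<ge> 3 \<Longrightarrow> l \<noteq> 1 / 2 \<Longrightarrow> ?R l k t \<le> ?L l k t \<Longrightarrow> k = t" by auto
qed

text \<open>In the plane the product of the two gaps depends on \<open>k\<close> and
  \<open>t\<close> only through their product, so the numerical inequality is an identity and bodies
  of different size can attain equality.\<close>

lemma power_gap_2: "power_gap 2 x y = 4 * x * y"
  by (simp add: power_gap_def power2_eq_square algebra_simps)

section \<open>Sums of connected boundaries\<close>

text \<open>Takes the place of arguments with bounded and unbounded components: below, sets are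
  shown empty by being both compact and open.\<close>

lemma compact_open_empty:
  fixes S :: "'a::euclidean_space set"
  assumes "compact S" "open S"
  shows "S = {}"
  using assms clopen[of S] compact_imp_closed compact_imp_bounded not_bounded_UNIV by blast

lemma frontier_dichotomy:
  assumes "closed A" "connected (frontier B)" "frontier A \<inter> frontier B = {}"
  shows "frontier B \<subseteq> interior A \<or> frontier B \<inter> A = {}"
proof -
  have "frontier B \<inter> A = {} \<or> frontier B - A = {}"
    using connected_Int_frontier[OF assms(2), of A] assms(3) by blast
  then show ?thesis using assms by (auto simp: frontier_def)
qed

text \<open>By connectedness each boundary lies wholly inside or wholly outside the other set. If
  both are inside, the union is open; if both are outside, the intersection is; either would be
  compact, hence empty, against \<open>meet\<close>. In the mixed cases a set difference is compact
  and open, and its emptiness is the inclusion.\<close>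

lemma nested_of_disjoint_frontiers:
  fixes A B :: "'a::euclidean_space set"
  assumes A: "compact A" "connected (frontier A)" and B: "compact B" "connected (frontier B)"
    and meet: "A \<inter> B \<noteq> {}" and disj: "frontier A \<inter> frontier B = {}"
  shows "A \<subseteq> B \<or> B \<subseteq> A"
proof -
  have cl: "closed A" "closed B" using A B compact_imp_closed by auto
  have decomp: "X = interior X \<union> frontier X" "interior X \<inter> frontier X = {}" if "closed X" for X :: "'a set"
    using that interior_subset[of X] by (auto simp: frontier_def)
  note dA = decomp[OF cl(1)] and dB = decomp[OF cl(2)]
  have sub: "Y \<subseteq> X"
    if "compact X" "compact Y" "frontier Y \<subseteq> interior X" "frontier X \<inter> Y = {}" for X Y :: "'a set"
  proof -
    have c: "closed X" "closed Y" using that compact_imp_closed by auto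
    have "Y - X = interior Y - X" using that(3) decomp(1)[OF c(2)] interior_subset[of X] by blast
    moreover have "Y - X = Y - interior X" using that(4) decomp(1)[OF c(1)] by blast
    ultimately have "open (Y - X)" "compact (Y - X)"
      using c that by (metis open_Diff open_interior) (metis \<open>Y - X = Y - interior X\<close> compact_diff open_interior that(2))
    then show ?thesis using compact_open_empty by blast
  qed
  have "frontier B \<subseteq> interior A \<or> frontier B \<inter> A = {}" "frontier A \<subseteq> interior B \<or> frontier A \<inter> B = {}"
    using frontier_dichotomy cl A B disj by blast+
  then consider (1) "frontier B \<subseteq> interior A" "frontier A \<subseteq> interior B"
    | (2) "frontier B \<subseteq> interior A" "frontier A \<inter> B = {}"
    | (3) "frontier B \<inter> A = {}" "frontier A \<subseteq> interior B"
    | (4) "frontier B \<inter> A = {}" "frontier A \<inter> B = {}" by blast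
  then show ?thesis
  proof cases
    case 1
    then have "A \<union> B = interior A \<union> interior B" using dA dB by blast
    then have "open (A \<union> B)" by (metis open_Un open_interior)
    then have "A \<union> B = {}" using compact_open_empty compact_Un A B by blast
    then show ?thesis using meet by blast
  next
    case 2 then show ?thesis using sub[of A B] A B by blast
  next
    case 3 then show ?thesis using sub[of B A] A B by blast
  next
    case 4
    then have "A \<inter> B = interior A \<inter> interior B" using dA dB by blast
    then have "open (A \<inter> B)" by (metis open_Int open_interior)
    then have "A \<inter> B = {}" using compact_open_empty compact_Int A B by blast
    then show ?thesis using meet by blast
  qed
qed

text \<open>In the usual terminology the Minkowski difference of \<open>X\<close> and the reflected
  set -Y: the translations \<open>x\<close> that carry -Y into \<open>X\<close>.\<close>

definition mink_diff :: "'a::euclidean_space set \<Rightarrow> 'a set \<Rightarrow> 'a set" where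
  "mink_diff X Y = {x. \<forall>y\<in>Y. x - y \<in> X}"

lemma compact_mink_diff:
  fixes X Y :: "'a::euclidean_space set"
  assumes "compact X" "Y \<noteq> {}"
  shows "compact (mink_diff X Y)"
proof -
  obtain y where y: "y \<in> Y" using assms by auto
  have eq: "mink_diff X Y = (\<Inter>y\<in>Y. (+) y ` X)"
    by (auto simp: mink_diff_def image_iff) (metis add_diff_cancel_left' diff_add_cancel add.commute)+
  have "closed (mink_diff X Y)" unfolding eq
    using assms by (intro closed_INT) (auto intro!: compact_imp_closed compact_translation)
  moreover have "mink_diff X Y \<subseteq> (+) y ` X" unfolding eq using y by blast
  then have "bounded (mink_diff X Y)"
    using assms compact_translation compact_imp_bounded bounded_subset by blast
  ultimately show ?thesis by (simp add: compact_eq_bounded_closed)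
qed

lemma convex_mink_diff:
  assumes "convex X"
  shows "convex (mink_diff X Y)"
proof (rule convexI)
  fix x y :: 'a and u v :: real
  assume h: "x \<in> mink_diff X Y" "y \<in> mink_diff X Y" "0 \<le> u" "0 \<le> v" "u + v = 1"
  have "u *\<^sub>R x + v *\<^sub>R y - z \<in> X" if "z \<in> Y" for z
  proof -
    have "u *\<^sub>R (x - z) + v *\<^sub>R (y - z) \<in> X"
      using h that by (intro convexD[OF assms]) (auto simp: mink_diff_def)
    moreover have "u *\<^sub>R (x - z) + v *\<^sub>R (y - z) = u *\<^sub>R x + v *\<^sub>R y - (u + v) *\<^sub>R z"
      by (simp add: algebra_simps)
    ultimately show ?thesis using h(5) by simp
  qed
  then show "u *\<^sub>R x + v *\<^sub>R y \<in> mink_diff X Y" by (simp add: mink_diff_def)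
qed

lemma measure_uminus_image:
  fixes A :: "'a::euclidean_space set"
  assumes "compact A"
  shows "measure lebesgue (uminus ` A) = measure lebesgue A"
  using measure_scaleR_image[OF assms, of "-1" 0] by simp

lemma frontier_affine_image:
  fixes S :: "'a::euclidean_space set"
  assumes "r \<noteq> 0"
  shows "frontier ((\<lambda>x. r *\<^sub>R x + v) ` S) = (\<lambda>x. r *\<^sub>R x + v) ` frontier S"
    "interior ((\<lambda>x. r *\<^sub>R x + v) ` S) = (\<lambda>x. r *\<^sub>R x + v) ` interior S"
proof -
  let ?g = "\<lambda>x. r *\<^sub>R x + v"
  have img: "?g ` X = (+) v ` (*\<^sub>R) r ` X" for X :: "'a set"
    by (auto simp: image_image add.commute)
  have lin: "linear ((*\<^sub>R) r :: 'a \<Rightarrow> 'a)" "inj ((*\<^sub>R) r :: 'a \<Rightarrow> 'a)"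
    using assms by (auto simp: linear_scaleR injective_scaleR)
  show int: "interior (?g ` S) = ?g ` interior S"
    unfolding img interior_translation interior_injective_linear_image[OF lin] ..
  have "closure (?g ` S) = ?g ` closure S"
    unfolding img closure_translation closure_injective_linear_image[OF lin] ..
  moreover have "inj ?g" using assms by (intro injI) simp
  ultimately show "frontier (?g ` S) = ?g ` frontier S"
    unfolding frontier_def int by (simp add: image_set_diff)
qed

lemma sum_subset_frontier_sum:
  fixes X Y :: "'a::euclidean_space set"
  assumes X: "compact X" "connected (frontier X)" and Y: "compact Y" "connected (frontier Y)"
  shows "X + Y \<subseteq> (frontier X + frontier Y) \<union> mink_diff X Y \<union> mink_diff Y X"
proof
  fix z assume "z \<in> X + Y"
  then obtain x y where xy: "x \<in> X" "y \<in> Y" "z = x + y" by (auto elim: set_plus_elim)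
  let ?r = "\<lambda>y. z - y"
  have fr: "frontier (?r ` Y) = ?r ` frontier Y"
    using frontier_affine_image(1)[of "-1" z Y] by simp
  have c: "compact (?r ` Y)" using Y by (intro compact_continuous_image continuous_intros)
  have con: "connected (frontier (?r ` Y))" unfolding fr
    using Y by (intro connected_continuous_image continuous_intros)
  have meet: "X \<inter> ?r ` Y \<noteq> {}" using xy by (force simp: image_iff)
  show "z \<in> (frontier X + frontier Y) \<union> mink_diff X Y \<union> mink_diff Y X"
  proof (cases "frontier X \<inter> frontier (?r ` Y) = {}")
    case True
    then consider "X \<subseteq> ?r ` Y" | "?r ` Y \<subseteq> X"
      using nested_of_disjoint_frontiers[OF X c con meet] by blast
    then show ?thesis
    proof cases
      case 1
      then have "z \<in> mink_diff Y X" by (force simp: mink_diff_def)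
      then show ?thesis by simp
    next
      case 2
      then have "z \<in> mink_diff X Y" by (force simp: mink_diff_def)
      then show ?thesis by simp
    qed
  next
    case False
    then obtain w y' where w: "w \<in> frontier X" "y' \<in> frontier Y" "w = z - y'" unfolding fr by blast
    then have "z = w + y'" by simp
    then have "z \<in> frontier X + frontier Y" using set_plus_intro[OF w(1,2)] by simp
    then show ?thesis by simp
  qed
qed

lemma compact_frontier_sum:
  fixes X Y :: "'a::euclidean_space set"
  assumes "compact X" "compact Y"
  shows "compact (frontier X + frontier Y)" "compact (X + Y)"
proof -
  have "compact (S + T)" if "compact S" "compact T" for S T :: "'a set"
  proof -
    have "S + T = {x + y |x y. x \<in> S \<and> y \<in> T}" by (auto simp: set_plus_def)
    then show ?thesis using compact_sums[OF that] by simp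
  qed
  then show "compact (frontier X + frontier Y)" "compact (X + Y)"
    using assms compact_frontier by blast+
qed

text \<open>\<open>mink_diff X Y\<close> plus the reflection of \<open>Y\<close> lies in
  \<open>X\<close>, so Brunn-Minkowski bounds the root of a positive volume by \<open>a - b\<close>.
  The maximum with 0 covers \<open>a \<le> b\<close>, when the set is null.\<close>

lemma measure_mink_diff_le:
  fixes X Y :: "'a::euclidean_space set"
  assumes X: "compact X" and Y: "compact Y" and a: "0 < a" "measure lebesgue X = a ^ DIM('a)"
    and b: "0 < b" "measure lebesgue Y = b ^ DIM('a)"
  shows "measure lebesgue (mink_diff X Y) \<le> max (a - b) 0 ^ DIM('a)"
proof -
  have "Y \<noteq> {}" using b by auto
  then have c: "compact (mink_diff X Y)" by (rule compact_mink_diff[OF X])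
  define d where "d = root DIM('a) (measure lebesgue (mink_diff X Y))"
  have d: "d \<ge> 0" "measure lebesgue (mink_diff X Y) = d ^ DIM('a)" by (auto simp: d_def)
  have "d \<le> max (a - b) 0"
  proof (cases "d = 0")
    case False
    have "(d + b) ^ DIM('a) \<le> measure lebesgue X"
      by (rule brunn_minkowski[OF c compact_negations[OF Y] X])
         (use d False b measure_uminus_image[OF Y] in \<open>auto simp: mink_diff_def\<close>)
    then have "d + b \<le> a" using a d b by (auto intro: power_le_imp_le_base power_mono_iff[THEN iffD1, rotated 3])
    then show ?thesis by simp
  qed simp
  then show ?thesis unfolding d(2) using d(1) by (intro power_mono)
qed

lemma measure_sum_ge:
  fixes X Y :: "'a::euclidean_space set"
  assumes X: "compact X" and Y: "compact Y" and a: "0 < a" "measure lebesgue X = a ^ DIM('a)"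
    and b: "0 < b" "measure lebesgue Y = b ^ DIM('a)"
  shows "(a + b) ^ DIM('a) \<le> measure lebesgue (X + Y)"
  by (rule brunn_minkowski[OF X Y compact_frontier_sum(2)[OF X Y]])
     (use a b in \<open>auto intro: set_plus_intro\<close>)

lemma max_powers_abs:
  fixes a b :: real
  assumes "n > 0"
  shows "max (a - b) 0 ^ n + max (b - a) 0 ^ n = \<bar>a - b\<bar> ^ n"
  using assms by (auto simp: max_def abs_if)

lemma measure_sum_le:
  fixes X Y :: "'a::euclidean_space set"
  assumes X: "compact X" "connected (frontier X)" and Y: "compact Y" "connected (frontier Y)"
    and ne: "X \<noteq> {}" "Y \<noteq> {}"
  shows "measure lebesgue (X + Y) \<le> measure lebesgue (frontier X + frontier Y)
     + measure lebesgue (mink_diff X Y) + measure lebesgue (mink_diff Y X)"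
proof -
  note c = compact_frontier_sum[OF X(1) Y(1)] compact_mink_diff[OF X(1) ne(2)] compact_mink_diff[OF Y(1) ne(1)]
  note m = c[THEN lmeasurable_compact]
  have "measure lebesgue (X + Y)
     \<le> measure lebesgue ((frontier X + frontier Y) \<union> mink_diff X Y \<union> mink_diff Y X)"
    using m by (intro measure_mono_fmeasurable sum_subset_frontier_sum X Y fmeasurable.Un) auto
  also have "\<dots> \<le> measure lebesgue ((frontier X + frontier Y) \<union> mink_diff X Y) + measure lebesgue (mink_diff Y X)"
    using m by (intro measure_Un_le) auto
  also have "measure lebesgue ((frontier X + frontier Y) \<union> mink_diff X Y)
     \<le> measure lebesgue (frontier X + frontier Y) + measure lebesgue (mink_diff X Y)"
    using m by (intro measure_Un_le) auto
  finally show ?thesis by simp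
qed

lemma frontier_sum_volume:
  fixes X Y :: "'a::euclidean_space set"
  assumes X: "compact X" "connected (frontier X)" and Y: "compact Y" "connected (frontier Y)"
    and a: "0 < a" "measure lebesgue X = a ^ DIM('a)" and b: "0 < b" "measure lebesgue Y = b ^ DIM('a)"
  shows "power_gap DIM('a) a b \<le> measure lebesgue (frontier X + frontier Y)"
proof -
  have ne: "X \<noteq> {}" "Y \<noteq> {}" using a b by auto
  show ?thesis
    using measure_sum_le[OF X Y ne] measure_sum_ge[OF X(1) Y(1) a b]
      measure_mink_diff_le[OF X(1) Y(1) a b] measure_mink_diff_le[OF Y(1) X(1) b a]
      max_powers_abs[of "DIM('a)" a b] by (simp add: power_gap_def)
qed

section \<open>Equality in the volume bound for a sum of two boundaries\<close>

lemma convex_body_eq_of_subset: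
  fixes X Z :: "'a::euclidean_space set"
  assumes X: "compact X" "convex X" "interior X \<noteq> {}" and Z: "compact Z" "Z \<subseteq> X"
    and m: "measure lebesgue X \<le> measure lebesgue Z"
  shows "X = Z"
proof (rule ccontr)
  assume "X \<noteq> Z"
  then obtain x where x: "x \<in> X" "x \<notin> Z" using Z by auto
  have op: "open (interior X \<inter> - Z)" using Z by (intro open_Int) (auto simp: compact_imp_closed)
  have "x \<in> closure (interior X)"
    using x convex_closure_interior[OF X(2,3)] closure_subset by auto
  then have ne: "interior X \<inter> - Z \<noteq> {}"
    using x Z(1) open_Int_closure_eq_empty[of "- Z" "interior X"] compact_imp_closed[OF Z(1)] by blast
  have mX: "X \<in> lmeasurable" and mZ: "Z \<in> lmeasurable" using X Z lmeasurable_compact by auto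
  have "measure lebesgue (X - Z) = measure lebesgue X - measure lebesgue Z"
    by (rule measurable_measure_Diff) (use mX mZ Z in auto)
  then have "measure lebesgue (X - Z) = 0" using m measure_nonneg[of lebesgue "X - Z"] by linarith
  then have "negligible (X - Z)" using mX mZ by (simp add: negligible_iff_measure0 fmeasurable.Diff)
  then have "negligible (interior X \<inter> - Z)"
    by (rule negligible_subset) (use interior_subset in blast)
  then show False using open_not_negligible[OF op ne] by blast
qed

text \<open>If \<open>b < a\<close>, the missed points fill a positive volume and equality in
  Brunn-Minkowski makes \<open>mink_diff X Y\<close> a homothet of -Y. For \<open>a = b\<close> that
  set is null and reveals no symmetry.\<close>

lemma frontier_sum_volume_equality:
  fixes X Y :: "'a::euclidean_space set"
  assumes dim: "DIM('a) \<ge> 2"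
    and X: "compact X" "convex X" "interior X \<noteq> {}" "connected (frontier X)"
    and Y: "compact Y" "convex Y" "interior Y \<noteq> {}" "connected (frontier Y)"
    and a: "0 < a" "measure lebesgue X = a ^ DIM('a)" and b: "0 < b" "measure lebesgue Y = b ^ DIM('a)"
    and le: "measure lebesgue (frontier X + frontier Y) \<le> power_gap DIM('a) a b"
  shows "\<exists>w. X = (\<lambda>y. (a / b) *\<^sub>R y + w) ` Y"
    and "b < a \<Longrightarrow> \<exists>s. Y = (\<lambda>y. s - y) ` Y"
proof -
  let ?n = "DIM('a)"
  have ne: "X \<noteq> {}" "Y \<noteq> {}" using a b by auto
  note c = compact_frontier_sum[OF X(1) Y(1)] compact_mink_diff[OF X(1) ne(2)] compact_mink_diff[OF Y(1) ne(1)]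
  note bounds = measure_sum_le[OF X(1,4) Y(1,4) ne] measure_sum_ge[OF X(1) Y(1) a b]
    measure_mink_diff_le[OF X(1) Y(1) a b] measure_mink_diff_le[OF Y(1) X(1) b a]
    max_powers_abs[of ?n a b] le
  have "measure lebesgue (X + Y) \<le> (a + b) ^ ?n" using bounds by (simp add: power_gap_def)
  then show ex: "\<exists>w. X = (\<lambda>y. (a / b) *\<^sub>R y + w) ` Y"
    by (intro brunn_minkowski_equality[OF dim X(1-3) Y(1-3) c(2) _ a(1) b(1) a(2) b(2)])
       (auto intro: set_plus_intro)
  assume ba: "b < a"
  let ?D = "mink_diff X Y" and ?Y = "uminus ` Y"
  have "max (b - a) 0 ^ ?n = 0" using ba by simp
  then have mD: "measure lebesgue ?D = (a - b) ^ ?n" using bounds ba by (simp add: power_gap_def power_0_left)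
  have "\<not> negligible ?D" using mD ba by (auto dest: negligible_imp_measure0)
  then have iD: "interior ?D \<noteq> {}"
    using negligible_convex_interior[OF convex_mink_diff[OF X(2), of Y]] by simp
  have Y': "compact ?Y" "convex ?Y" "interior ?Y \<noteq> {}"
    using Y by (auto simp: compact_negations convex_negations interior_negations)
  have mY': "measure lebesgue ?Y = b ^ ?n" using measure_uminus_image[OF Y(1)] b by simp
  have "\<exists>w. ?D = (\<lambda>y. ((a - b) / b) *\<^sub>R y + w) ` ?Y"
    by (rule brunn_minkowski_equality[OF dim c(3) convex_mink_diff[OF X(2)] iD Y' X(1) _ _ b(1) mD mY'])
       (use ba a in \<open>auto simp: mink_diff_def\<close>)
  then obtain w' where w': "?D = (\<lambda>y. ((a - b) / b) *\<^sub>R y + w') ` ?Y" by auto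
  \<comment> \<open>The sum of \<open>mink_diff X Y\<close> and -Y, again a homothet of -Y, with
    factor (a - b)/b + 1 = a/b. It lies in \<open>X\<close> and has the same volume, so it is
    \<open>X\<close>.\<close>
  define Z where "Z = (\<lambda>y. (a / b) *\<^sub>R y + w') ` ?Y"
  have ZX: "Z \<subseteq> X"
  proof
    fix z assume "z \<in> Z"
    then obtain y where y: "y \<in> Y" "z = (a / b) *\<^sub>R (- y) + w'" by (auto simp: Z_def)
    have "((a - b) / b) *\<^sub>R (- y) + w' \<in> ?D" unfolding w' using y(1) by (intro imageI)
    then have "((a - b) / b) *\<^sub>R (- y) + w' - y \<in> X" using y by (simp add: mink_diff_def)
    moreover have "((a - b) / b) *\<^sub>R (- y) + w' - y = z"
      using b(1) by (simp add: y(2) diff_divide_distrib scaleR_diff_left)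
    ultimately show "z \<in> X" by simp
  qed
  have cZ: "compact Z" unfolding Z_def using Y(1) by (intro compact_continuous_image continuous_intros)
  have mZ: "measure lebesgue Z = a ^ ?n"
    unfolding Z_def measure_scaleR_image[OF Y'(1)] mY' using a b by (simp add: power_divide)
  have XZ: "X = Z" by (rule convex_body_eq_of_subset[OF X(1-3) cZ ZX]) (simp add: mZ a)
  obtain w where w: "X = (\<lambda>y. (a / b) *\<^sub>R y + w) ` Y" using ex by auto
  \<comment> \<open>\<open>h\<close> undoes the homothety from \<open>Y\<close> to \<open>X\<close>;
    applied to the description of \<open>X\<close> by -Y it exhibits \<open>Y\<close> as its own
    reflection in a point.\<close>
  define h where "h x = (b / a) *\<^sub>R (x - w)" for x :: 'a
  have r: "(b / a) * (a / b) = 1" using a b by simp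
  have "h ` X = Y" unfolding w h_def image_image using a b by simp
  moreover have "h ` X = (\<lambda>y. (b / a) *\<^sub>R (w' - w) - y) ` Y"
    unfolding XZ Z_def h_def image_image using a b by (simp add: algebra_simps)
  ultimately show "\<exists>s. Y = (\<lambda>y. s - y) ` Y" by metis
qed

text \<open>The converse of the equality case. The sum of boundaries lies in a translate of (a + b)
  M and, for \<open>a \<noteq> b\<close>, avoids the equally translated open set |a - b| interior M:
  otherwise a boundary point of \<open>M\<close> would be a proper convex combination of an interior
  point and, by symmetry, the reflection of a point of \<open>M\<close>.\<close>

lemma frontier_sum_volume_symmetric:
  fixes M :: "'a::euclidean_space set"
  assumes M: "compact M" "convex M" "interior M \<noteq> {}" and sym: "M = uminus ` M"
    and a: "0 < a" and b: "0 < b"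
  shows "measure lebesgue (frontier ((\<lambda>x. a *\<^sub>R x + v) ` M) + frontier ((\<lambda>x. b *\<^sub>R x + w) ` M))
     \<le> power_gap DIM('a) a b * measure lebesgue M"
proof -
  let ?n = "DIM('a)"
  define c where "c = \<bar>a - b\<bar>"
  define S where "S = (\<lambda>x. (a + b) *\<^sub>R x + (v + w)) ` M"
  define E where "E = (\<lambda>x. c *\<^sub>R x + (v + w)) ` interior M"
  have symD: "- x \<in> M" if "x \<in> M" for x using that sym by blast
  have closedM: "closed M" using M by (simp add: compact_imp_closed)
  have frM: "frontier M \<subseteq> M" using closedM by (simp add: frontier_subset_eq)
  have M0: "0 \<in> M"
  proof -
    obtain x where x: "x \<in> M" using M(3) interior_subset by blast
    have "(1/2) *\<^sub>R x + (1/2) *\<^sub>R (- x) \<in> M" using x symD by (intro convexD[OF M(2)]) auto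
    then show ?thesis by simp
  qed
  have shrink: "s *\<^sub>R x \<in> M" if "x \<in> M" "0 \<le> s" "s \<le> 1" for x s
    using convexD[OF M(2) that(1) M0, of s "1 - s"] that by simp
  have key: "False" if m: "m \<in> interior M" and x: "x \<in> frontier M" and y: "y \<in> M"
    and ab: "0 < b" "b < a" and eq: "a *\<^sub>R x + b *\<^sub>R y = (a - b) *\<^sub>R m" for x y m and a b :: real
  proof -
    have "x = (1 / a) *\<^sub>R (a *\<^sub>R x)" using ab by simp
    also have "a *\<^sub>R x = (a - b) *\<^sub>R m + b *\<^sub>R (- y)" using eq by (simp add: algebra_simps)
    finally have "x = ((a - b) / a) *\<^sub>R m + (b / a) *\<^sub>R (- y)"
      using ab by (simp add: scaleR_add_right scaleR_diff_right)
    then have xe: "x = - y - ((a - b) / a) *\<^sub>R (- y - m)"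
      using ab by (simp add: diff_divide_distrib algebra_simps)
    have "- y - ((a - b) / a) *\<^sub>R (- y - m) \<in> interior M"
      by (rule mem_interior_convex_shrink[OF M(2) m symD[OF y]]) (use ab in auto)
    then show False using x xe by (simp add: frontier_def)
  qed
  have ES: "E \<subseteq> S"
  proof
    fix z assume "z \<in> E"
    then obtain m where m: "m \<in> interior M" "z = c *\<^sub>R m + (v + w)" by (auto simp: E_def)
    have "(c / (a + b)) *\<^sub>R m \<in> M"
      using m interior_subset a b by (intro shrink) (auto simp: c_def)
    then show "z \<in> S" using a b m(2) unfolding S_def by (intro image_eqI[of _ _ "(c / (a + b)) *\<^sub>R m"]) auto
  qed
  \<comment> \<open>For \<open>a = b\<close> the set \<open>E\<close> shrinks to a single point,
    which the sum of boundaries can contain; nothing is removed then, at no cost in volume.\<close>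
  have sub: "frontier ((\<lambda>x. a *\<^sub>R x + v) ` M) + frontier ((\<lambda>x. b *\<^sub>R x + w) ` M) \<subseteq> S - (if a = b then {} else E)"
  proof
    fix z assume "z \<in> frontier ((\<lambda>x. a *\<^sub>R x + v) ` M) + frontier ((\<lambda>x. b *\<^sub>R x + w) ` M)"
    then obtain x y where xy: "x \<in> frontier M" "y \<in> frontier M" "z = (a *\<^sub>R x + v) + (b *\<^sub>R y + w)"
      using frontier_affine_image(1)[of a v M] frontier_affine_image(1)[of b w M] a b
      by (auto elim!: set_plus_elim)
    have xyM: "x \<in> M" "y \<in> M" using xy frM by auto
    have "(a / (a + b)) *\<^sub>R x + (b / (a + b)) *\<^sub>R y \<in> M"
      using xyM a b by (intro convexD[OF M(2)]) (auto simp: add_divide_distrib[symmetric])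
    then have "z \<in> S" unfolding S_def xy(3) using a b
      by (intro image_eqI[of _ _ "(a / (a + b)) *\<^sub>R x + (b / (a + b)) *\<^sub>R y"]) (auto simp: scaleR_add_right)
    moreover have "z \<notin> E" if "a \<noteq> b"
    proof
      assume "z \<in> E"
      then obtain m where m: "m \<in> interior M" "z = c *\<^sub>R m + (v + w)" by (auto simp: E_def)
      then have eq: "a *\<^sub>R x + b *\<^sub>R y = c *\<^sub>R m" using xy(3) by (simp add: algebra_simps)
      show False
      proof (cases "b < a")
        case True
        then show ?thesis using key[OF m(1) xy(1) xyM(2) b True] eq by (simp add: c_def)
      next
        case False
        then have "a < b" using that by simp
        then show ?thesis using key[OF m(1) xy(2) xyM(1) a, of b] eq by (simp add: c_def add.commute)
      qed
    qed
    ultimately show "z \<in> S - (if a = b then {} else E)" by simp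
  qed
  have cS: "compact S" unfolding S_def using M by (intro compact_continuous_image continuous_intros)
  have mS: "measure lebesgue S = (a + b) ^ ?n * measure lebesgue M"
    unfolding S_def measure_scaleR_image[OF M(1)] using a b by simp
  have iM: "measure lebesgue (interior M) = measure lebesgue M"
    by (rule measure_interior) (use M compact_imp_bounded negligible_convex_frontier in auto)
  have "measure lebesgue E = c ^ ?n * measure lebesgue (interior M)"
    unfolding E_def using emeasure_lebesgue_affine[of c "v + w" "interior M"]
    by (simp add: Sigma_Algebra.measure_def enn2real_mult c_def)
  then have mE: "measure lebesgue E = c ^ ?n * measure lebesgue M" unfolding iM .
  have E: "E \<in> lmeasurable" if "a \<noteq> b"
  proof -
    have "E = interior ((\<lambda>x. c *\<^sub>R x + (v + w)) ` M)"
      unfolding E_def using that by (intro frontier_affine_image(2)[symmetric]) (simp add: c_def)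
    moreover have "bounded ((\<lambda>x. c *\<^sub>R x + (v + w)) ` M)"
      using M by (intro compact_imp_bounded compact_continuous_image continuous_intros)
    ultimately show ?thesis using bounded_subset[OF _ interior_subset] lmeasurable_open open_interior by metis
  qed
  let ?E = "if a = b then {} else E"
  have mE': "measure lebesgue ?E = c ^ ?n * measure lebesgue M" "?E \<in> lmeasurable" "?E \<subseteq> S"
    using mE E ES by (auto simp: c_def)
  have "compact (frontier ((\<lambda>x. a *\<^sub>R x + v) ` M) + frontier ((\<lambda>x. b *\<^sub>R x + w) ` M))"
    by (intro compact_frontier_sum(1) compact_continuous_image continuous_intros M)
  then have "measure lebesgue (frontier ((\<lambda>x. a *\<^sub>R x + v) ` M) + frontier ((\<lambda>x. b *\<^sub>R x + w) ` M))
     \<le> measure lebesgue (S - ?E)"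
    using fmeasurable.Diff[OF lmeasurable_compact[OF cS] mE'(2)]
    by (intro measure_mono_fmeasurable[OF sub]) (auto intro: fmeasurableD lmeasurable_compact)
  also have "\<dots> = measure lebesgue S - measure lebesgue ?E"
    by (rule measurable_measure_Diff) (use cS mE' in \<open>auto intro: lmeasurable_compact\<close>)
  also have "\<dots> = power_gap ?n a b * measure lebesgue M"
    unfolding mS mE'(1) by (simp add: power_gap_def c_def algebra_simps)
  finally show ?thesis .
qed

section \<open>The product inequality and its equality case\<close>

lemma mink_comb_frontier:
  fixes K T :: "(real ^ 'n) set"
  assumes "0 < l" "l < 1"
  shows "mink_comb l (frontier K) (frontier T) = frontier ((\<lambda>x. l *\<^sub>R x + 0) ` K) + frontier ((\<lambda>x. (1 - l) *\<^sub>R x + 0) ` T)"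
  using frontier_affine_image(1)[of l 0 K] frontier_affine_image(1)[of "1 - l" 0 T] assms
  by (simp add: mink_comb_def)

lemma scaled_body:
  fixes K :: "(real ^ 'n) set"
  assumes "compact K" "0 < r" "measure lebesgue K = k ^ CARD('n)"
  shows "compact ((\<lambda>x. r *\<^sub>R x + v) ` K)"
    "connected (frontier K) \<Longrightarrow> connected (frontier ((\<lambda>x. r *\<^sub>R x + v) ` K))"
    "measure lebesgue ((\<lambda>x. r *\<^sub>R x + v) ` K) = (r * k) ^ DIM(real ^ 'n)"
    "convex K \<Longrightarrow> convex ((\<lambda>x. r *\<^sub>R x + v) ` K)"
    "interior K \<noteq> {} \<Longrightarrow> interior ((\<lambda>x. r *\<^sub>R x + v) ` K) \<noteq> {}"
proof -
  show "compact ((\<lambda>x. r *\<^sub>R x + v) ` K)"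
    using assms by (intro compact_continuous_image continuous_intros)
  show "connected (frontier ((\<lambda>x. r *\<^sub>R x + v) ` K))" if "connected (frontier K)"
    using frontier_affine_image(1)[of r v K] assms that
    by (auto intro!: connected_continuous_image continuous_intros)
  show "measure lebesgue ((\<lambda>x. r *\<^sub>R x + v) ` K) = (r * k) ^ DIM(real ^ 'n)"
    unfolding measure_scaleR_image[OF assms(1)] using assms by (simp add: power_mult_distrib)
  show "convex ((\<lambda>x. r *\<^sub>R x + v) ` K)" if "convex K"
  proof -
    have "(\<lambda>x. r *\<^sub>R x + v) ` K = (\<lambda>x. v + r *\<^sub>R x) ` K" by (simp add: add.commute)
    then show ?thesis using convex_affinity[OF that] by simp
  qed
  show "interior ((\<lambda>x. r *\<^sub>R x + v) ` K) \<noteq> {}" if "interior K \<noteq> {}"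
    using frontier_affine_image(2)[of r v K] assms that by simp
qed

lemma mink_comb_frontier_volume:
  fixes K T :: "(real ^ 'n) set"
  assumes K: "compact K" "connected (frontier K)" and T: "compact T" "connected (frontier T)"
    and k: "0 < k" "measure lebesgue K = k ^ CARD('n)" and t: "0 < t" "measure lebesgue T = t ^ CARD('n)"
    and l: "0 < l" "l < 1"
  shows "power_gap CARD('n) (l * k) ((1 - l) * t) \<le> measure lebesgue (mink_comb l (frontier K) (frontier T))"
proof -
  have l': "0 < 1 - l" using l by simp
  note X = scaled_body[OF K(1) l(1) k(2), of 0] and Y = scaled_body[OF T(1) l' t(2), of 0]
  show ?thesis unfolding mink_comb_frontier[OF l]
    using frontier_sum_volume[OF X(1) X(2)[OF K(2)] Y(1) Y(2)[OF T(2)] _ X(3) _ Y(3)] k t l by simp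
qed

lemma point_symmetric_affine_image:
  fixes A :: "'a::real_vector set"
  assumes A: "A = (\<lambda>x. s - x) ` A" and B: "B = (\<lambda>x. r *\<^sub>R x + w) ` A"
  shows "\<exists>s. B = (\<lambda>x. s - x) ` B"
proof
  have "(\<lambda>x. (r *\<^sub>R s + 2 *\<^sub>R w) - x) ` B = (\<lambda>x. r *\<^sub>R x + w) ` (\<lambda>x. s - x) ` A"
    unfolding B image_image by (intro image_cong refl) (simp add: algebra_simps scaleR_2)
  then show "B = (\<lambda>x. (r *\<^sub>R s + 2 *\<^sub>R w) - x) ` B" using A B by simp
qed

lemma affine_image_inverse:
  fixes A :: "'a::real_vector set"
  assumes "B = (\<lambda>x. r *\<^sub>R x + w) ` A" "r \<noteq> 0"
  shows "A = (\<lambda>x. (1 / r) *\<^sub>R x + (- (1 / r)) *\<^sub>R w) ` B"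
  unfolding assms(1) image_image using assms(2) by (simp add: scaleR_add_right)

lemma mink_comb_frontier_volume_equality:
  fixes K T :: "(real ^ 'n) set"
  assumes n: "CARD('n) \<ge> 2"
    and K: "compact K" "convex K" "interior K \<noteq> {}" "connected (frontier K)"
    and T: "compact T" "convex T" "interior T \<noteq> {}" "connected (frontier T)"
    and k: "0 < k" "measure lebesgue K = k ^ CARD('n)" and t: "0 < t" "measure lebesgue T = t ^ CARD('n)"
    and l: "0 < l" "l < 1"
    and le: "measure lebesgue (mink_comb l (frontier K) (frontier T)) \<le> power_gap CARD('n) (l * k) ((1 - l) * t)"
  shows "\<exists>w. K = (\<lambda>x. (k / t) *\<^sub>R x + w) ` T"
    and "l * k \<noteq> (1 - l) * t \<Longrightarrow> \<exists>s. T = (\<lambda>x. s - x) ` T"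
proof -
  have l': "0 < 1 - l" using l by simp
  define X Y where "X = (\<lambda>x. l *\<^sub>R x + 0) ` K" and "Y = (\<lambda>x. (1 - l) *\<^sub>R x + 0) ` T"
  note X' = scaled_body[OF K(1) l(1) k(2), of 0, folded X_def]
  note Y' = scaled_body[OF T(1) l' t(2), of 0, folded Y_def]
  note X = X'(1) X'(4)[OF K(2)] X'(5)[OF K(3)] X'(2)[OF K(4)]
  note Y = Y'(1) Y'(4)[OF T(2)] Y'(5)[OF T(3)] Y'(2)[OF T(4)]
  have dim: "DIM(real ^ 'n) \<ge> 2" using n by simp
  have a: "0 < l * k" and b: "0 < (1 - l) * t" using k t l by auto
  have le': "measure lebesgue (frontier X + frontier Y) \<le> power_gap DIM(real ^ 'n) (l * k) ((1 - l) * t)"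
    using le unfolding mink_comb_frontier[OF l] X_def Y_def by simp
  have le'': "measure lebesgue (frontier Y + frontier X) \<le> power_gap DIM(real ^ 'n) ((1 - l) * t) (l * k)"
    using le' by (simp add: add.commute power_gap_commute)
  note eq = frontier_sum_volume_equality[OF dim X Y a X'(3) b Y'(3) le']
  note eq' = frontier_sum_volume_equality[OF dim Y X b Y'(3) a X'(3) le'']
  have KX: "K = (\<lambda>x. (1 / l) *\<^sub>R x + 0) ` X" and TY: "T = (\<lambda>x. (1 / (1 - l)) *\<^sub>R x + 0) ` Y"
    using l by (simp_all add: X_def Y_def image_image)
  obtain w where w: "X = (\<lambda>y. ((l * k) / ((1 - l) * t)) *\<^sub>R y + w) ` Y" using eq(1) by auto
  have KT: "K = (\<lambda>x. (k / t) *\<^sub>R x + (1 / l) *\<^sub>R w) ` T"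
    unfolding KX w Y_def image_image using l t by (simp add: scaleR_add_right)
  then show "\<exists>w. K = (\<lambda>x. (k / t) *\<^sub>R x + w) ` T" by blast
  assume "l * k \<noteq> (1 - l) * t"
  then consider "(1 - l) * t < l * k" | "l * k < (1 - l) * t" by linarith
  then show "\<exists>s. T = (\<lambda>x. s - x) ` T"
  proof cases
    case 1
    then obtain s where "Y = (\<lambda>y. s - y) ` Y" using eq(2) by auto
    then show ?thesis using TY by (rule point_symmetric_affine_image)
  next
    \<comment> \<open>Now the scaled \<open>K\<close> is the smaller body and the one found
      symmetric; the homothety carries the symmetry to \<open>T\<close>.\<close>
    case 2
    then obtain s where "X = (\<lambda>y. s - y) ` X" using eq'(2) by auto
    then have "\<exists>s. K = (\<lambda>x. s - x) ` K" using KX by (rule point_symmetric_affine_image)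
    then obtain s' where "K = (\<lambda>x. s' - x) ` K" by auto
    then show ?thesis
      by (rule point_symmetric_affine_image[OF _ affine_image_inverse[OF KT]]) (use k t in auto)
  qed
qed

lemma mink_comb_frontier_volume_symmetric:
  fixes K T M :: "(real ^ 'n) set"
  assumes M: "centrally_symmetric_body M"
    and K: "K = (\<lambda>x. a *\<^sub>R x + v) ` M" and T: "T = (\<lambda>x. b *\<^sub>R x + w) ` M"
    and a: "0 < a" and b: "0 < b" and l: "0 < l" "l < 1"
  shows "measure lebesgue (mink_comb l (frontier K) (frontier T))
     \<le> power_gap CARD('n) (l * a) ((1 - l) * b) * measure lebesgue M"
proof -
  have M': "compact M" "convex M" "interior M \<noteq> {}" "M = uminus ` M"
    using M by (auto simp: centrally_symmetric_body_def convex_body_def)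
  have "(\<lambda>x. l *\<^sub>R x + 0) ` K = (\<lambda>x. (l * a) *\<^sub>R x + l *\<^sub>R v) ` M"
    "(\<lambda>x. (1 - l) *\<^sub>R x + 0) ` T = (\<lambda>x. ((1 - l) * b) *\<^sub>R x + (1 - l) *\<^sub>R w) ` M"
    by (simp_all add: K T image_image scaleR_add_right)
  then show ?thesis unfolding mink_comb_frontier[OF l]
    using frontier_sum_volume_symmetric[OF M', of "l * a" "(1 - l) * b" "l *\<^sub>R v" "(1 - l) *\<^sub>R w"] a b l by simp
qed

lemma positive_volume:
  fixes K :: "(real ^ 'n) set"
  assumes "compact K" "convex K" "interior K \<noteq> {}"
  shows "0 < measure lebesgue K"
proof -
  have "\<not> negligible K" using negligible_convex_interior[OF assms(2)] assms(3) by simp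
  then show ?thesis using assms(1)
    by (simp add: negligible_iff_measure0 lmeasurable_compact zero_less_measure_iff)
qed

text \<open>A body with T = s - T is symmetric about s/2. The factor 1 keeps \<open>M\<close> in the
  form required by the lemmas on affine images.\<close>

lemma centrally_symmetric_recentring:
  fixes T :: "(real ^ 'n) set"
  assumes T: "convex_body T" and s: "T = (\<lambda>x. s - x) ` T"
  defines "M \<equiv> (\<lambda>x. 1 *\<^sub>R x + (- (1 / 2)) *\<^sub>R s) ` T"
  shows "centrally_symmetric_body M" "T = (\<lambda>x. x + (1 / 2) *\<^sub>R s) ` M"
proof -
  have c: "compact T" "convex T" "interior T \<noteq> {}" using T by (auto simp: convex_body_def)
  have "convex_body M"
    unfolding convex_body_def M_def
  proof (intro conjI)
    show "compact ((\<lambda>x. 1 *\<^sub>R x + (- (1 / 2)) *\<^sub>R s) ` T)"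
      using c by (intro compact_continuous_image continuous_intros)
    show "convex ((\<lambda>x. 1 *\<^sub>R x + (- (1 / 2)) *\<^sub>R s) ` T)"
      using convex_affinity[OF c(2), of "(- (1 / 2)) *\<^sub>R s" 1] by (simp add: add.commute)
    show "interior ((\<lambda>x. 1 *\<^sub>R x + (- (1 / 2)) *\<^sub>R s) ` T) \<noteq> {}"
      using frontier_affine_image(2)[of 1 "(- (1 / 2)) *\<^sub>R s" T] c by simp
  qed
  moreover have "uminus ` M = (\<lambda>x. 1 *\<^sub>R x + (- (1 / 2)) *\<^sub>R s) ` (\<lambda>x. s - x) ` T"
  proof -
    have "- (1 *\<^sub>R x + (- (1 / 2)) *\<^sub>R s) = 1 *\<^sub>R (s - x) + (- (1 / 2)) *\<^sub>R s" for x
      using scaleR_left_distrib[of "1/2" "1/2" s] by (simp add: algebra_simps)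
    then show ?thesis unfolding M_def image_image by (intro image_cong) auto
  qed
  then have "uminus ` M = M" using s by (simp add: M_def)
  ultimately show "centrally_symmetric_body M" by (simp add: centrally_symmetric_body_def)
  show "T = (\<lambda>x. x + (1 / 2) *\<^sub>R s) ` M" by (simp add: M_def image_image)
qed

theorem theorem1p3:
  fixes K T :: "(real ^ 'n) set" and l :: real
  assumes "CARD('n) \<ge> 2"
    and "compact K" and "connected (frontier K)"
    and "compact T" and "connected (frontier T)"
    and "0 < l" and "l < 1"
  shows "measure lebesgue (mink_comb l (frontier K) (frontier T))
           * measure lebesgue (mink_comb l (frontier T) (frontier K))
         \<ge> measure lebesgue K * measure lebesgue T * (1 - \<bar>1 - 2 * l\<bar> ^ CARD('n))\<^sup>2
       \<and> (convex_body K \<and> convex_body T \<and> l \<noteq> 1 / 2 \<longrightarrow>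
          (measure lebesgue (mink_comb l (frontier K) (frontier T))
             * measure lebesgue (mink_comb l (frontier T) (frontier K))
           = measure lebesgue K * measure lebesgue T * (1 - \<bar>1 - 2 * l\<bar> ^ CARD('n))\<^sup>2
           \<longleftrightarrow>
           (\<exists>M. centrally_symmetric_body M \<and> is_translation_of K M \<and> is_translation_of T M)
           \<or> (CARD('n) = 2 \<and>
              (\<exists>M H H'. centrally_symmetric_body M \<and> is_homothet_of H M \<and> is_homothet_of H' M
                 \<and> is_translation_of K H \<and> is_translation_of T H'))))"
    (is "?rhs \<le> ?P1 * ?P2 \<and> (_ \<longrightarrow> (?eq \<longleftrightarrow> ?tr \<or> ?hom))")
proof -
  let ?n = "CARD('n)"
  note n = assms(1) and K = assms(2,3) and T = assms(4,5) and l = assms(6,7)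
  note vol = mink_comb_frontier_volume[OF K T _ _ _ _ l] mink_comb_frontier_volume[OF T K _ _ _ _ l]
  have roots: "\<exists>k>0. measure lebesgue S = k ^ ?n" if "0 < measure lebesgue S" for S :: "(real ^ 'n) set"
    using that n by (intro exI[of _ "root ?n (measure lebesgue S)"]) auto
  have ineq: "?rhs \<le> ?P1 * ?P2"
  proof (cases "measure lebesgue K = 0 \<or> measure lebesgue T = 0")
    case False
    then have "0 < measure lebesgue K" "0 < measure lebesgue T"
      by (simp_all add: zero_less_measure_iff)
    then obtain k t where k: "0 < k" "measure lebesgue K = k ^ ?n" and t: "0 < t" "measure lebesgue T = t ^ ?n"
      using roots by blast
    have "?rhs \<le> power_gap ?n (l * k) ((1 - l) * t) * power_gap ?n (l * t) ((1 - l) * k)"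
      unfolding k(2) t(2) by (rule power_gap_product[OF l k(1) t(1) n])
    also have "\<dots> \<le> ?P1 * ?P2"
      using vol(1)[OF k t] vol(2)[OF t k] l k t n
      by (intro mult_mono less_imp_le[OF power_gap_pos]) auto
    finally show ?thesis .
  qed auto
  have "?eq \<longleftrightarrow> ?tr \<or> ?hom" if cb: "convex_body K" "convex_body T" and lh: "l \<noteq> 1 / 2"
  proof
    have cK: "compact K" "convex K" "interior K \<noteq> {}" and cT: "compact T" "convex T" "interior T \<noteq> {}"
      using cb by (auto simp: convex_body_def)
    assume eq: ?eq
    obtain k where k: "0 < k" "measure lebesgue K = k ^ ?n" using roots[OF positive_volume[OF cK]] by auto
    obtain t where t: "0 < t" "measure lebesgue T = t ^ ?n" using roots[OF positive_volume[OF cT]] by auto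
    let ?f = "power_gap ?n (l * k) ((1 - l) * t)" and ?g = "power_gap ?n (l * t) ((1 - l) * k)"
    have pos: "0 < ?f" "0 < ?g" using k t l n by (auto intro!: power_gap_pos)
    have num: "?rhs \<le> ?f * ?g" unfolding k(2) t(2) by (rule power_gap_product[OF l k(1) t(1) n])
    note v1 = vol(1)[OF k t] and v2 = vol(2)[OF t k]
    \<comment> \<open>Both factors are at least their gaps and the product of the gaps is at least
      the right-hand side, so equality leaves neither factor above its gap.\<close>
    have p1: "?P1 \<le> ?f"
    proof (rule ccontr)
      assume "\<not> ?thesis"
      then have "?f * ?g < ?P1 * ?P2" using pos v2 by (intro mult_less_le_imp_less) auto
      then show False using eq num by simp
    qed
    have p2: "?P2 \<le> ?g"
    proof (rule ccontr)
      assume "\<not> ?thesis"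
      then have "?f * ?g < ?P1 * ?P2" using pos v1 by (intro mult_le_less_imp_less) auto
      then show False using eq num by simp
    qed
    note e1 = mink_comb_frontier_volume_equality[OF n cK K(2) cT T(2) k t l p1]
    note e2 = mink_comb_frontier_volume_equality[OF n cT T(2) cK K(2) t k l p2]
    obtain w where w: "K = (\<lambda>x. (k / t) *\<^sub>R x + w) ` T" using e1(1) by auto
    have "\<exists>s. T = (\<lambda>x. s - x) ` T"
    proof (cases "l * k = (1 - l) * t")
      case True
      \<comment> \<open>Here \<open>l \<noteq> 1 / 2\<close> enters: if the scaled bodies had equal
        volumes in both factors, then l^2 = (1 - l)^2.\<close>
      have "l * t \<noteq> (1 - l) * k"
      proof
        assume "l * t = (1 - l) * k"
        with True have "(l * k) * (l * t) = ((1 - l) * t) * ((1 - l) * k)" by simp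
        then have "l * l = (1 - l) * (1 - l)" using k t by (simp add: ac_simps)
        then show False using lh by (simp add: algebra_simps)
      qed
      then obtain s where "K = (\<lambda>x. s - x) ` K" using e2(2) by auto
      moreover obtain w' where "T = (\<lambda>x. (t / k) *\<^sub>R x + w') ` K" using e2(1) by auto
      ultimately show ?thesis by (rule point_symmetric_affine_image)
    qed (use e1(2) in auto)
    then obtain s where s: "T = (\<lambda>x. s - x) ` T" by auto
    define M where "M = (\<lambda>x. 1 *\<^sub>R x + (- (1 / 2)) *\<^sub>R s) ` T"
    have M: "centrally_symmetric_body M" "T = (\<lambda>x. x + (1 / 2) *\<^sub>R s) ` M"
      unfolding M_def by (rule centrally_symmetric_recentring[OF cb(2) s])+
    have KM: "K = (\<lambda>x. (k / t) *\<^sub>R x + ((k / t) *\<^sub>R (1 / 2) *\<^sub>R s + w)) ` M"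
      using w unfolding M(2) image_image by (simp add: scaleR_add_right add.assoc)
    have TM: "is_translation_of T M"
      unfolding is_translation_of_def using M(2) by (metis (no_types, lifting) add.commute image_cong)
    show "?tr \<or> ?hom"
    proof (cases "?n = 2")
      case True
      let ?H = "(*\<^sub>R) (k / t) ` M"
      have "is_translation_of K ?H" unfolding is_translation_of_def
        by (rule exI[of _ "(k / t) *\<^sub>R (1 / 2) *\<^sub>R s + w"]) (subst KM, simp add: image_image add.commute)
      moreover have "is_homothet_of ?H M" unfolding is_homothet_of_def using k t by (intro exI[of _ "k / t"]) simp
      moreover have "is_homothet_of M M" unfolding is_homothet_of_def by (intro exI[of _ 1]) simp
      ultimately show ?thesis using True M(1) TM by blast
    next
      case False
      then have n3: "?n \<ge> 3" using n by simp
      \<comment> \<open>Equality for the product is also equality in the numerical inequality, which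
        from dimension three on forces equal volumes.\<close>
      have "?f * ?g \<le> ?P1 * ?P2" using pos v1 v2 by (intro mult_mono) auto
      then have "?f * ?g \<le> k ^ ?n * t ^ ?n * (1 - \<bar>1 - 2 * l\<bar> ^ ?n)\<^sup>2" using eq k t by simp
      then have "k = t" by (rule power_gap_product(2)[OF l k(1) t(1) n n3 lh])
      then have "is_translation_of K M" unfolding is_translation_of_def using k
        by (intro exI[of _ "(k / t) *\<^sub>R (1 / 2) *\<^sub>R s + w"]) (subst KM, simp add: add.commute)
      then show ?thesis using M(1) TM by blast
    qed
  next
    \<comment> \<open>Both converses at once: homothets of \<open>M\<close> attain equality whenever
      their factors \<open>a\<close>, \<open>b\<close> turn the numerical inequality into an
      equality, as they do for \<open>a = b = 1\<close> and always in the plane.\<close>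
    have conv: "?rhs = ?P1 * ?P2"
      if M: "centrally_symmetric_body M" and a: "0 < a" and b: "0 < b"
        and KM: "K = (\<lambda>x. a *\<^sub>R x + v) ` M" and TM: "T = (\<lambda>x. b *\<^sub>R x + w) ` M"
        and ab: "power_gap ?n (l * a) ((1 - l) * b) * power_gap ?n (l * b) ((1 - l) * a)
           = a ^ ?n * b ^ ?n * (1 - \<bar>1 - 2 * l\<bar> ^ ?n)\<^sup>2"
      for M a b v w
    proof (rule antisym[OF ineq])
      have cM: "compact M" using M by (simp add: centrally_symmetric_body_def convex_body_def)
      have m: "measure lebesgue K = a ^ ?n * measure lebesgue M" "measure lebesgue T = b ^ ?n * measure lebesgue M"
        unfolding KM TM measure_scaleR_image[OF cM] using a b by simp_all
      have "?P1 * ?P2 \<le> (power_gap ?n (l * a) ((1 - l) * b) * measure lebesgue M)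
          * (power_gap ?n (l * b) ((1 - l) * a) * measure lebesgue M)"
        using mink_comb_frontier_volume_symmetric[OF M KM TM a b l]
          mink_comb_frontier_volume_symmetric[OF M TM KM b a l] a b l n
        by (intro mult_mono mult_nonneg_nonneg less_imp_le[OF power_gap_pos]) auto
      also have "\<dots> = (power_gap ?n (l * a) ((1 - l) * b) * power_gap ?n (l * b) ((1 - l) * a))
          * (measure lebesgue M * measure lebesgue M)" by (simp add: ac_simps)
      also have "\<dots> = ?rhs" unfolding ab m by (simp add: ac_simps)
      finally show "?P1 * ?P2 \<le> ?rhs" .
    qed
    assume "?tr \<or> ?hom"
    then show ?eq
    proof
      assume ?tr
      then obtain M v w where M: "centrally_symmetric_body M" "K = (+) v ` M" "T = (+) w ` M"
        by (auto simp: is_translation_of_def)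
      have gap: "power_gap ?n l (1 - l) = 1 - \<bar>1 - 2 * l\<bar> ^ ?n"
        by (simp add: power_gap_def abs_minus_commute)
      show ?eq
        by (rule conv[OF M(1), of 1 1 v w, symmetric]) (auto simp: M add.commute gap power2_eq_square)
    next
      assume hom: ?hom
      then obtain M H H' where M: "centrally_symmetric_body M" and H: "is_homothet_of H M" "is_homothet_of H' M"
        "is_translation_of K H" "is_translation_of T H'" by blast
      from H obtain a b v w where ab: "0 < a" "0 < b" "K = (+) v ` (*\<^sub>R) a ` M" "T = (+) w ` (*\<^sub>R) b ` M"
        unfolding is_homothet_of_def is_translation_of_def by blast
      have n2: "?n = 2" using hom by blast
      have sq: "\<bar>1 - 2 * l\<bar>\<^sup>2 = 1 - 4 * l * (1 - l)" by (simp add: power2_eq_square algebra_simps)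
      have "power_gap ?n (l * a) ((1 - l) * b) * power_gap ?n (l * b) ((1 - l) * a)
           = a ^ ?n * b ^ ?n * (1 - \<bar>1 - 2 * l\<bar> ^ ?n)\<^sup>2"
        unfolding n2 power_gap_2 sq by (simp add: power2_eq_square)
      then show ?eq
        by (intro conv[OF M ab(1,2), of v w, symmetric]) (simp_all add: ab(3,4) image_image add.commute)
    qed
  qed
  then show ?thesis using ineq by blast
qed

end
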